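(* Let $x^0\in H$ and assume the following condition: there exist $T>0$, $\delta>0$, $c>0$ such that for all $t\in[0,T]$ and all $x\in\mathbb{R}^d\setminus H$ with $|x-x^0|\le\delta$, $$\operatorname{sgn}(x_d)\,b_d(t,x)\ge c .$$ Let $X^{\pm}$ be the solutions of $$X^\pm(t)=x^0+\int_0^t b^\pm(s,X^\pm(s))\,ds,\quad t\in[0,\tau_H^\pm],\qquad \tau_H^\pm=\inf\{t>0:\ X^\pm(t)\in H\},$$ so that $X^+$ leaves $H$ into the half-space $\{x_d>0\}$ and $X^-$ leaves $H$ into $\{x_d<0\}$. Then, as $\varepsilon\to0+$, the distribution of $X^\varepsilon(\cdot\wedge\tau_H^+\wedge\tau_H^-)$ converges weakly in $C([0,\infty),\mathbb{R}^d)$ to the measure $$p_-\,\delta_{X^-(\cdot\wedge\tau_H^+\wedge\tau_H^-)}+p_+\,\delta_{X^+(\cdot\wedge\tau_H^+\wedge\tau_H^-)},\qquad p_\pm=\frac{\pm b_d^\pm(0,x^0)}{b_d^+(0,x^0)-b_d^-(0,x^0)} .$$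
   Context: Write $x=(x_1,\dots,x_d)=(\bar x,x_d)\in\mathbb{R}^d$ and $H=\{x\in\mathbb{R}^d: x_d=0\}$. The functions $b^\pm:[0,\infty)\times\mathbb{R}^d\to\mathbb{R}^d$ are measurable, locally bounded, and satisfy a Lipschitz condition in $x$ on $\mathbb{R}^d$ (with constant independent of $t$). Set $b(t,x)=b^+(t,x)\mathbf 1_{x_d\ge0}+b^-(t,x)\mathbf 1_{x_d<0}$; $b_d$, $b_d^\pm$ denote the $d$-th coordinates. For $\varepsilon>0$, $X^\varepsilon$ is the unique strong solution of $$X^\varepsilon(t)=x^0+\int_0^t b(s,X^\varepsilon(s))\,ds+\varepsilon w(t),\quad t\ge0,$$ where $w$ is a $d$-dimensional Wiener process. The space $C([0,\infty),\mathbb{R}^d)$ carries the topology of uniform convergence on compact sets; $\delta_f$ denotes the Dirac measure at $f$, and $a\wedge b=\min(a,b)$.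
   Formalization: The formal theorem additionally assumes that t ↦ b_d^±(t,x^0) are right-continuous at t=0; without this the claim fails (d=1, b^-=-1, b^+=1 for t>0, b^+(0,·)=2 gives limit weights 1/2, not p_+=2/3). *)

theory Defs
  imports "HOL-Probability.Probability"
begin

section \<open>Drift coefficients\<close>

text \<open>Euclidean space is \<^typ>\<open>real ^ 'n\<close> with an arbitrary distinguished index \<open>d\<close> playing the role of
  the last coordinate.\<close>

definition hyperplane :: "'n::finite \<Rightarrow> (real ^ 'n) set" where
  "hyperplane d = {x. x $ d = 0}"

definition drift_coefficient :: "(real \<Rightarrow> real ^ 'n::finite \<Rightarrow> real ^ 'n) \<Rightarrow> bool" where
  "drift_coefficient f \<longleftrightarrow>
     case_prod f \<in> borel_measurable (restrict_space borel ({0..} \<times> UNIV)) \<and>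
     (\<forall>z \<in> {0..} \<times> UNIV. \<exists>r>0. bounded (case_prod f ` (ball z r \<inter> {0..} \<times> UNIV))) \<and>
     (\<exists>L. \<forall>t\<ge>0. L-lipschitz_on UNIV (f t))"

definition glued_drift ::
  "'n::finite \<Rightarrow> (real \<Rightarrow> real ^ 'n \<Rightarrow> real ^ 'n) \<Rightarrow> (real \<Rightarrow> real ^ 'n \<Rightarrow> real ^ 'n)
     \<Rightarrow> real \<Rightarrow> real ^ 'n \<Rightarrow> real ^ 'n" where
  "glued_drift d bp bm t x = (if x $ d \<ge> 0 then bp t x else bm t x)"

text \<open>\<open>X\<close> solves the integral equation on \<open>[0,\<tau>]\<close> (on \<open>[0,\<infinity>)\<close> if \<open>\<tau> = \<infinity>\<close>), where
  \<open>\<tau> = inf {t > 0. X t \<in> H}\<close>. A HOL function is total, while \<open>X\<close> is only meaningful on \<open>[0,\<tau>]\<close>;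
  hence the guard \<open>t \<le> \<tau>\<close> in the infimum. Since \<open>Inf {} = \<infinity>\<close>, the equation for \<open>\<tau>\<close> forces \<open>\<tau> > 0\<close>,
  and \<open>\<tau> < \<infinity>\<close> is then the unique positive time in \<open>[0,\<tau>]\<close> at which \<open>X\<close> is in \<open>H\<close>.\<close>

definition solves_until_return ::
  "'v set \<Rightarrow> (real \<Rightarrow> 'v \<Rightarrow> 'v) \<Rightarrow> 'v \<Rightarrow> (real \<Rightarrow> 'v::euclidean_space) \<Rightarrow> ereal \<Rightarrow> bool" where
  "solves_until_return H f x0 X \<tau> \<longleftrightarrow>
     \<tau> = Inf (ereal ` {t. 0 < t \<and> ereal t \<le> \<tau> \<and> X t \<in> H}) \<and>
     continuous_on {t. 0 \<le> t \<and> ereal t \<le> \<tau>} X \<and>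
     (\<forall>t. 0 \<le> t \<and> ereal t \<le> \<tau> \<longrightarrow> X t = x0 + (LINT s:{0..t}|lborel. f s (X s)))"

lemma solves_until_return_pos:
  assumes "solves_until_return H f x0 X \<tau>"
  shows "0 < \<tau>" and "\<And>t. 0 < t \<Longrightarrow> ereal t < \<tau> \<Longrightarrow> X t \<notin> H"
    and "\<And>r. \<tau> = ereal r \<Longrightarrow> X r \<in> H"
proof -
  let ?S = "ereal ` {t. 0 < t \<and> ereal t \<le> \<tau> \<and> X t \<in> H}"
  have eq: "\<tau> = Inf ?S"
    using assms by (simp add: solves_until_return_def)
  show "X t \<notin> H" if "0 < t" "ereal t < \<tau>" for t
  proof
    assume "X t \<in> H"
    with that have "ereal t \<in> ?S" by auto
    then have "Inf ?S \<le> ereal t" by (rule Inf_lower)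
    with eq that show False by simp
  qed
  have only: "s = \<tau>" if "s \<in> ?S" for s
    using that eq Inf_lower[of s ?S] by auto
  have cases: "\<tau> = \<infinity> \<or> \<tau> \<in> ?S"
  proof (cases "?S = {}")
    case True
    then have "Inf ?S = \<infinity>" by (simp only: Inf_empty top_ereal_def)
    with eq show ?thesis by simp
  next
    case False
    then show ?thesis using only by blast
  qed
  then show "0 < \<tau>" by auto
  show "X r \<in> H" if "\<tau> = ereal r" for r
    using cases that by auto
qed

section \<open>Wiener process and strong solutions\<close>

text \<open>Standard Wiener process with index set \<open>[0,\<infinity>)\<close>; values at negative times are irrelevant.\<close>

definition wiener_process :: "'a measure \<Rightarrow> (real \<Rightarrow> 'a \<Rightarrow> real ^ 'n::finite) \<Rightarrow> bool" where
  "wiener_process M w \<longleftrightarrow>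
     prob_space M \<and>
     (\<forall>t\<ge>0. w t \<in> borel_measurable M) \<and>
     (AE \<omega> in M. w 0 \<omega> = 0) \<and>
     (\<forall>s t. 0 \<le> s \<and> s < t \<longrightarrow>
        distributed M lborel (\<lambda>\<omega>. w t \<omega> - w s \<omega>)
          (\<lambda>x. ennreal (\<Prod>i\<in>UNIV. normal_density 0 (sqrt (t - s)) (x $ i)))) \<and>
     (\<forall>(n::nat) (u::nat \<Rightarrow> real). 0 \<le> u 0 \<and> (\<forall>k<n. u k \<le> u (Suc k)) \<longrightarrow>
        prob_space.indep_vars M (\<lambda>_. borel) (\<lambda>k \<omega>. w (u (Suc k)) \<omega> - w (u k) \<omega>) {..<n}) \<and>
     (AE \<omega> in M. continuous_on {0..} (\<lambda>t. w t \<omega>))"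

definition augmented_filtration ::
  "'a measure \<Rightarrow> (real \<Rightarrow> 'a \<Rightarrow> 'v::topological_space) \<Rightarrow> real \<Rightarrow> 'a measure" where
  "augmented_filtration M w t =
     sigma (space M) ({w s -` A \<inter> space M | s A. 0 \<le> s \<and> s \<le> t \<and> A \<in> sets borel} \<union> null_sets M)"

definition strong_solution ::
  "'a measure \<Rightarrow> (real \<Rightarrow> 'a \<Rightarrow> real ^ 'n::finite) \<Rightarrow> (real \<Rightarrow> real ^ 'n \<Rightarrow> real ^ 'n)
     \<Rightarrow> real \<Rightarrow> real ^ 'n \<Rightarrow> (real \<Rightarrow> 'a \<Rightarrow> real ^ 'n) \<Rightarrow> bool" where
  "strong_solution M w b \<epsilon> x0 X \<longleftrightarrow>
     (\<forall>t\<ge>0. X t \<in> borel_measurable (augmented_filtration M w t)) \<and>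
     (\<forall>\<omega>\<in>space M. continuous_on {0..} (\<lambda>t. X t \<omega>)) \<and>
     (AE \<omega> in M. \<forall>t\<ge>0.
        X t \<omega> = x0 + (LINT s:{0..t}|lborel. b s (X s \<omega>)) + \<epsilon> *\<^sub>R w t \<omega>)"

section \<open>The path space \<open>C([0,\<infinity>), V)\<close> and weak convergence\<close>

text \<open>Paths are extensional (equal to \<^const>\<open>undefined\<close> off \<open>[0,\<infinity>)\<close>), so that equality of paths is
  equality on \<open>[0,\<infinity>)\<close>.\<close>

definition paths :: "(real \<Rightarrow> 'v::metric_space) set" where
  "paths = {f \<in> extensional {0..}. continuous_on {0..} f}"

definition path_open :: "(real \<Rightarrow> 'v::metric_space) set \<Rightarrow> bool" where
  "path_open U \<longleftrightarrow>
     U \<subseteq> paths \<and>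
     (\<forall>f\<in>U. \<exists>K e. compact K \<and> K \<subseteq> {0..} \<and> 0 < e \<and>
        (\<forall>g\<in>paths. (\<forall>t\<in>K. dist (g t) (f t) < e) \<longrightarrow> g \<in> U))"

definition path_topology :: "(real \<Rightarrow> 'v::metric_space) topology" where
  "path_topology = topology path_open"

lemma istopology_path_open: "istopology path_open"
  unfolding istopology_def
proof (intro conjI allI impI)
  fix S T :: "(real \<Rightarrow> 'v::metric_space) set"
  assume S: "path_open S" and T: "path_open T"
  show "path_open (S \<inter> T)"
    unfolding path_open_def
  proof (intro conjI ballI)
    show "S \<inter> T \<subseteq> paths" using S by (auto simp: path_open_def)
    fix f assume f: "f \<in> S \<inter> T"
    obtain K e where K: "compact K" "K \<subseteq> {0..}" "0 < e"
      "\<And>g. g \<in> paths \<Longrightarrow> \<forall>t\<in>K. dist (g t) (f t) < e \<Longrightarrow> g \<in> S"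
      using S f unfolding path_open_def by (metis IntE)
    obtain L r where L: "compact L" "L \<subseteq> {0..}" "0 < r"
      "\<And>g. g \<in> paths \<Longrightarrow> \<forall>t\<in>L. dist (g t) (f t) < r \<Longrightarrow> g \<in> T"
      using T f unfolding path_open_def by (metis IntE)
    show "\<exists>K e. compact K \<and> K \<subseteq> {0..} \<and> 0 < e \<and>
        (\<forall>g\<in>paths. (\<forall>t\<in>K. dist (g t) (f t) < e) \<longrightarrow> g \<in> S \<inter> T)"
      using K L by (intro exI[of _ "K \<union> L"] exI[of _ "min e r"]) (auto simp: compact_Un)
  qed
next
  fix \<K> :: "(real \<Rightarrow> 'v::metric_space) set set"
  assume *: "\<forall>K\<in>\<K>. path_open K"
  show "path_open (\<Union>\<K>)"
    unfolding path_open_def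
  proof (intro conjI ballI)
    show "\<Union>\<K> \<subseteq> paths" using * by (auto simp: path_open_def)
    fix f assume "f \<in> \<Union>\<K>"
    then obtain U where U: "U \<in> \<K>" "f \<in> U" by blast
    with * obtain K e where "compact K" "K \<subseteq> {0..}" "0 < e"
      "\<And>g. g \<in> paths \<Longrightarrow> \<forall>t\<in>K. dist (g t) (f t) < e \<Longrightarrow> g \<in> U"
      unfolding path_open_def by metis
    with U show "\<exists>K e. compact K \<and> K \<subseteq> {0..} \<and> 0 < e \<and>
        (\<forall>g\<in>paths. (\<forall>t\<in>K. dist (g t) (f t) < e) \<longrightarrow> g \<in> \<Union>\<K>)"
      by blast
  qed
qed

lemma openin_path_topology: "openin path_topology U \<longleftrightarrow> path_open U"
  by (simp add: path_topology_def topology_inverse' istopology_path_open)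

lemma topspace_path_topology: "topspace path_topology = (paths :: (real \<Rightarrow> 'v::metric_space) set)"
proof -
  have "path_open (paths :: (real \<Rightarrow> 'v) set)"
    unfolding path_open_def by (auto intro!: exI[of _ "{}"] exI[of _ "1::real"])
  then have "paths \<subseteq> topspace (path_topology :: (real \<Rightarrow> 'v) topology)"
    by (intro openin_subset) (simp add: openin_path_topology)
  moreover have "topspace (path_topology :: (real \<Rightarrow> 'v) topology) \<subseteq> paths"
    using openin_topspace[of "path_topology :: (real \<Rightarrow> 'v) topology"]
    unfolding openin_path_topology path_open_def by (rule conjunct1)
  ultimately show ?thesis by blast
qed

definition borel_of :: "'b topology \<Rightarrow> 'b measure" where
  "borel_of T = sigma (topspace T) {U. openin T U}"

definition weakly_converges ::
  "'b topology \<Rightarrow> ('i \<Rightarrow> 'b measure) \<Rightarrow> 'b measure \<Rightarrow> 'i filter \<Rightarrow> bool" where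
  "weakly_converges T \<mu> \<nu> F \<longleftrightarrow>
     (\<forall>\<^sub>F i in F. prob_space (\<mu> i) \<and> sets (\<mu> i) = sets (borel_of T)) \<and>
     prob_space \<nu> \<and> sets \<nu> = sets (borel_of T) \<and>
     (\<forall>\<phi>. continuous_map T euclideanreal \<phi> \<and> bounded (\<phi> ` topspace T) \<longrightarrow>
        ((\<lambda>i. LINT f|\<mu> i. \<phi> f) \<longlongrightarrow> (LINT f|\<nu>. \<phi> f)) F)"

text \<open>Sum of two measures on the same \<open>\<sigma>\<close>-algebra.\<close>

definition add_measure :: "'b measure \<Rightarrow> 'b measure \<Rightarrow> 'b measure" where
  "add_measure M N = measure_of (space M) (sets M) (\<lambda>A. emeasure M A + emeasure N A)"

lemma sets_add_measure [simp]: "sets (add_measure M N) = sets M"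
  by (simp add: add_measure_def)

lemma emeasure_add_measure:
  assumes "sets N = sets M" and "A \<in> sets M"
  shows "emeasure (add_measure M N) A = emeasure M A + emeasure N A"
proof (rule emeasure_measure_of[OF add_measure_def])
  show "sets M \<subseteq> Pow (space M)" by (rule sets.space_closed)
  show "A \<in> sets (add_measure M N)" using assms by simp
  show "positive (sets (add_measure M N)) (\<lambda>A. emeasure M A + emeasure N A)"
    by (simp add: positive_def)
  show "countably_additive (sets (add_measure M N)) (\<lambda>A. emeasure M A + emeasure N A)"
  proof (rule countably_additiveI)
    fix B :: "nat \<Rightarrow> _"
    assume "range B \<subseteq> sets (add_measure M N)" "disjoint_family B"
    then show "(\<Sum>i. emeasure M (B i) + emeasure N (B i)) = emeasure M (\<Union> (range B)) + emeasure N (\<Union> (range B))"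
      using assms by (simp add: suminf_add[symmetric] suminf_emeasure)
  qed
qed

text \<open>The path \<open>x(\<cdot> \<and> \<tau>)\<close>, for \<open>\<tau> \<in> [0,\<infinity>]\<close>.\<close>

definition stopped_path :: "ereal \<Rightarrow> (real \<Rightarrow> 'v) \<Rightarrow> real \<Rightarrow> 'v" where
  "stopped_path \<tau> x = (\<lambda>t\<in>{0..}. x (real_of_ereal (min (ereal t) \<tau>)))"

end

theory Submission
  imports Defs "HOL-Real_Asymp.Real_Asymp"
begin

text \<open>
  By symmetry, and because \<open>p\<^sub>+ + p\<^sub>- = 1\<close>, it suffices to bound from below the limiting probability
  that the solution follows a given branch. Only the sign of \<open>x\<^sub>d\<close> at one small time \<open>t0\<close> matters: if
  \<open>\<sigma> x\<^sub>d(t0) \<ge> \<rho> t0 / 2\<close> and the noise is small, the repulsive drift and a Gronwall estimate keep the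
  solution close to the corresponding branch.

  Up to time \<open>t0\<close> the drift of \<open>y(t) = \<sigma> x\<^sub>d(t) - \<rho> t\<close> is at least \<open>\<beta>(y)\<close>, where \<open>\<beta> = p\<close> on the positive and
  \<open>\<beta> = -m\<close> on the nonpositive axis; as \<open>\<beta>\<close> is monotone, \<open>y\<close> dominates an Euler scheme with drift \<open>\<beta>\<close>
  driven by the increments of the Wiener process. This needs only the independence of these increments,
  no stochastic calculus. For the Euler scheme, exponentials \<open>exp (- 2 p v / \<epsilon>\<^sup>2)\<close> and \<open>exp (2 m v / \<epsilon>\<^sup>2)\<close>
  are preserved in expectation on the respective sides, which yields a bounded function of the scheme that
  is a submartingale up to an error vanishing with the step size for each fixed \<open>\<epsilon>\<close>. Its values at
  \<open>0\<close> and \<open>\<plusminus>\<infinity>\<close> give the probability \<open>p / (p + m)\<close> in the limit.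
\<close>

section \<open>Exponential moments of Wiener increments\<close>

text \<open>The coefficients are merely measurable in time, so changing them at time 0 alone would
  alter p_+ and p_- but none of the solutions. Right continuity of the normal components at
  \<open>x0\<close> is what ties their values at time 0 to the motion just after it. The
  discontinuous drift is known only up to errors near (0, \<open>x0\<close>), so every comparison is
  one-sided and carries a slack \<open>\<rho>\<close>. Subtracting \<open>\<rho> * t\<close> turns
  "y is not far below 0" into a strictly positive height of x, so no estimate at the exact level 0
  is required. The origin of the probability: let U be the potential, with U(0) = 0, U \<le>
  \<open>\<kappa>\<close> everywhere, and U \<le> exp (- 2 m r / \<open>\<epsilon>\<^sup>2\<close>)
  - 1 below the level -r. If the expectation of U is nearly nonnegative at the final time, the
  scheme ends above -r with probability at least about 1 / (\<open>\<kappa>\<close> + 1), which is p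
  / (p + m) for \<open>\<kappa>\<close> = m / p. The limits are taken in the order: step size for
  fixed \<open>\<epsilon>\<close>, then \<open>\<epsilon>\<close>, then
  \<open>\<rho>\<close>.\<close>

lemma nn_integral_exp_normal_density:
  fixes l \<sigma> :: real
  assumes "0 < \<sigma>"
  shows "(\<integral>\<^sup>+x. ennreal (normal_density 0 \<sigma> x * exp (l * x)) \<partial>lborel) = ennreal (exp (l\<^sup>2 * \<sigma>\<^sup>2 / 2))"
proof -
  \<comment> \<open>Completing the square: exponential tilting moves the mean of the Gaussian from 0
    to \<open>l * \<sigma>\<^sup>2\<close> and leaves a constant factor.\<close>
  have eq: "normal_density 0 \<sigma> x * exp (l * x) = exp (l\<^sup>2 * \<sigma>\<^sup>2 / 2) * normal_density (l * \<sigma>\<^sup>2) \<sigma> x" for x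
  proof -
    have "- (x\<^sup>2) / (2 * \<sigma>\<^sup>2) + l * x = l\<^sup>2 * \<sigma>\<^sup>2 / 2 + - ((x - l * \<sigma>\<^sup>2)\<^sup>2) / (2 * \<sigma>\<^sup>2)"
      using assms by (simp add: field_simps power2_eq_square)
    then have "exp (- (x\<^sup>2) / (2 * \<sigma>\<^sup>2)) * exp (l * x)
        = exp (l\<^sup>2 * \<sigma>\<^sup>2 / 2) * exp (- ((x - l * \<sigma>\<^sup>2)\<^sup>2) / (2 * \<sigma>\<^sup>2))"
      by (simp only: exp_add[symmetric])
    then show ?thesis by (simp add: normal_density_def)
  qed
  have "(\<integral>\<^sup>+x. ennreal (normal_density (l * \<sigma>\<^sup>2) \<sigma> x) \<partial>lborel) = ennreal 1"
    using assms by (intro nn_integral_eq_integral[THEN trans])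
      (auto simp: integrable_normal_density integral_normal_density)
  then show ?thesis unfolding eq
    by (simp add: ennreal_mult nn_integral_cmult)
qed

lemma prod_Basis_cart:
  fixes g :: "real ^ 'n \<Rightarrow> 'b::comm_monoid_mult"
  shows "(\<Prod>b\<in>Basis. g b) = (\<Prod>i\<in>UNIV. g (axis i 1))"
proof -
  have "(Basis :: (real ^ 'n) set) = (\<lambda>i. axis i 1) ` UNIV" by (auto simp: Basis_vec_def)
  moreover have "inj_on (\<lambda>i. axis i 1 :: real ^ 'n) UNIV" by (auto simp: inj_on_def axis_eq_axis)
  ultimately show ?thesis by (metis (no_types, lifting) prod.reindex_cong)
qed

text \<open>The density is a product over the coordinates, so by Tonelli the expectation factors and
  each coordinate other than \<open>i\<close> contributes 1. Beyond independence, these exponential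
  moments are all that the estimates use of the law of the increments.\<close>

lemma wiener_increment_mgf:
  fixes w :: "real \<Rightarrow> 'a \<Rightarrow> real ^ 'n::finite"
  assumes w: "wiener_process M w" and st: "0 \<le> s" "s < t"
  shows "integrable M (\<lambda>\<omega>. exp (l * (w t \<omega> $ i - w s \<omega> $ i)))"
    and "(\<integral>\<omega>. exp (l * (w t \<omega> $ i - w s \<omega> $ i)) \<partial>M) = exp (l\<^sup>2 * (t - s) / 2)"
proof -
  have D: "distributed M lborel (\<lambda>\<omega>. w t \<omega> - w s \<omega>)
          (\<lambda>x. ennreal (\<Prod>i\<in>UNIV. normal_density 0 (sqrt (t - s)) (x $ i)))"
    using w st unfolding wiener_process_def by blast
  have meas[measurable]: "w t \<in> borel_measurable M" "w s \<in> borel_measurable M"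
    using w st unfolding wiener_process_def by auto
  let ?f = "\<lambda>(b :: real^'n) y. ennreal (normal_density 0 (sqrt (t - s)) y * (if b = axis i 1 then exp (l * y) else 1))"
  have 1: "(\<integral>\<^sup>+x. ennreal (normal_density 0 (sqrt (t - s)) x) \<partial>lborel) = 1"
    using nn_integral_exp_normal_density[of "sqrt (t - s)" 0] st by simp
  have "(\<integral>\<^sup>+\<omega>. ennreal (exp (l * (w t \<omega> $ i - w s \<omega> $ i))) \<partial>M)
    = (\<integral>\<^sup>+x. ennreal (\<Prod>i\<in>UNIV. normal_density 0 (sqrt (t - s)) (x $ i)) * ennreal (exp (l * (x $ i))) \<partial>lborel)"
    using distributed_nn_integral[OF D, of "\<lambda>x. ennreal (exp (l * (x $ i)))"] by simp
  also have "\<dots> = (\<integral>\<^sup>+x. (\<Prod>b\<in>Basis. ?f b (x \<bullet> b)) \<partial>(lborel :: (real^'n) measure))"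
  proof (rule nn_integral_cong)
    fix x :: "real ^ 'n"
    have "(\<Prod>b\<in>Basis. ?f b (x \<bullet> b))
      = ennreal (\<Prod>j\<in>UNIV. normal_density 0 (sqrt (t - s)) (x $ j) * (if j = i then exp (l * x $ j) else 1))"
      by (simp add: prod_Basis_cart prod_ennreal inner_axis axis_eq_axis cong: if_cong)
    also have "\<dots> = ennreal (\<Prod>j\<in>UNIV. normal_density 0 (sqrt (t - s)) (x $ j)) * ennreal (exp (l * (x $ i)))"
      by (simp add: prod.distrib prod.delta ennreal_mult prod_nonneg)
    finally show "ennreal (\<Prod>i\<in>UNIV. normal_density 0 (sqrt (t - s)) (x $ i)) * ennreal (exp (l * (x $ i)))
      = (\<Prod>b\<in>Basis. ?f b (x \<bullet> b))" by simp
  qed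
  also have "\<dots> = (\<Prod>b\<in>Basis. (\<integral>\<^sup>+y. ?f b y \<partial>lborel))"
    by (rule nn_integral_lborel_prod) auto
  also have "\<dots> = (\<Prod>j\<in>UNIV. if j = i then ennreal (exp (l\<^sup>2 * (t - s) / 2)) else 1)"
    unfolding prod_Basis_cart
    using nn_integral_exp_normal_density[of "sqrt (t - s)" l] st 1
    by (intro prod.cong) (auto simp: axis_eq_axis)
  also have "\<dots> = ennreal (exp (l\<^sup>2 * (t - s) / 2))"
    by (simp add: prod.delta)
  finally have "(\<integral>\<^sup>+\<omega>. ennreal (exp (l * (w t \<omega> $ i - w s \<omega> $ i))) \<partial>M) = ennreal (exp (l\<^sup>2 * (t - s) / 2))" .
  then have "integrable M (\<lambda>\<omega>. exp (l * (w t \<omega> $ i - w s \<omega> $ i))) \<and>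
    (\<integral>\<omega>. exp (l * (w t \<omega> $ i - w s \<omega> $ i)) \<partial>M) = exp (l\<^sup>2 * (t - s) / 2)"
    by (subst nn_integral_eq_integrable[symmetric]) (auto simp: cart_eq_inner_axis)
  then show "integrable M (\<lambda>\<omega>. exp (l * (w t \<omega> $ i - w s \<omega> $ i)))"
    and "(\<integral>\<omega>. exp (l * (w t \<omega> $ i - w s \<omega> $ i)) \<partial>M) = exp (l\<^sup>2 * (t - s) / 2)" by auto
qed

section \<open>Measurability in the path space\<close>

text \<open>By continuity the condition can be tested on a countable dense subset of the open
  interval. That interval is empty unless \<open>a < b\<close>, hence the separate case.\<close>

lemma sets_Collect_le_interval:
  fixes F :: "real \<Rightarrow> 'a \<Rightarrow> real"
  assumes meas: "\<And>t. t \<in> {a..b} \<Longrightarrow> F t \<in> borel_measurable M"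
    and cont: "\<And>\<omega>. \<omega> \<in> space M \<Longrightarrow> continuous_on {a..b} (\<lambda>t. F t \<omega>)"
  shows "{\<omega> \<in> space M. \<forall>t\<in>{a..b}. F t \<omega> \<le> c} \<in> sets M"
proof (cases "a < b")
  case False
  then have "{a..b} = {} \<or> {a..b} = {a}" by auto
  then show ?thesis
  proof
    assume "{a..b} = {a}"
    then have [measurable]: "F a \<in> borel_measurable M" using meas by blast
    have "{\<omega> \<in> space M. F a \<omega> \<le> c} \<in> sets M" by measurable
    then show ?thesis unfolding \<open>{a..b} = {a}\<close> by simp
  next
    assume "{a..b} = {}"
    show ?thesis unfolding \<open>{a..b} = {}\<close> by simp
  qed
next
  case True
  obtain D :: "real set" where D: "countable D" "\<And>U. open U \<Longrightarrow> U \<noteq> {} \<Longrightarrow> \<exists>d\<in>D. d \<in> U"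
    using countable_dense_exists by metis
  let ?D = "D \<inter> {a<..<b}"
  have "(\<forall>t\<in>{a..b}. F t \<omega> \<le> c) \<longleftrightarrow> (\<forall>t\<in>?D. F t \<omega> \<le> c)" if \<omega>: "\<omega> \<in> space M" for \<omega>
  proof
    assume R: "\<forall>t\<in>?D. F t \<omega> \<le> c"
    show "\<forall>t\<in>{a..b}. F t \<omega> \<le> c"
    proof (rule ccontr)
      assume "\<not> (\<forall>t\<in>{a..b}. F t \<omega> \<le> c)"
      then obtain t0 where t0: "t0 \<in> {a..b}" "F t0 \<omega> > c" by auto
      obtain U where U: "open U" "U \<inter> {a..b} = (\<lambda>t. F t \<omega>) -` {c<..} \<inter> {a..b}"
        using cont[OF \<omega>] unfolding continuous_on_open_invariant by (meson open_greaterThan)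
      have "t0 \<in> U \<inter> closure {a<..<b}" using t0 U True by auto
      then have "U \<inter> {a<..<b} \<noteq> {}" using U(1) open_Int_closure_eq_empty by blast
      then obtain q where "q \<in> D" "q \<in> U \<inter> {a<..<b}"
        using D(2)[of "U \<inter> {a<..<b}"] open_Int[OF U(1) open_greaterThanLessThan] by blast
      then have "q \<in> (\<lambda>t. F t \<omega>) -` {c<..} \<inter> {a..b}" "F q \<omega> \<le> c"
        unfolding U(2)[symmetric] using R by auto
      then show False by simp
    qed
  qed auto
  then have "{\<omega> \<in> space M. \<forall>t\<in>{a..b}. F t \<omega> \<le> c} = {\<omega> \<in> space M. \<forall>t\<in>?D. F t \<omega> \<le> c}" by auto
  also have "\<dots> \<in> sets M"
  proof (rule predE, rule measurable_pred_countable(1))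
    show "countable ?D" using D by auto
    fix t assume "t \<in> ?D"
    then have [measurable]: "F t \<in> borel_measurable M" by (intro meas) auto
    show "Measurable.pred M (\<lambda>\<omega>. F t \<omega> \<le> c)" by measurable
  qed
  finally show ?thesis .
qed

lemma path_open_imp_subset: "path_open U \<Longrightarrow> U \<subseteq> paths"
  unfolding path_open_def by (rule conjunct1)

text \<open>Every open set of paths is a union of tubes with values in a countable dense set, and there are only
  countably many of these.\<close>

definition step_tube :: "nat \<Rightarrow> nat \<Rightarrow> 'v::metric_space list \<Rightarrow> (real \<Rightarrow> 'v) set" where
  "step_tube T n v = {g \<in> paths. \<forall>i<length v.
     \<forall>t\<in>{real i * real T / real (length v)..real (Suc i) * real T / real (length v)}.
       dist (g t) (v ! i) \<le> 1 / real (Suc n)}"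

text \<open>Uniform continuity yields a grid on whose cells \<open>f\<close> varies by less than
  half the tube radius; the other half pays for replacing the values at grid points by elements of
  \<open>D\<close>.\<close>

lemma path_open_step_tube:
  fixes f :: "real \<Rightarrow> 'v::metric_space"
  assumes U: "path_open U" "f \<in> U" and D: "\<And>W. open W \<Longrightarrow> W \<noteq> {} \<Longrightarrow> \<exists>d\<in>D. d \<in> W"
  shows "\<exists>T n v. set v \<subseteq> D \<and> f \<in> step_tube T n v \<and> step_tube T n v \<subseteq> U"
proof -
  obtain K e where K: "compact K" "K \<subseteq> {0..}" "0 < e"
    "\<And>g. g \<in> paths \<Longrightarrow> \<forall>t\<in>K. dist (g t) (f t) < e \<Longrightarrow> g \<in> U"
    using U unfolding path_open_def by metis
  have "f \<in> paths" using path_open_imp_subset[OF U(1)] U(2) by (rule subsetD)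
  then have f: "f \<in> paths" "continuous_on {0..} f" by (auto simp: paths_def)
  obtain B where B: "\<And>t. t \<in> K \<Longrightarrow> \<bar>t\<bar> \<le> B"
    using compact_imp_bounded[OF K(1)] unfolding bounded_real by blast
  \<comment> \<open>The \<open>+ 1\<close> makes \<open>t < T\<close> strict on \<open>K\<close>, so
    that the cell index \<open>i\<close> chosen below is less than \<open>m\<close>.\<close>
  define T where "T = nat \<lceil>\<bar>B\<bar>\<rceil> + 1"
  have T: "t < real T" if "t \<in> K" for t using B[OF that] unfolding T_def by linarith
  have T0: "0 < T" unfolding T_def by simp
  \<comment> \<open>Two members of the same tube differ by up to twice its radius, hence the
    2.\<close>
  obtain n :: nat where n: "2 / e < real n" using reals_Archimedean2 by blast
  have n': "2 / real (Suc n) < e" using n K(3) by (simp add: field_simps)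
  have "uniformly_continuous_on {0..real T} f"
    by (rule compact_uniformly_continuous[OF continuous_on_subset[OF f(2)]]) auto
  then obtain \<delta> where \<delta>: "0 < \<delta>" "\<And>s t. s \<in> {0..real T} \<Longrightarrow> t \<in> {0..real T} \<Longrightarrow> dist t s < \<delta>
      \<Longrightarrow> dist (f t) (f s) < 1 / (2 * real (Suc n))"
    unfolding uniformly_continuous_on_def
    by (elim allE[where x = "1 / (2 * real (Suc n))"]) auto
  obtain m' :: nat where "real T / \<delta> < real m'" using reals_Archimedean2 by blast
  then obtain m :: nat where m: "real T / \<delta> < real m" "0 < m"
    using \<delta>(1) T0 by (intro that[of m'] gr0I) (auto simp: divide_less_0_iff)
  have m': "real T / real m < \<delta>" using m \<delta> by (simp add: field_simps)
  have "\<exists>d. d \<in> D \<and> dist (f (real i * real T / real m)) d < 1 / (2 * real (Suc n))" for i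
    using D[of "ball (f (real i * real T / real m)) (1 / (2 * real (Suc n)))"] by auto
  then obtain d where d: "\<And>i. d i \<in> D"
    "\<And>i. dist (f (real i * real T / real m)) (d i) < 1 / (2 * real (Suc n))" by metis
  define v where "v = map d [0..<m]"
  have lv: "length v = m" by (simp add: v_def)
  have vi: "v ! i = d i" if "i < m" for i using that by (simp add: v_def)
  have "f \<in> step_tube T n v"
    unfolding step_tube_def lv
  proof (intro CollectI conjI allI impI ballI f(1))
    fix i t assume i: "i < m" and t: "t \<in> {real i * real T / real m..real (Suc i) * real T / real m}"
    have le: "real (Suc i) * real T / real m \<le> real T"
    proof -
      have "real (Suc i) \<le> real m" using i by simp
      then have "real (Suc i) * real T \<le> real m * real T" by (rule mult_right_mono) simp
      then show ?thesis using m(2) by (simp add: divide_le_eq mult.commute)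
    qed
    have 0: "0 \<le> real i * real T / real m" by simp
    have "real (Suc i) * real T / real m - real i * real T / real m = real T / real m"
      by (simp add: diff_divide_distrib[symmetric] algebra_simps)
    then have "dist t (real i * real T / real m) < \<delta>"
      using t m' by (auto simp: dist_real_def)
    then have "dist (f t) (f (real i * real T / real m)) < 1 / (2 * real (Suc n))"
      using t le 0 order_trans[OF 0, of t] order_trans[OF _ le, of t] by (intro \<delta>(2)) auto
    then have "dist (f t) (d i) < 1 / (2 * real (Suc n)) + 1 / (2 * real (Suc n))"
      using d(2)[of i] dist_triangle[of "f t" "d i" "f (real i * real T / real m)"] by linarith
    also have "\<dots> = 1 / real (Suc n)" by (simp add: field_simps)
    finally show "dist (f t) (v ! i) \<le> 1 / real (Suc n)" using vi[OF i] by simp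
  qed
  moreover have "step_tube T n v \<subseteq> U"
  proof
    fix g assume g: "g \<in> step_tube T n v"
    show "g \<in> U"
    proof (rule K(4))
      show "g \<in> paths" using g by (simp add: step_tube_def)
      show "\<forall>t\<in>K. dist (g t) (f t) < e"
      proof
        fix t assume t: "t \<in> K"
        define i where "i = nat \<lfloor>t * real m / real T\<rfloor>"
        have t0: "0 \<le> t" using t K(2) by auto
        have i1: "real i \<le> t * real m / real T" "t * real m / real T < real i + 1"
          using t0 unfolding i_def by auto
        have "t * real m / real T < real m" using T[OF t] m(2) T0 by (simp add: field_simps)
        then have i: "i < m" using i1 by linarith
        have "t \<in> {real i * real T / real m..real (Suc i) * real T / real m}"
          using i1 m(2) T0 by (simp add: field_simps)
        then have "dist (g t) (v ! i) \<le> 1 / real (Suc n)" "dist (f t) (v ! i) \<le> 1 / real (Suc n)"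
          using g \<open>f \<in> step_tube T n v\<close> i unfolding step_tube_def lv by blast+
        then have "dist (g t) (f t) \<le> 2 / real (Suc n)"
          using dist_triangle2[of "g t" "f t" "v ! i"] by simp
        then show "dist (g t) (f t) < e" using n' by simp
      qed
    qed
  qed
  moreover have "set v \<subseteq> D" using d(1) unfolding v_def by auto
  ultimately show ?thesis by blast
qed

text \<open>The Borel sets could a priori exceed what the evaluations generate, since an open set is
  an arbitrary union of tubes. Second countability closes the gap: an open set is the union of the
  countably many step tubes inside it, and the preimage of each tube is measurable by continuity of
  the paths.\<close>

lemma measurable_borel_of_path_topology:
  fixes G :: "'a \<Rightarrow> real \<Rightarrow> 'v::{metric_space,second_countable_topology}"
  assumes paths: "\<And>\<omega>. \<omega> \<in> space M \<Longrightarrow> G \<omega> \<in> paths"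
    and meas: "\<And>t. 0 \<le> t \<Longrightarrow> (\<lambda>\<omega>. G \<omega> t) \<in> borel_measurable M"
  shows "G \<in> measurable M (borel_of path_topology)"
  unfolding borel_of_def topspace_path_topology
proof (rule measurable_measure_of)
  show "{U. openin path_topology U} \<subseteq> Pow paths"
    by (auto simp: openin_path_topology dest: path_open_imp_subset)
  show "G \<in> space M \<rightarrow> paths" using paths by (rule Pi_I)
  fix U :: "(real \<Rightarrow> 'v) set" assume "U \<in> {U. openin path_topology U}"
  then have U: "path_open U" by (simp add: openin_path_topology)
  obtain D :: "'v set" where D: "countable D" "\<And>W. open W \<Longrightarrow> W \<noteq> {} \<Longrightarrow> \<exists>d\<in>D. d \<in> W"
    using countable_dense_exists by metis
  define I where "I = {(T, n, v). set v \<subseteq> D \<and> step_tube T n v \<subseteq> U}"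
  have "countable I"
  proof (rule countable_subset)
    show "I \<subseteq> UNIV \<times> UNIV \<times> lists D" unfolding I_def by auto
    show "countable ((UNIV :: nat set) \<times> (UNIV :: nat set) \<times> lists D)"
      using D(1) by (intro countable_SIGMA countable_lists) auto
  qed
  have "U = (\<Union>(T, n, v)\<in>I. step_tube T n v)"
  proof (intro set_eqI iffI)
    fix f assume "f \<in> U"
    from path_open_step_tube[OF U this D(2)] show "f \<in> (\<Union>(T, n, v)\<in>I. step_tube T n v)"
      unfolding I_def by blast
  next
    fix f assume "f \<in> (\<Union>(T, n, v)\<in>I. step_tube T n v)"
    then show "f \<in> U" unfolding I_def by blast
  qed
  then have "G -` U \<inter> space M = (\<Union>(T, n, v)\<in>I. G -` step_tube T n v \<inter> space M)" by auto
  also have "\<dots> \<in> sets M"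
  proof (rule sets.countable_UN''[OF \<open>countable I\<close>], clarify)
    fix T n v
    have "G -` step_tube T n v \<inter> space M = {\<omega> \<in> space M. \<forall>i\<in>{..<length v}.
     \<forall>t\<in>{real i * real T / real (length v)..real (Suc i) * real T / real (length v)}.
       dist (G \<omega> t) (v ! i) \<le> 1 / real (Suc n)}"
      using paths unfolding step_tube_def by auto
    also have "\<dots> \<in> sets M"
    proof (rule predE, rule measurable_pred_countable(1), simp, unfold pred_def, goal_cases)
      case (1 i)
      have 0: "0 \<le> real i * real T / real (length v)" by simp
      show ?case
      proof (rule sets_Collect_le_interval)
        fix t assume "t \<in> {real i * real T / real (length v)..real (Suc i) * real T / real (length v)}"
        then have "real i * real T / real (length v) \<le> t" by simp
        with 0 have "0 \<le> t" by (rule order_trans)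
        then have [measurable]: "(\<lambda>\<omega>. G \<omega> t) \<in> borel_measurable M" by (rule meas)
        show "(\<lambda>\<omega>. dist (G \<omega> t) (v ! i)) \<in> borel_measurable M" by measurable
      next
        fix \<omega> assume "\<omega> \<in> space M"
        then have "continuous_on {0..} (G \<omega>)" using paths unfolding paths_def by auto
        then show "continuous_on {real i * real T / real (length v)..real (Suc i) * real T / real (length v)}
            (\<lambda>t. dist (G \<omega> t) (v ! i))"
        proof (intro continuous_intros, elim continuous_on_subset, intro subsetI)
          fix t assume "t \<in> {real i * real T / real (length v)..real (Suc i) * real T / real (length v)}"
          then have "real i * real T / real (length v) \<le> t" by simp
          with 0 have "0 \<le> t" by (rule order_trans)
          then show "t \<in> {0..}" by simp
        qed
      qed
    qed
    finally show "G -` step_tube T n v \<inter> space M \<in> sets M" .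
  qed
  finally show "G -` U \<inter> space M \<in> sets M" .
qed

section \<open>The Euler scheme with repulsive drift\<close>

primrec noisy_orbit :: "('b \<Rightarrow> 'b) \<Rightarrow> 'b \<Rightarrow> (nat \<Rightarrow> 'b) \<Rightarrow> nat \<Rightarrow> 'b::ab_group_add" where
  "noisy_orbit f y z 0 = y"
| "noisy_orbit f y z (Suc k) = f (noisy_orbit f y z k) + z k"

lemma noisy_orbit_cong: "(\<And>j. j < k \<Longrightarrow> z j = z' j) \<Longrightarrow> noisy_orbit f y z k = noisy_orbit f y z' k"
  by (induction k) auto

lemma measurable_noisy_orbit:
  fixes f :: "real \<Rightarrow> real"
  assumes [measurable]: "f \<in> borel_measurable borel" and "{..<k} \<subseteq> I"
  shows "(\<lambda>z. noisy_orbit f y z k) \<in> borel_measurable (PiM I (\<lambda>_. borel))"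
  using assms(2)
proof (induction k)
  case (Suc k)
  have "{..<k} \<subseteq> I" and [measurable]: "k \<in> I" using Suc.prems by auto
  note [measurable] = Suc.IH[OF this(1)]
  show ?case by simp
qed simp

text \<open>The state after \<open>k\<close> steps is a function of the noises with index below
  \<open>k\<close> only, and disjoint blocks of an independent family are independent.\<close>

lemma (in prob_space) indep_var_noisy_orbit:
  fixes f :: "real \<Rightarrow> real"
  assumes f: "f \<in> borel_measurable borel"
    and Z: "indep_vars (\<lambda>_. borel) Z {..<n}" and k: "k < n"
  shows "indep_var borel (\<lambda>\<omega>. noisy_orbit f y (\<lambda>j. Z j \<omega>) k) borel (Z k)"
proof -
  have "indep_var (PiM {..<k} (\<lambda>_. borel)) (\<lambda>\<omega>. restrict (\<lambda>i. Z i \<omega>) {..<k})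
      (PiM {k} (\<lambda>_. borel)) (\<lambda>\<omega>. restrict (\<lambda>i. Z i \<omega>) {k})"
    by (rule indep_var_restrict[OF Z]) (use k in auto)
  then have "indep_var borel ((\<lambda>z. noisy_orbit f y z k) \<circ> (\<lambda>\<omega>. restrict (\<lambda>i. Z i \<omega>) {..<k}))
      borel ((\<lambda>z. z k) \<circ> (\<lambda>\<omega>. restrict (\<lambda>i. Z i \<omega>) {k}))"
    by (rule indep_var_compose) (auto intro!: measurable_noisy_orbit f)
  moreover have "(\<lambda>z. noisy_orbit f y z k) \<circ> (\<lambda>\<omega>. restrict (\<lambda>i. Z i \<omega>) {..<k})
      = (\<lambda>\<omega>. noisy_orbit f y (\<lambda>j. Z j \<omega>) k)"
    by (auto simp: fun_eq_iff intro!: noisy_orbit_cong)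
  moreover have "(\<lambda>z. z k) \<circ> (\<lambda>\<omega>. restrict (\<lambda>i. Z i \<omega>) {k}) = Z k"
    by (auto simp: fun_eq_iff)
  ultimately show ?thesis by simp
qed

text \<open>The value at 0 is the lower one. It will be applied to y = \<open>\<sigma>\<close> x_d -
  \<open>\<rho>\<close> t, and where y \<le> 0 the side on which x lies is unknown, so only the
  worse of the two drift bounds is available.\<close>

definition repulsive_drift :: "real \<Rightarrow> real \<Rightarrow> real \<Rightarrow> real" where
  "repulsive_drift p m v = (if 0 < v then p else - m)"

lemma borel_measurable_repulsive_drift [measurable]: "repulsive_drift p m \<in> borel_measurable borel"
  unfolding repulsive_drift_def[abs_def] by measurable

lemma repulsive_drift_mono: "0 \<le> p \<Longrightarrow> 0 \<le> m \<Longrightarrow> v \<le> v' \<Longrightarrow> repulsive_drift p m v \<le> repulsive_drift p m v'"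
  by (auto simp: repulsive_drift_def)

text \<open>With \<open>a = 2 * p / s\<close>, \<open>g = 2 * m / s\<close> and \<open>\<kappa> = m / p\<close> this is the scale function of the diffusion with
  drift \<open>repulsive_drift p m\<close> and variance \<open>s\<close>. Taking \<open>\<kappa>\<close> slightly larger makes it strictly subharmonic at
  the kink \<open>0\<close>, which absorbs all errors of the discretisation except steps longer than a fixed \<open>c\<close>.\<close>

definition exit_potential :: "real \<Rightarrow> real \<Rightarrow> real \<Rightarrow> real \<Rightarrow> real" where
  "exit_potential \<kappa> a g v = (if 0 < v then \<kappa> * (1 - exp (- (a * v))) else exp (g * v) - 1)"

lemma borel_measurable_exit_potential [measurable]: "exit_potential \<kappa> a g \<in> borel_measurable borel"
  unfolding exit_potential_def[abs_def] by measurable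

lemma exit_potential_bounds:
  assumes "0 < \<kappa>" "0 < a" "0 < g"
  shows "- 1 \<le> exit_potential \<kappa> a g v" and "exit_potential \<kappa> a g v \<le> \<kappa>"
  using assms by (auto simp: exit_potential_def mult_le_cancel_left1 mult_nonneg_nonpos
      intro: order_trans[of _ 0])

text \<open>The right branch, continued to the negative axis, is concave and lies below its tangent
  \<open>\<kappa> * a * v\<close> at 0, hence below \<open>g * v\<close>, the tangent of the convex
  left branch. So a step that starts on the positive side can be estimated by the continued branch,
  whose expectation is explicit, wherever the step lands.\<close>

lemma exit_potential_ge_right:
  assumes "0 < \<kappa>" "0 < a" "0 < g" "g \<le> \<kappa> * a"
  shows "\<kappa> * (1 - exp (- (a * v))) \<le> exit_potential \<kappa> a g v"
proof (cases "0 < v")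
  case False
  have "\<kappa> * (1 - exp (- (a * v))) \<le> \<kappa> * (a * v)"
    using exp_ge_add_one_self[of "- (a * v)"] assms by (intro mult_left_mono) auto
  also have "\<dots> \<le> g * v" using assms False by (metis mult.assoc mult_right_mono_neg not_less)
  also have "\<dots> \<le> exp (g * v) - 1" using exp_ge_add_one_self[of "g * v"] by linarith
  finally show ?thesis using False by (simp add: exit_potential_def)
qed (simp add: exit_potential_def)

text \<open>The counterpart for steps from the left is harder, since the continued left branch grows
  without bound. The strict kink \<open>g < \<kappa> * a\<close> keeps it below the potential on a
  short interval to the right of 0; beyond that, the subtracted exponential outweighs it. The rate
  \<open>l\<close> remains free, so that the price of a long jump can be made small for short time
  steps.\<close>

lemma exit_potential_ge_left:
  assumes "0 < \<kappa>" "0 < a" "0 < g" "g < \<kappa> * a"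
  obtains c where "0 < c"
    "\<And>l v. 0 \<le> l \<Longrightarrow> exp (g * v) - 1 - exp (g * v + l * (v - c)) \<le> exit_potential \<kappa> a g v"
proof -
  let ?f = "\<lambda>v. \<kappa> * (1 - exp (- (a * v))) - (exp (g * v) - 1)"
  have "DERIV ?f 0 :> \<kappa> * a - g" by (auto intro!: derivative_eq_intros)
  then obtain c where c: "0 < c" "\<And>h. 0 < h \<Longrightarrow> h < c \<Longrightarrow> ?f 0 < ?f (0 + h)"
    using DERIV_pos_inc_right[of ?f "\<kappa> * a - g" 0] assms by auto
  show ?thesis
  proof (rule that[of "c/2"])
    fix l v :: real assume l: "0 \<le> l"
    consider "v \<le> 0" | "0 < v" "v < c" | "c \<le> v" by linarith
    then show "exp (g * v) - 1 - exp (g * v + l * (v - c/2)) \<le> exit_potential \<kappa> a g v"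
    proof cases
      case 2
      then have "exp (g * v) - 1 \<le> exit_potential \<kappa> a g v"
        using c(2)[of v] by (simp add: exit_potential_def)
      then show ?thesis using exp_gt_zero[of "g * v + l * (v - c/2)"] by linarith
    next
      case 3
      have "exp (g * v) \<le> exp (g * v + l * (v - c/2))" using l 3 c(1) by simp
      moreover have "0 \<le> exit_potential \<kappa> a g v" using 3 c(1) assms by (simp add: exit_potential_def)
      ultimately show ?thesis by linarith
    qed (simp add: exit_potential_def)
  qed (use c in auto)
qed

text \<open>The rates are chosen so that drift and noise cancel exactly for every step size:
  \<open>a * h * p = a\<^sup>2 * (s * h) / 2\<close> for a = 2 p / s, and likewise for g = 2 m / s
  with \<open>m\<close>. Each branch therefore keeps its expectation, and the only loss is the mean
  of the jump penalty from \<open>exit_potential_ge_left\<close>.\<close>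

lemma (in prob_space) expectation_exit_potential_step:
  fixes V Z :: "'a \<Rightarrow> real"
  assumes ind: "indep_var borel V borel Z"
    and mgf: "\<And>l. integrable M (\<lambda>\<omega>. exp (l * Z \<omega>))" "\<And>l. expectation (\<lambda>\<omega>. exp (l * Z \<omega>)) = exp (l\<^sup>2 * (s * h) / 2)"
    and pos: "0 < \<kappa>" "0 < p" "0 < m" "0 < s" "0 < h" "0 \<le> l" and g: "m < \<kappa> * p"
    and c: "\<And>v. exp (2 * m / s * v) - 1 - exp (2 * m / s * v + l * (v - c)) \<le> exit_potential \<kappa> (2 * p / s) (2 * m / s) v"
  shows "expectation (\<lambda>\<omega>. exit_potential \<kappa> (2 * p / s) (2 * m / s) (V \<omega>)) - exp ((2 * m / s + l)\<^sup>2 * (s * h) / 2 - l * c)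
    \<le> expectation (\<lambda>\<omega>. exit_potential \<kappa> (2 * p / s) (2 * m / s) (V \<omega> + h * repulsive_drift p m (V \<omega>) + Z \<omega>))"
proof -
  define a where "a = 2 * p / s"
  define g where "g = 2 * m / s"
  have ag: "0 < a" "0 < g" "g < \<kappa> * a"
    using pos g by (auto simp: a_def g_def field_simps)
  note [measurable] = indep_var_rv1[OF ind] indep_var_rv2[OF ind]
  \<comment> \<open>The lower bound \<open>?D\<close> below is a sum of terms in which a bounded
    function of \<open>V\<close> multiplies an exponential of \<open>Z\<close>, so that independence
    factors each expectation. These are the functions of \<open>V\<close>.\<close>
  define f1 where "f1 v = (if 0 < v then \<kappa> * exp (- (a * v)) * exp (- (a * h * p)) else 0)" for v :: real
  define f2 where "f2 v = (if 0 < v then 0 else exp (g * v) * exp (- (g * h * m)))" for v :: real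
  define f4 where "f4 v = (if 0 < v then \<kappa> else - 1)" for v :: real
  have [measurable]: "f1 \<in> borel_measurable borel" "f2 \<in> borel_measurable borel" "f4 \<in> borel_measurable borel"
    unfolding f1_def[abs_def] f2_def[abs_def] f4_def[abs_def] by measurable
  have b1: "\<bar>f1 v\<bar> \<le> \<kappa>" for v
  proof (cases "0 < v")
    case True
    have "0 \<le> a * v" "0 \<le> a * h * p" using True pos ag by auto
    then have "exp (- (a * v)) * exp (- (a * h * p)) \<le> 1" by (simp add: exp_add[symmetric])
    then have "\<kappa> * (exp (- (a * v)) * exp (- (a * h * p))) \<le> \<kappa> * 1" using pos by (intro mult_left_mono) auto
    then show ?thesis using True pos by (simp add: f1_def abs_mult mult.assoc)
  qed (use pos in \<open>simp add: f1_def\<close>)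
  have b2: "\<bar>f2 v\<bar> \<le> 1" for v
  proof (cases "0 < v")
    case False
    have "g * v \<le> 0" "0 \<le> g * h * m" using False pos ag by (auto simp: mult_nonneg_nonpos)
    then show ?thesis using False by (simp add: f2_def abs_mult exp_add[symmetric])
  qed (simp add: f2_def)
  have b4: "\<bar>f4 v\<bar> \<le> \<kappa> + 1" for v
    using pos by (auto simp: f4_def)
  have i1: "integrable M (\<lambda>\<omega>. f1 (V \<omega>))" by (rule integrable_const_bound[of _ \<kappa>]) (use b1 in auto)
  have i2: "integrable M (\<lambda>\<omega>. f2 (V \<omega>))" by (rule integrable_const_bound[of _ 1]) (use b2 in auto)
  have i4: "integrable M (\<lambda>\<omega>. f4 (V \<omega>))" by (rule integrable_const_bound[of _ "\<kappa> + 1"]) (use b4 in auto)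
  have iU: "integrable M (\<lambda>\<omega>. exit_potential \<kappa> a g (W \<omega>))" if [measurable]: "W \<in> borel_measurable M" for W
  proof (rule integrable_const_bound[of _ "\<kappa> + 1"])
    show "AE \<omega> in M. norm (exit_potential \<kappa> a g (W \<omega>)) \<le> \<kappa> + 1"
    proof (rule AE_I2)
      fix \<omega> show "norm (exit_potential \<kappa> a g (W \<omega>)) \<le> \<kappa> + 1"
        using exit_potential_bounds[of \<kappa> a g "W \<omega>"] pos ag by auto
    qed
  qed simp
  have prod: "integrable M (\<lambda>\<omega>. f (V \<omega>) * exp (t * Z \<omega>)) \<and>
      expectation (\<lambda>\<omega>. f (V \<omega>) * exp (t * Z \<omega>)) = expectation (\<lambda>\<omega>. f (V \<omega>)) * exp (t\<^sup>2 * (s * h) / 2)"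
    if [measurable]: "f \<in> borel_measurable borel" and i: "integrable M (\<lambda>\<omega>. f (V \<omega>))" for f :: "real \<Rightarrow> real" and t
  proof -
    have "indep_var borel (f \<circ> V) borel ((\<lambda>z. exp (t * z)) \<circ> Z)"
      by (rule indep_var_compose[OF ind]) auto
    then have iv: "indep_var borel (\<lambda>\<omega>. f (V \<omega>)) borel (\<lambda>\<omega>. exp (t * Z \<omega>))"
      by (simp add: o_def)
    show ?thesis using indep_var_integrable[OF iv i mgf(1)] indep_var_lebesgue_integral[OF iv i mgf(1)] mgf(2) by simp
  qed
  let ?D = "\<lambda>\<omega>. f4 (V \<omega>) - f1 (V \<omega>) * exp (- a * Z \<omega>) + f2 (V \<omega>) * exp (g * Z \<omega>) - exp (- (l * c)) * exp ((g + l) * Z \<omega>)"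
  have low: "?D \<omega> \<le> exit_potential \<kappa> a g (V \<omega> + h * repulsive_drift p m (V \<omega>) + Z \<omega>)" for \<omega>
  proof (cases "0 < V \<omega>")
    case True
    have "?D \<omega> \<le> \<kappa> - f1 (V \<omega>) * exp (- a * Z \<omega>)"
      using True by (simp add: f4_def f2_def)
    also have "\<dots> = \<kappa> * (1 - exp (- (a * (V \<omega> + h * p + Z \<omega>))))"
      using True by (simp add: f1_def algebra_simps exp_add[symmetric])
    also have "\<dots> \<le> exit_potential \<kappa> a g (V \<omega> + h * p + Z \<omega>)"
      using pos ag by (intro exit_potential_ge_right) auto
    finally show ?thesis using True by (simp add: repulsive_drift_def)
  next
    case False
    let ?v = "V \<omega> - h * m + Z \<omega>"
    have "g * V \<omega> \<le> 0" "0 \<le> g * h * m" "l * V \<omega> \<le> 0" "0 \<le> l * h * m"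
      using False pos ag by (auto simp: mult_nonneg_nonpos)
    \<comment> \<open>For \<open>V\<close> \<le> 0, dropping \<open>V\<close> and the drift only
      enlarges the penalty, which thereby depends on \<open>Z\<close> alone.\<close>
    then have "exp (g * ?v + l * (?v - c)) \<le> exp (- (l * c) + (g + l) * Z \<omega>)"
      by (simp add: algebra_simps)
    moreover have "?D \<omega> = exp (g * ?v) - 1 - exp (- (l * c) + (g + l) * Z \<omega>)"
      using False by (simp add: f1_def f2_def f4_def exp_add[symmetric] algebra_simps)
    moreover have "exp (g * ?v) - 1 - exp (g * ?v + l * (?v - c)) \<le> exit_potential \<kappa> a g ?v"
      using c[of ?v] unfolding a_def g_def by simp
    ultimately have "?D \<omega> \<le> exit_potential \<kappa> a g ?v" by linarith
    then show ?thesis using False by (simp add: repulsive_drift_def)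
  qed
  have c1: "exp (- (a * h * p)) * exp (a\<^sup>2 * (s * h) / 2) = 1"
    using pos by (simp add: exp_add[symmetric] a_def power2_eq_square field_simps)
  have c2: "exp (- (g * h * m)) * exp (g\<^sup>2 * (s * h) / 2) = 1"
    using pos by (simp add: exp_add[symmetric] g_def power2_eq_square field_simps)
  have U: "exit_potential \<kappa> a g v = f4 v - f1 v * exp (a\<^sup>2 * (s * h) / 2) + f2 v * exp (g\<^sup>2 * (s * h) / 2)" for v
    using c1 c2 by (auto simp: exit_potential_def f1_def f2_def f4_def mult.assoc algebra_simps)
  have "expectation (\<lambda>\<omega>. exit_potential \<kappa> a g (V \<omega>)) - exp ((g + l)\<^sup>2 * (s * h) / 2 - l * c)
     = expectation (\<lambda>\<omega>. f4 (V \<omega>)) - expectation (\<lambda>\<omega>. f1 (V \<omega>)) * exp (a\<^sup>2 * (s * h) / 2)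
      + expectation (\<lambda>\<omega>. f2 (V \<omega>)) * exp (g\<^sup>2 * (s * h) / 2) - exp (- (l * c)) * exp ((g + l)\<^sup>2 * (s * h) / 2)"
    unfolding U using i1 i2 i4 by (simp add: exp_add[symmetric])
  also have "\<dots> = expectation ?D"
    using prod[OF _ i1, of "-a"] prod[OF _ i2, of g] i4 mgf(1)[of "g + l"] mgf(2)[of "g + l"] by simp
  also have "\<dots> \<le> expectation (\<lambda>\<omega>. exit_potential \<kappa> a g (V \<omega> + h * repulsive_drift p m (V \<omega>) + Z \<omega>))"
  proof (rule integral_mono)
    show "integrable M ?D"
      using prod[OF _ i1, of "-a"] prod[OF _ i2, of g] i4 mgf(1)[of "g + l"] by simp
  qed (use low in \<open>auto intro!: iU\<close>)
  finally show ?thesis unfolding a_def g_def .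
qed


lemma (in prob_space) expectation_exit_potential_orbit:
  fixes Z :: "nat \<Rightarrow> 'a \<Rightarrow> real" and p m h :: real
  defines "f \<equiv> \<lambda>v. v + h * repulsive_drift p m v"
  assumes ind: "indep_vars (\<lambda>_. borel) Z {..<n}"
    and mgf: "\<And>k l. k < n \<Longrightarrow> integrable M (\<lambda>\<omega>. exp (l * Z k \<omega>))"
      "\<And>k l. k < n \<Longrightarrow> expectation (\<lambda>\<omega>. exp (l * Z k \<omega>)) = exp (l\<^sup>2 * (s * h) / 2)"
    and pos: "0 < \<kappa>" "0 < p" "0 < m" "0 < s" "0 < h" "0 \<le> l" and g: "m < \<kappa> * p"
    and c: "\<And>v. exp (2 * m / s * v) - 1 - exp (2 * m / s * v + l * (v - c)) \<le> exit_potential \<kappa> (2 * p / s) (2 * m / s) v"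
  shows "k \<le> n \<Longrightarrow> exit_potential \<kappa> (2 * p / s) (2 * m / s) y - real k * exp ((2 * m / s + l)\<^sup>2 * (s * h) / 2 - l * c)
    \<le> expectation (\<lambda>\<omega>. exit_potential \<kappa> (2 * p / s) (2 * m / s) (noisy_orbit f y (\<lambda>j. Z j \<omega>) k))"
proof (induction k)
  case 0
  then show ?case by (simp add: prob_space)
next
  case (Suc k)
  have [measurable]: "f \<in> borel_measurable borel" unfolding f_def by measurable
  have "indep_var borel (\<lambda>\<omega>. noisy_orbit f y (\<lambda>j. Z j \<omega>) k) borel (Z k)"
    by (rule indep_var_noisy_orbit[OF _ ind]) (use Suc.prems in auto)
  from expectation_exit_potential_step[OF this mgf pos g c] Suc
  show ?case by (simp add: f_def algebra_simps)
qed

text \<open>The potential is at most \<open>\<kappa>\<close> everywhere and at most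
  \<open>exp (- (g * r)) - 1\<close> below \<open>- r\<close>. Bounding its final expectation in
  this way and comparing with the initial value \<open>exp (- (g * \<theta>)) - 1\<close> cancels
  the two -1. The accumulated error depends on \<open>n\<close> but not on \<open>Z\<close>, so the
  threshold for \<open>n\<close> can precede the quantifier over \<open>Z\<close>.\<close>

lemma (in prob_space) eventually_orbit_stays_up:
  fixes p m s t r \<theta> \<kappa> \<eta> :: real
  assumes pos: "0 < p" "0 < m" "0 < s" "0 < t" "0 \<le> r" "0 \<le> \<theta>" "0 < \<eta>" and \<kappa>: "m < \<kappa> * p"
  shows "\<forall>\<^sub>F n in sequentially. \<forall>Z. indep_vars (\<lambda>_. borel) Z {..<n} \<longrightarrow>
      (\<forall>k<n. \<forall>l. integrable M (\<lambda>\<omega>. exp (l * Z k \<omega>)) \<and>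
        expectation (\<lambda>\<omega>. exp (l * Z k \<omega>)) = exp (l\<^sup>2 * (s * (t / real n)) / 2)) \<longrightarrow>
      exp (- (2 * m / s * \<theta>)) - exp (- (2 * m / s * r)) - \<eta> \<le> (\<kappa> + 1) *
        prob {\<omega> \<in> space M. - r \<le> noisy_orbit (\<lambda>v. v + t / real n * repulsive_drift p m v) (- \<theta>) (\<lambda>j. Z j \<omega>) n}"
proof -
  define a where "a = 2 * p / s"
  define g where "g = 2 * m / s"
  have k0: "0 < \<kappa>" using \<kappa> pos by (metis less_trans zero_less_mult_pos2)
  have ag: "0 < a" "0 < g" "g < \<kappa> * a"
    using pos \<kappa> by (auto simp: a_def g_def field_simps)
  obtain c where c: "0 < c"
    "\<And>l v. 0 \<le> l \<Longrightarrow> exp (g * v) - 1 - exp (g * v + l * (v - c)) \<le> exit_potential \<kappa> a g v"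
    using exit_potential_ge_left[OF k0 ag] by metis
  \<comment> \<open>The rate is \<open>l\<close> = sqrt n: with step size t / n the quadratic term
    of the exponent stays bounded, while - c sqrt n beats the factor n from the number of
    steps.\<close>
  have "((\<lambda>n. real n * exp ((g + sqrt (real n))\<^sup>2 * (s * (t / real n)) / 2 - sqrt (real n) * c)) \<longlongrightarrow> 0) sequentially"
    using c(1) pos ag by real_asymp
  then have "\<forall>\<^sub>F n in sequentially. real n * exp ((g + sqrt (real n))\<^sup>2 * (s * (t / real n)) / 2 - sqrt (real n) * c) < \<eta>"
    using pos(7) by (rule order_tendstoD)
  then show ?thesis using eventually_gt_at_top[of 0]
  proof eventually_elim
    case (elim n)
    show ?case
    proof (intro allI impI)
      fix Z :: "nat \<Rightarrow> 'a \<Rightarrow> real"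
      assume ind: "indep_vars (\<lambda>_. borel) Z {..<n}"
        and mgf: "\<forall>k<n. \<forall>l. integrable M (\<lambda>\<omega>. exp (l * Z k \<omega>)) \<and>
          expectation (\<lambda>\<omega>. exp (l * Z k \<omega>)) = exp (l\<^sup>2 * (s * (t / real n)) / 2)"
      let ?f = "\<lambda>v. v + t / real n * repulsive_drift p m v"
      let ?V = "\<lambda>\<omega>. noisy_orbit ?f (- \<theta>) (\<lambda>j. Z j \<omega>) n"
      let ?A = "{\<omega> \<in> space M. - r \<le> ?V \<omega>}"
      have Zm: "\<And>j. j < n \<Longrightarrow> Z j \<in> borel_measurable M"
        using ind unfolding indep_vars_def by auto
      have "k \<le> n \<Longrightarrow> (\<lambda>\<omega>. noisy_orbit ?f (- \<theta>) (\<lambda>j. Z j \<omega>) k) \<in> borel_measurable M" for k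
      proof (induction k)
        case (Suc k)
        then have [measurable]: "(\<lambda>\<omega>. noisy_orbit ?f (- \<theta>) (\<lambda>j. Z j \<omega>) k) \<in> borel_measurable M" "Z k \<in> borel_measurable M"
          using Zm by auto
        show ?case unfolding noisy_orbit.simps by measurable
      qed simp
      from this[OF order_refl] have Vm[measurable]: "?V \<in> borel_measurable M" .
      have A: "?A \<in> events" by measurable
      have ind_int: "integrable M (\<lambda>\<omega>. c1 + c2 * indicator A \<omega> :: real)"
        "expectation (\<lambda>\<omega>. c1 + c2 * indicator A \<omega> :: real) = c1 + c2 * prob A"
        if "A \<in> events" for A c1 c2
        using that by (simp_all add: prob_space less_top[symmetric])
      have "exit_potential \<kappa> a g (- \<theta>) - real n * exp ((g + sqrt (real n))\<^sup>2 * (s * (t / real n)) / 2 - sqrt (real n) * c)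
        \<le> expectation (\<lambda>\<omega>. exit_potential \<kappa> a g (?V \<omega>))"
        unfolding a_def g_def
        by (rule expectation_exit_potential_orbit[OF ind _ _ k0 pos(1-3) _ _ \<kappa>])
          (use mgf pos elim c(2) in \<open>auto simp: a_def g_def\<close>)
      then have "exp (- (g * \<theta>)) - 1 - \<eta> \<le> expectation (\<lambda>\<omega>. exit_potential \<kappa> a g (?V \<omega>))"
        using elim(1) pos(6) by (simp add: exit_potential_def)
      also have "\<dots> \<le> expectation (\<lambda>\<omega>. (exp (- (g * r)) - 1) + (\<kappa> + 1) * indicator ?A \<omega>)"
      proof (rule integral_mono)
        show "integrable M (\<lambda>\<omega>. exit_potential \<kappa> a g (?V \<omega>))"
        proof (rule integrable_const_bound[of _ "\<kappa> + 1"], rule AE_I2)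
          fix \<omega> show "norm (exit_potential \<kappa> a g (?V \<omega>)) \<le> \<kappa> + 1"
            using exit_potential_bounds[of \<kappa> a g "?V \<omega>"] k0 ag by auto
        qed measurable
        show "integrable M (\<lambda>\<omega>. (exp (- (g * r)) - 1) + (\<kappa> + 1) * indicator ?A \<omega>)"
          by (rule ind_int(1)[OF A])
        fix \<omega> assume \<omega>: "\<omega> \<in> space M"
        show "exit_potential \<kappa> a g (?V \<omega>) \<le> (exp (- (g * r)) - 1) + (\<kappa> + 1) * indicator ?A \<omega>"
        proof (cases "- r \<le> ?V \<omega>")
          case True
          then show ?thesis using \<omega> exit_potential_bounds(2)[of \<kappa> a g "?V \<omega>"] k0 ag
            by (simp add: add_increasing)
        next
          case False
          then have "g * ?V \<omega> \<le> g * (- r)" using ag by (intro mult_left_mono) auto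
          then show ?thesis using False pos(5) by (simp add: exit_potential_def)
        qed
      qed
      also have "\<dots> = (exp (- (g * r)) - 1) + (\<kappa> + 1) * prob ?A"
        by (rule ind_int(2)[OF A])
      finally show "exp (- (2 * m / s * \<theta>)) - exp (- (2 * m / s * r)) - \<eta> \<le> (\<kappa> + 1) * prob ?A"
        unfolding g_def by simp
    qed
  qed
qed

section \<open>Paths with small additive noise\<close>

text \<open>In the weight exp (- 2 L (s - a)) the integral term contributes at most half of the
  maximum K. At a maximum point this gives K \<le> A + K / 2, which explains both factors 2 in the
  bound.\<close>

lemma weighted_gronwall:
  fixes g :: "real \<Rightarrow> real"
  assumes g: "continuous_on {a..b} g" and A: "0 \<le> A" and L: "0 < L"
    and le: "\<And>t. t \<in> {a..b} \<Longrightarrow> g t \<le> A + L * integral {a..t} g"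
    and t: "t \<in> {a..b}"
  shows "g t \<le> 2 * A * exp (2 * L * (t - a))"
proof -
  let ?\<phi> = "\<lambda>s. g s * exp (- (2 * L * (s - a)))"
  have "continuous_on {a..b} ?\<phi>" by (intro continuous_intros g)
  then obtain u where u: "u \<in> {a..b}" "\<And>s. s \<in> {a..b} \<Longrightarrow> ?\<phi> s \<le> ?\<phi> u"
    using continuous_attains_sup[of "{a..b}" ?\<phi>] t by auto
  define K where "K = ?\<phi> u"
  have gK: "g s \<le> K * exp (2 * L * (s - a))" if "s \<in> {a..b}" for s
  proof -
    have "?\<phi> s * exp (2 * L * (s - a)) \<le> K * exp (2 * L * (s - a))"
      using u(2)[OF that] unfolding K_def by (intro mult_right_mono) auto
    then show ?thesis by (simp add: mult.assoc exp_add[symmetric])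
  qed
  have "K \<le> 2 * A"
  proof (cases "K \<le> 0")
    case False
    have "((\<lambda>s. K * exp (2 * L * (s - a))) has_integral
       K * exp (2 * L * (u - a)) / (2 * L) - K * exp (2 * L * (a - a)) / (2 * L)) {a..u}"
      using L u(1) by (intro fundamental_theorem_of_calculus)
        (auto intro!: derivative_eq_intros simp: has_real_derivative_iff_has_vector_derivative[symmetric])
    moreover have "g integrable_on {a..u}"
      using u(1) by (intro integrable_continuous_real continuous_on_subset[OF g]) auto
    ultimately have "integral {a..u} g \<le> K * exp (2 * L * (u - a)) / (2 * L) - K * exp (2 * L * (a - a)) / (2 * L)"
      using gK u(1) by (intro has_integral_le[OF integrable_integral]) auto
    then have "L * integral {a..u} g \<le> L * (K * exp (2 * L * (u - a)) / (2 * L) - K / (2 * L))"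
      using L by (intro mult_left_mono) auto
    also have "\<dots> \<le> K / 2 * exp (2 * L * (u - a))" using L False by (simp add: field_simps)
    finally have "g u \<le> A + K / 2 * exp (2 * L * (u - a))" using le[OF u(1)] by linarith
    moreover have "A \<le> A * exp (2 * L * (u - a))"
      using A L u(1) by (simp add: mult_le_cancel_left1)
    moreover have "g u = K * exp (2 * L * (u - a))" by (simp add: K_def exp_minus)
    ultimately have "K * exp (2 * L * (u - a)) \<le> (A + K / 2) * exp (2 * L * (u - a))"
      by (simp add: distrib_right)
    then show ?thesis by simp
  qed (use A in auto)
  then have "K * exp (2 * L * (t - a)) \<le> 2 * A * exp (2 * L * (t - a))" by (intro mult_right_mono) auto
  then show ?thesis using gK[OF t] by linarith
qed

text \<open>One notion covers the branches, with \<open>v\<close> = 0, and the trajectories of the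
  stochastic equation, with \<open>v\<close> = \<open>\<epsilon>\<close> w. Integrability is part of
  it because \<open>integral\<close> defaults to 0 on nonintegrable functions, which would make the
  equation meaningless.\<close>

definition noisy_path ::
  "(real \<Rightarrow> 'v \<Rightarrow> 'v) \<Rightarrow> 'v \<Rightarrow> real \<Rightarrow> (real \<Rightarrow> 'v) \<Rightarrow> (real \<Rightarrow> 'v::euclidean_space) \<Rightarrow> bool" where
  "noisy_path b x0 S v x \<longleftrightarrow> continuous_on {0..S} x \<and> (\<lambda>s. b s (x s)) integrable_on {0..S} \<and>
     (\<forall>t\<in>{0..S}. x t = x0 + integral {0..t} (\<lambda>s. b s (x s)) + v t)"

lemma noisy_pathI:
  assumes x: "continuous_on {0..S} x" and b: "set_integrable lborel {0..S} (\<lambda>s. b s (x s))"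
    and eq: "\<And>t. t \<in> {0..S} \<Longrightarrow> x t = x0 + (LINT s:{0..t}|lborel. b s (x s)) + v t"
  shows "noisy_path b x0 S v x"
  unfolding noisy_path_def
proof (intro conjI x ballI)
  show "(\<lambda>s. b s (x s)) integrable_on {0..S}" by (rule set_borel_integral_eq_integral[OF b])
  fix t assume t: "t \<in> {0..S}"
  have "set_integrable lborel {0..t} (\<lambda>s. b s (x s))"
    by (rule set_integrable_subset[OF b]) (use t in auto)
  then show "x t = x0 + integral {0..t} (\<lambda>s. b s (x s)) + v t"
    using eq[OF t] by (simp add: set_borel_integral_eq_integral)
qed

lemma noisy_path_integrable:
  assumes "noisy_path b x0 S v x" "0 \<le> s" "t \<le> S"
  shows "(\<lambda>s. b s (x s)) integrable_on {s..t}"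
  using assms unfolding noisy_path_def by (auto intro: integrable_on_subinterval)

lemma noisy_path_increment:
  assumes N: "noisy_path b x0 S v x" and st: "0 \<le> s" "s \<le> t" "t \<le> S"
  shows "x t - x s = integral {s..t} (\<lambda>s. b s (x s)) + (v t - v s)"
proof -
  have "integral {0..s} (\<lambda>s. b s (x s)) + integral {s..t} (\<lambda>s. b s (x s)) = integral {0..t} (\<lambda>s. b s (x s))"
    using st by (intro Henstock_Kurzweil_Integration.integral_combine noisy_path_integrable[OF N]) auto
  moreover have "x t = x0 + integral {0..t} (\<lambda>s. b s (x s)) + v t" "x s = x0 + integral {0..s} (\<lambda>s. b s (x s)) + v s"
    using N st unfolding noisy_path_def by auto
  ultimately show ?thesis by (simp add: algebra_simps)
qed

lemma noisy_path_a_priori_bound: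
  assumes N: "noisy_path b x0 S v x" and L: "0 < L" and B0: "0 \<le> B0"
    and growth: "\<And>t x. t \<in> {0..S} \<Longrightarrow> norm (b t x) \<le> B0 + L * norm (x - x0)"
    and v: "\<And>t. t \<in> {0..S} \<Longrightarrow> norm (v t) \<le> 1" and t: "t \<in> {0..S}"
  shows "norm (x t - x0) \<le> 2 * (1 + B0 * S) * exp (2 * L * S)"
proof -
  have c: "continuous_on {0..S} (\<lambda>t. norm (x t - x0))"
    using N unfolding noisy_path_def by (intro continuous_intros) auto
  have "norm (x t - x0) \<le> (1 + B0 * S) + L * integral {0..t} (\<lambda>s. norm (x s - x0))" if t: "t \<in> {0..S}" for t
  proof -
    have i: "(\<lambda>s. norm (x s - x0)) integrable_on {0..t}"
      using t by (intro integrable_continuous_real continuous_on_subset[OF c]) auto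
    have "norm (integral {0..t} (\<lambda>s. b s (x s))) \<le> integral {0..t} (\<lambda>s. B0 + L * norm (x s - x0))"
      using t growth i by (intro integral_norm_bound_integral noisy_path_integrable[OF N] integrable_add integrable_on_mult_right) auto
    also have "\<dots> = B0 * t + L * integral {0..t} (\<lambda>s. norm (x s - x0))"
      using i t by (subst Henstock_Kurzweil_Integration.integral_add) (auto intro!: integrable_on_mult_right)
    finally have "norm (integral {0..t} (\<lambda>s. b s (x s))) \<le> B0 * S + L * integral {0..t} (\<lambda>s. norm (x s - x0))"
      using mult_left_mono[of t S B0] t B0 by auto
    moreover have "x t - x0 = integral {0..t} (\<lambda>s. b s (x s)) + v t"
      using N t unfolding noisy_path_def by (auto simp: algebra_simps)
    ultimately show ?thesis using v[OF t] norm_triangle_ineq[of "integral {0..t} (\<lambda>s. b s (x s))" "v t"] by simp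
  qed
  from weighted_gronwall[OF c _ L this t] t B0
  have "norm (x t - x0) \<le> 2 * (1 + B0 * S) * exp (2 * L * t)" by simp
  also have "\<dots> \<le> 2 * (1 + B0 * S) * exp (2 * L * S)" using t L B0 by (intro mult_left_mono) auto
  finally show ?thesis .
qed

lemma noisy_path_modulus:
  assumes N: "noisy_path b x0 S v x" and st: "0 \<le> s" "s \<le> t" "t \<le> S"
    and B: "\<And>u. u \<in> {s..t} \<Longrightarrow> norm (b u (x u)) \<le> B"
    and v: "norm (v t - v s) \<le> \<eta>"
  shows "norm (x t - x s) \<le> B * (t - s) + \<eta>"
proof -
  have "norm (integral {s..t} (\<lambda>s. b s (x s))) \<le> B * (t - s)"
    using integral_norm_bound_integral[OF noisy_path_integrable[OF N st(1,3)], of "\<lambda>_. B"] B st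
    by (simp add: mult.commute integrable_const_ivl)
  then show ?thesis using v norm_triangle_ineq[of "integral {s..t} (\<lambda>s. b s (x s))" "v t - v s"]
    unfolding noisy_path_increment[OF N st] by linarith
qed

lemma integral_vec_nth:
  fixes f :: "real \<Rightarrow> real ^ 'n"
  assumes "f integrable_on S"
  shows "(\<lambda>s. f s $ d) integrable_on S" and "integral S f $ d = integral S (\<lambda>s. f s $ d)"
proof -
  have "((\<lambda>x. x $ d) \<circ> f has_integral (integral S f $ d)) S"
    by (rule has_integral_linear[OF integrable_integral[OF assms] bounded_linear_vec_nth])
  then show "(\<lambda>s. f s $ d) integrable_on S" and "integral S f $ d = integral S (\<lambda>s. f s $ d)"
    by (auto simp: o_def has_integral_integrable integral_unique)
qed


text \<open>Gronwall for the difference, with a Lipschitz bound on \<open>b1\<close> alone, since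
  \<open>b\<close> jumps at the hyperplane. The drifts are compared on the half-open interval
  because \<open>c\<close> will be the first time at which \<open>x\<close> fails to be on the right
  side; the single point \<open>c\<close> does not affect the integrals.\<close>

lemma noisy_path_stability:
  fixes b :: "real \<Rightarrow> 'v \<Rightarrow> 'v::euclidean_space"
  assumes N: "noisy_path b x0 S v x" and N1: "noisy_path b1 x0 S (\<lambda>_. 0) X1"
    and st: "0 \<le> a" "a \<le> c" "c \<le> S" and L: "0 < L"
    and lip: "\<And>t x y. t \<in> {0..S} \<Longrightarrow> norm (b1 t x - b1 t y) \<le> L * norm (x - y)"
    and eq: "\<And>s. s \<in> {a..<c} \<Longrightarrow> b s (x s) = b1 s (x s)"
    and v: "\<And>t. t \<in> {a..c} \<Longrightarrow> norm (v t - v a) \<le> \<eta>" and t: "t \<in> {a..c}"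
  shows "norm (x t - X1 t) \<le> 2 * (norm (x a - X1 a) + \<eta>) * exp (2 * L * S)"
proof -
  have "0 \<le> \<eta>" using v[of a] st by simp
  have c: "continuous_on {a..c} (\<lambda>t. norm (x t - X1 t))"
    using N N1 st unfolding noisy_path_def by (intro continuous_intros) (auto elim: continuous_on_subset)
  have "norm (x t - X1 t) \<le> (norm (x a - X1 a) + \<eta>) + L * integral {a..t} (\<lambda>s. norm (x s - X1 s))"
    if t: "t \<in> {a..c}" for t
  proof -
    let ?f = "\<lambda>s. b s (x s) - b1 s (X1 s)" and ?g = "\<lambda>s. b1 s (x s) - b1 s (X1 s)"
    have i: "(\<lambda>s. norm (x s - X1 s)) integrable_on {a..t}"
      using t by (intro integrable_continuous_real continuous_on_subset[OF c]) auto
    have fi: "?f integrable_on {a..t}"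
      using t st by (intro integrable_diff noisy_path_integrable[OF N] noisy_path_integrable[OF N1]) auto
    have sp: "?g s = ?f s" if "s \<in> {a..t} - {c}" for s
      using eq[of s] that t by auto
    have gi: "?g integrable_on {a..t}" and gf: "integral {a..t} ?g = integral {a..t} ?f"
      using integrable_spike[OF fi negligible_sing sp] integral_spike[OF negligible_sing, of "{a..t}" c ?g ?f] sp by auto
    have "norm (integral {a..t} ?g) \<le> integral {a..t} (\<lambda>s. L * norm (x s - X1 s))"
      using lip t st by (intro integral_norm_bound_integral gi integrable_on_mult_right i) auto
    then have 1: "norm (integral {a..t} ?f) \<le> L * integral {a..t} (\<lambda>s. norm (x s - X1 s))"
      unfolding gf by simp
    have ta: "a \<le> t" "t \<le> S" using t st by auto
    have "integral {a..t} ?f = integral {a..t} (\<lambda>s. b s (x s)) - integral {a..t} (\<lambda>s. b1 s (X1 s))"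
      using st ta by (intro Henstock_Kurzweil_Integration.integral_diff noisy_path_integrable[OF N] noisy_path_integrable[OF N1])
    then have "x t - X1 t = (x a - X1 a) + (v t - v a) + integral {a..t} ?f"
      using noisy_path_increment[OF N st(1) ta] noisy_path_increment[OF N1 st(1) ta] by (simp add: algebra_simps)
    then have "norm (x t - X1 t) \<le> norm (x a - X1 a) + norm (v t - v a) + norm (integral {a..t} ?f)"
      unfolding \<open>x t - X1 t = _\<close> using norm_triangle_ineq[of "(x a - X1 a) + (v t - v a)" "integral {a..t} ?f"]
        norm_triangle_ineq[of "x a - X1 a" "v t - v a"] by linarith
    then show ?thesis using 1 v[OF t] by linarith
  qed
  from weighted_gronwall[OF c _ L this t] \<open>0 \<le> \<eta>\<close>
  have "norm (x t - X1 t) \<le> 2 * (norm (x a - X1 a) + \<eta>) * exp (2 * L * (t - a))" by simp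
  also have "\<dots> \<le> 2 * (norm (x a - X1 a) + \<eta>) * exp (2 * L * S)"
    using t st L \<open>0 \<le> \<eta>\<close> by (intro mult_left_mono) auto
  finally show ?thesis .
qed

text \<open>\<open>\<sigma>\<close> is the sign of the half-space entered by \<open>X1\<close>. A noisy path that has reached height \<open>\<rho> * t0 / 2\<close>
  at a small time \<open>t0\<close> stays on that side: near \<open>x0\<close> since the drift pushes outwards, and later
  since it is close to \<open>X1\<close>, which is bounded away from the hyperplane.\<close>

lemma noisy_path_follows_branch:
  fixes b b1 b2 :: "real \<Rightarrow> real ^ 'n \<Rightarrow> real ^ 'n"
  assumes S: "0 < S" and L: "0 < L" and \<sigma>: "\<bar>\<sigma>\<bar> = 1" and \<delta>: "0 < \<delta>" and B0: "0 \<le> B0"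
    and pos: "0 < \<rho>" "0 < t2" "0 < e"
    and lip1: "\<And>t x y. t \<in> {0..S} \<Longrightarrow> norm (b1 t x - b1 t y) \<le> L * norm (x - y)"
    and lip2: "\<And>t x y. t \<in> {0..S} \<Longrightarrow> norm (b2 t x - b2 t y) \<le> L * norm (x - y)"
    and B0_1: "\<And>t. t \<in> {0..S} \<Longrightarrow> norm (b1 t x0) \<le> B0"
    and B0_2: "\<And>t. t \<in> {0..S} \<Longrightarrow> norm (b2 t x0) \<le> B0"
    and b12: "\<And>t x. b t x = b1 t x \<or> b t x = b2 t x"
    and b1: "\<And>t x. 0 < \<sigma> * x $ d \<Longrightarrow> b t x = b1 t x"
    and X1: "noisy_path b1 x0 S (\<lambda>_. 0) X1" "\<And>t. 0 < t \<Longrightarrow> t < S \<Longrightarrow> 0 < \<sigma> * X1 t $ d"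
    and near: "\<And>t x. t \<in> {0..t2} \<Longrightarrow> norm (x - x0) \<le> \<delta> \<Longrightarrow> 0 \<le> \<sigma> * b1 t x $ d"
  obtains t0 \<eta> where "0 < t0" "t0 \<le> t2" "t0 \<le> S" "0 < \<eta>"
    "\<And>x v t. noisy_path b x0 S v x \<Longrightarrow> (\<forall>t\<in>{0..S}. norm (v t) \<le> \<eta>) \<Longrightarrow> t \<in> {0..t0} \<Longrightarrow> norm (x t - x0) \<le> \<delta>"
    "\<And>x v t. noisy_path b x0 S v x \<Longrightarrow> (\<forall>t\<in>{0..S}. norm (v t) \<le> \<eta>) \<Longrightarrow> \<rho> * t0 / 2 \<le> \<sigma> * x t0 $ d \<Longrightarrow>
      t \<in> {0..S} \<Longrightarrow> norm (x t - X1 t) \<le> e"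
proof -
  \<comment> \<open>\<open>K\<close> is the Gronwall factor, \<open>R\<close> an a priori radius for
    all paths with noise at most 1, and \<open>B\<close> bounds the drift along them. The
    \<open>+ 1\<close> in \<open>B\<close> makes it safe to divide by \<open>B\<close>.\<close>
  define K where "K = exp (2 * L * S)"
  define R where "R = 2 * (1 + B0 * S) * K"
  define B where "B = B0 + L * R + 1"
  have K1: "1 \<le> K" using L S by (simp add: K_def)
  have R0: "0 \<le> R" using B0 S K1 by (simp add: R_def)
  have B1: "1 \<le> B" using R0 B0 L by (simp add: B_def)
  have growth1: "norm (b1 t x) \<le> B0 + L * norm (x - x0)" if "t \<in> {0..S}" for t x
    using lip1[OF that, of x x0] B0_1[OF that] norm_triangle_ineq[of "b1 t x - b1 t x0" "b1 t x0"] by simp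
  have growth2: "norm (b2 t x) \<le> B0 + L * norm (x - x0)" if "t \<in> {0..S}" for t x
    using lip2[OF that, of x x0] B0_2[OF that] norm_triangle_ineq[of "b2 t x - b2 t x0" "b2 t x0"] by simp
  have growth: "norm (b t x) \<le> B0 + L * norm (x - x0)" if "t \<in> {0..S}" for t x
    using growth1[OF that, of x] growth2[OF that, of x] b12[of t x] by auto
  have bound: "norm (c u (x u)) \<le> B"
    if N: "noisy_path c x0 S v x" and g: "\<And>t x. t \<in> {0..S} \<Longrightarrow> norm (c t x) \<le> B0 + L * norm (x - x0)"
      and v: "\<forall>t\<in>{0..S}. norm (v t) \<le> \<eta>" and \<eta>: "\<eta> \<le> 1" and u: "u \<in> {0..S}"
    for c v x \<eta> u
  proof -
    have "norm (x u - x0) \<le> R"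
      unfolding R_def K_def using v \<eta> by (intro noisy_path_a_priori_bound[OF N L B0 g _ u]) force+
    then have "L * norm (x u - x0) \<le> L * R" using L by (intro mult_left_mono) auto
    then show ?thesis using g[OF u, of "x u"] unfolding B_def by linarith
  qed
  have modulus: "norm (x t - x s) \<le> B * (t - s) + 2 * \<eta>"
    if N: "noisy_path c x0 S v x" and g: "\<And>t x. t \<in> {0..S} \<Longrightarrow> norm (c t x) \<le> B0 + L * norm (x - x0)"
      and v: "\<forall>t\<in>{0..S}. norm (v t) \<le> \<eta>" and \<eta>: "\<eta> \<le> 1" and st: "0 \<le> s" "s \<le> t" "t \<le> S"
    for c v x \<eta> s t
  proof (rule noisy_path_modulus[OF N st])
    fix u assume u: "u \<in> {s..t}"
    then show "norm (c u (x u)) \<le> B" using st by (intro bound[OF N g v \<eta>]) auto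
  next
    have "norm (v t) \<le> \<eta>" "norm (v s) \<le> \<eta>" using v st by auto
    then show "norm (v t - v s) \<le> 2 * \<eta>" using norm_triangle_ineq4[of "v t" "v s"] by linarith
  qed
  have init: "norm (x t - x0) \<le> B * t + \<eta>"
    if N: "noisy_path c x0 S v x" and g: "\<And>t x. t \<in> {0..S} \<Longrightarrow> norm (c t x) \<le> B0 + L * norm (x - x0)"
      and v: "\<forall>t\<in>{0..S}. norm (v t) \<le> \<eta>" and \<eta>: "\<eta> \<le> 1" and t: "0 \<le> t" "t \<le> S"
    for c v x \<eta> t
  proof -
    let ?I = "integral {0..t} (\<lambda>s. c s (x s))"
    have "norm ?I \<le> integral {0..t} (\<lambda>_. B)"
      using bound[OF N g v \<eta>] t
      by (intro integral_norm_bound_integral noisy_path_integrable[OF N] integrable_const_ivl) auto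
    then have "norm ?I \<le> B * t" using t by (simp add: mult.commute)
    moreover have "x t - x0 = ?I + v t" using N t unfolding noisy_path_def by auto
    moreover have "norm (v t) \<le> \<eta>" using v t by auto
    moreover have "norm (?I + v t) \<le> norm ?I + norm (v t)" by (rule norm_triangle_ineq)
    ultimately show ?thesis by simp
  qed
  \<comment> \<open>Up to \<open>t1\<close> a path moves at most \<open>\<delta>\<close> / 2 by
    drift, which leaves \<open>\<delta>\<close> / 2 for the noise, so it stays where the drift
    points outwards. The bound \<open>S / 4\<close> separates \<open>t1\<close> from
    \<open>T2\<close>.\<close>
  define t1 where "t1 = min t2 (min (S / 4) (\<delta> / (2 * B)))"
  have "t1 \<le> \<delta> / (2 * B)" by (simp add: t1_def)
  then have t1: "0 < t1" "t1 \<le> t2" "t1 \<le> S / 4" "B * t1 \<le> \<delta> / 2"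
    using pos S \<delta> B1 by (auto simp: t1_def field_simps)
  \<comment> \<open>\<open>X1\<close> may be back on the hyperplane at time \<open>S\<close>, so it
    has no positive distance from it on all of \<open>{t1..S}\<close>. After \<open>T2\<close> the
    sign is given up: both paths move too little to spoil the estimate.\<close>
  define T2 where "T2 = S - min (S / 2) (e / (8 * B))"
  have "S - T2 \<le> e / (8 * B)" "S - T2 \<le> S / 2" "0 < S - T2" using pos S B1 by (auto simp: T2_def)
  then have T2: "t1 < T2" "T2 < S" "2 * (B * (S - T2)) \<le> e / 4"
    using S t1 B1 by (auto simp: field_simps)
  have "continuous_on {t1..T2} (\<lambda>t. \<sigma> * X1 t $ d)"
    using X1(1) T2 t1 unfolding noisy_path_def by (intro continuous_intros) (auto elim: continuous_on_subset)
  then obtain u where u: "u \<in> {t1..T2}" "\<And>t. t \<in> {t1..T2} \<Longrightarrow> \<sigma> * X1 u $ d \<le> \<sigma> * X1 t $ d"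
    using continuous_attains_inf[of "{t1..T2}" "\<lambda>t. \<sigma> * X1 t $ d"] T2 by auto
  define \<kappa> where "\<kappa> = \<sigma> * X1 u $ d"
  have \<kappa>: "0 < \<kappa>" using X1(2)[of u] u(1) t1 T2 unfolding \<kappa>_def by auto
  \<comment> \<open>The deviation allowed up to \<open>T2\<close>: at most half of the minimal
    height \<open>\<kappa>\<close> of \<open>X1\<close> on \<open>{t1..T2}\<close>, to keep the
    sign, and at most half of the final accuracy.\<close>
  define m where "m = min (\<kappa> / 2) (e / 2)"
  have m: "0 < m" "m \<le> \<kappa> / 2" "m \<le> e / 2" using \<kappa> pos by (auto simp: m_def)
  \<comment> \<open>Before \<open>t0\<close> the sign of the path is unknown and the two paths may
    separate by \<open>2 * B * t0\<close>. This must stay below \<open>m\<close> even after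
    amplification by \<open>K\<close>; \<open>\<eta>\<close> comes last because it must also be
    small compared with the height \<open>\<rho> * t0 / 2\<close>.\<close>
  define t0 where "t0 = min t1 (m / (8 * B * K))"
  have t0m: "t0 \<le> m / (8 * B * K)" by (simp add: t0_def)
  have t0: "0 < t0" "t0 \<le> t1" using t1 m B1 K1 by (auto simp: t0_def)
  have t0K: "8 * (B * t0 * K) \<le> m" using t0m B1 K1 by (simp add: field_simps)
  define \<eta> where "\<eta> = min (min 1 (\<delta> / 2)) (min (e / 8) (min (\<rho> * t0 / 8) (m / (12 * K))))"
  have \<eta>: "0 < \<eta>" "\<eta> \<le> 1" "\<eta> \<le> \<delta> / 2" "\<eta> \<le> e / 8" "\<eta> \<le> \<rho> * t0 / 8"
    using pos \<delta> t0 m K1 by (auto simp: \<eta>_def)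
  have "\<eta> \<le> m / (12 * K)" by (simp add: \<eta>_def)
  then have \<eta>K: "12 * (\<eta> * K) \<le> m" using K1 by (simp add: field_simps)
  have E0: "2 * (2 * (B * t0) + \<eta> + 2 * \<eta>) * K \<le> m"
  proof -
    have "2 * (2 * (B * t0) + \<eta> + 2 * \<eta>) * K = (8 * (B * t0 * K)) / 2 + (12 * (\<eta> * K)) / 2" by algebra
    then show ?thesis using t0K \<eta>K by linarith
  qed
  have region: "norm (x t - x0) \<le> \<delta>"
    if N: "noisy_path b x0 S v x" and v: "\<forall>t\<in>{0..S}. norm (v t) \<le> \<eta>" and t: "t \<in> {0..t1}" for x v t
  proof -
    have "B * t \<le> B * t1" using t B1 by (intro mult_left_mono) auto
    moreover have "norm (x t - x0) \<le> B * t + \<eta>"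
      by (rule init[OF N growth v \<eta>(2)]) (use t t1 S in auto)
    ultimately show ?thesis using t1 \<eta> by linarith
  qed
  show ?thesis
  proof (rule that[of t0 \<eta>])
    fix x v t assume N: "noisy_path b x0 S v x" and v: "\<forall>t\<in>{0..S}. norm (v t) \<le> \<eta>"
      and start: "\<rho> * t0 / 2 \<le> \<sigma> * x t0 $ d" and t: "t \<in> {0..S}"
    have vd: "norm (v t - v s) \<le> 2 * \<eta>" if "s \<in> {0..S}" "t \<in> {0..S}" for s t
    proof -
      have "norm (v t) \<le> \<eta>" "norm (v s) \<le> \<eta>" using v that by auto
      then show ?thesis using norm_triangle_ineq4[of "v t" "v s"] by linarith
    qed
    have v1: "\<forall>t\<in>{0..S}. norm ((\<lambda>_. 0::real^'n) t) \<le> 0" by simp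
    have early: "norm (x t - X1 t) \<le> 2 * (B * t0) + \<eta>" if t: "t \<in> {0..t0}" for t
    proof -
      have "B * t \<le> B * t0" using t B1 by (intro mult_left_mono) auto
      moreover have "norm (x t - x0) \<le> B * t + \<eta>"
        by (rule init[OF N growth v \<eta>(2)]) (use t t0 t1 S in auto)
      moreover have "norm (X1 t - x0) \<le> B * t + 0"
        by (rule init[OF X1(1) growth1 v1]) (use t t0 t1 S in auto)
      ultimately show ?thesis using norm_triangle_ineq4[of "x t - x0" "X1 t - x0"] by simp
    qed
    have close: "norm (x t - X1 t) \<le> m"
      if c: "t0 \<le> c" "c \<le> T2" and up: "\<And>s. s \<in> {t0..<c} \<Longrightarrow> 0 < \<sigma> * x s $ d" and t: "t \<in> {t0..c}" for c t
    proof -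
      have "norm (x t - X1 t) \<le> 2 * (norm (x t0 - X1 t0) + 2 * \<eta>) * exp (2 * L * S)"
        by (rule noisy_path_stability[OF N X1(1) _ c(1) _ L lip1 b1[OF up] vd t]) (use c t0 t1 T2 in auto)
      also have "\<dots> \<le> 2 * (2 * (B * t0) + \<eta> + 2 * \<eta>) * exp (2 * L * S)"
        using early[of t0] t0 by (intro mult_right_mono mult_left_mono add_right_mono) auto
      finally show ?thesis using E0 unfolding K_def by linarith
    qed
    have up: "0 < \<sigma> * x s $ d" if s: "s \<in> {t0..T2}" for s
    proof (rule ccontr)
      assume neg: "\<not> 0 < \<sigma> * x s $ d"
      let ?E = "{s \<in> {t0..T2}. \<sigma> * x s $ d \<le> 0}"
      have cx: "continuous_on {t0..T2} (\<lambda>s. \<sigma> * x s $ d)"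
        using N T2 t0 t1 unfolding noisy_path_def by (intro continuous_intros) (auto elim: continuous_on_subset)
      have "closed ?E"
        using continuous_closed_preimage[OF cx _ closed_atMost[of 0]] by (simp add: vimage_def Int_def conj_commute)
      moreover have "bounded ?E" by (rule bounded_subset[of "{t0..T2}"]) auto
      ultimately have "compact ?E" by (simp add: compact_eq_bounded_closed)
      moreover have "s \<in> ?E" using s neg by auto
      \<comment> \<open>\<open>c\<close> is the first time after \<open>t0\<close> at which the path
        is not strictly on the side of \<open>X1\<close>. Up to \<open>t1\<close> the outward drift
        excludes it, later the closeness to \<open>X1\<close> does.\<close>
      ultimately obtain c where c: "c \<in> ?E" "\<And>s. s \<in> ?E \<Longrightarrow> c \<le> s"
        using compact_attains_inf[of ?E] by blast
      have before: "0 < \<sigma> * x s $ d" if "s \<in> {t0..<c}" for s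
        using c(2)[of s] c(1) that by (auto simp: not_le[symmetric])
      have c': "t0 \<le> c" "c \<le> T2" "\<sigma> * x c $ d \<le> 0" "c \<le> S" using c(1) T2 by auto
      show False
      proof (cases "c \<le> t1")
        case True
        let ?I = "integral {t0..c} (\<lambda>s. b s (x s))"
        have bi: "(\<lambda>s. b s (x s)) integrable_on {t0..c}"
          using c' t0 by (intro noisy_path_integrable[OF N]) auto
        have "0 \<le> integral {t0..c} (\<lambda>s. \<sigma> * b s (x s) $ d)"
        proof -
          \<comment> \<open>The point \<open>c\<close> is removed since the path has left the open
            half-space there, and \<open>b\<close> need not equal \<open>b1\<close>.\<close>
          have "0 \<le> integral ({t0..c} - {c}) (\<lambda>s. \<sigma> * b s (x s) $ d)"
          proof (rule integral_nonneg)
            show "(\<lambda>s. \<sigma> * b s (x s) $ d) integrable_on ({t0..c} - {c})"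
              using integrable_on_mult_right[OF integral_vec_nth(1)[OF bi], of \<sigma> d]
              by (subst integrable_spike_set_eq[of _ "{t0..c}"]) (auto intro: negligible_subset[OF negligible_sing[of c]])
            fix s assume "s \<in> {t0..c} - {c}"
            then have s: "s \<in> {t0..<c}" by auto
            have "0 \<le> \<sigma> * b1 s (x s) $ d"
              using s True t0 t1 by (intro near region[OF N v]) auto
            then show "0 \<le> \<sigma> * b s (x s) $ d" using b1[OF before[OF s]] by simp
          qed
          also have "\<dots> = integral {t0..c} (\<lambda>s. \<sigma> * b s (x s) $ d)"
            by (rule integral_spike_set) (auto intro: negligible_subset[OF negligible_sing[of c]])
          finally show ?thesis .
        qed
        then have I: "0 \<le> \<sigma> * ?I $ d"
          by (simp add: integral_vec_nth(2)[OF bi])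
        have "\<sigma> * x c $ d - \<sigma> * x t0 $ d = \<sigma> * (x c - x t0) $ d" by (simp add: algebra_simps)
        also have "\<dots> = \<sigma> * ?I $ d + \<sigma> * (v c - v t0) $ d"
          unfolding noisy_path_increment[OF N less_imp_le[OF t0(1)] c'(1,4)] by (simp add: distrib_left)
        finally have "\<sigma> * x c $ d - \<sigma> * x t0 $ d = \<sigma> * ?I $ d + \<sigma> * (v c - v t0) $ d" .
        moreover have "\<sigma> * (v c - v t0) $ d \<ge> - (2 * \<eta>)"
        proof -
          have "\<bar>\<sigma> * (v c - v t0) $ d\<bar> \<le> norm (v c - v t0)"
            using component_le_norm_cart[of "v c - v t0" d] \<sigma> by (simp add: abs_mult)
          also have "\<dots> \<le> 2 * \<eta>" using c' t0 by (intro vd) auto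
          finally show ?thesis by linarith
        qed
        ultimately have "\<sigma> * x c $ d \<ge> \<rho> * t0 / 2 - 2 * \<eta>" using I start by linarith
        moreover have "0 < \<rho> * t0" using pos t0 by simp
        ultimately show False using c'(3) \<eta>(5) by linarith
      next
        case False
        have "\<bar>\<sigma> * (x c - X1 c) $ d\<bar> \<le> norm (x c - X1 c)"
          using component_le_norm_cart[of "x c - X1 c" d] \<sigma> by (simp add: abs_mult)
        also have "\<dots> \<le> m" using c' before by (intro close[of c]) auto
        finally have "\<sigma> * X1 c $ d - m \<le> \<sigma> * x c $ d" by (simp add: algebra_simps abs_le_iff)
        moreover have "\<kappa> \<le> \<sigma> * X1 c $ d" unfolding \<kappa>_def using False c' by (intro u(2)) auto
        ultimately show False using c'(3) m \<kappa> by linarith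
      qed
    qed
    consider "t \<in> {0..t0}" | "t \<in> {t0..T2}" | "t \<in> {T2..S}" using t by fastforce
    then show "norm (x t - X1 t) \<le> e"
    proof cases
      case 1
      have "2 * (B * t0) + \<eta> \<le> 2 * (2 * (B * t0) + \<eta> + 2 * \<eta>) * 1" using B1 t0 \<eta> by simp
      also have "\<dots> \<le> 2 * (2 * (B * t0) + \<eta> + 2 * \<eta>) * K"
        using K1 B1 t0 \<eta> by (intro mult_left_mono) auto
      finally show ?thesis using early[OF 1] E0 m pos by linarith
    next
      case 2
      have "norm (x t - X1 t) \<le> m" by (rule close[of T2 t]) (use 2 up t0 t1 T2 in auto)
      then show ?thesis using m pos by linarith
    next
      case 3
      have "norm (x T2 - X1 T2) \<le> m" by (rule close[of T2 T2]) (use up t0 t1 T2 in auto)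
      moreover have "norm (x t - x T2) \<le> B * (t - T2) + 2 * \<eta>"
        by (rule modulus[OF N growth v \<eta>(2)]) (use 3 t1 T2 in auto)
      moreover have "norm (X1 t - X1 T2) \<le> B * (t - T2) + 2 * 0"
        by (rule modulus[OF X1(1) growth1 v1]) (use 3 t1 T2 in auto)
      moreover have "B * (t - T2) \<le> B * (S - T2)" using 3 B1 by (intro mult_left_mono) auto
      moreover have "norm (x t - X1 t) \<le> norm (x T2 - X1 T2) + norm (x t - x T2) + norm (X1 t - X1 T2)"
      proof -
        have "x t - X1 t = (x T2 - X1 T2) + ((x t - x T2) - (X1 t - X1 T2))" by simp
        then show ?thesis
          using norm_triangle_ineq[of "x T2 - X1 T2" "(x t - x T2) - (X1 t - X1 T2)"]
            norm_triangle_ineq4[of "x t - x T2" "X1 t - X1 T2"] by simp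
      qed
      ultimately show ?thesis using T2 m \<eta> by linarith
    qed
  qed (use t0 t1 S \<eta> region in auto)
qed

section \<open>Drift coefficients along continuous paths\<close>

lemma drift_coefficient_bounded:
  assumes f: "drift_coefficient f" and K: "compact K" "K \<subseteq> {0..} \<times> UNIV"
  shows "bounded (case_prod f ` K)"
proof -
  have "\<forall>z\<in>K. \<exists>r>0. bounded (case_prod f ` (ball z r \<inter> {0..} \<times> UNIV))"
    using f K(2) unfolding drift_coefficient_def by blast
  then obtain r where r: "\<And>z. z \<in> K \<Longrightarrow> 0 < r z"
    "\<And>z. z \<in> K \<Longrightarrow> bounded (case_prod f ` (ball z (r z) \<inter> {0..} \<times> UNIV))" by metis
  have "K \<subseteq> (\<Union>z\<in>K. ball z (r z))" using r(1) by force
  then obtain C where C: "C \<subseteq> K" "finite C" "K \<subseteq> (\<Union>z\<in>C. ball z (r z))"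
    using compactE_image[OF K(1), of K "\<lambda>z. ball z (r z)"] by (metis open_ball)
  have "case_prod f ` K \<subseteq> (\<Union>z\<in>C. case_prod f ` (ball z (r z) \<inter> {0..} \<times> UNIV))"
    using C(3) K(2) by blast
  moreover have "bounded (\<Union>z\<in>C. case_prod f ` (ball z (r z) \<inter> {0..} \<times> UNIV))"
    using C r(2) by (intro bounded_UN) auto
  ultimately show ?thesis by (rule bounded_subset[rotated])
qed

lemma drift_coefficient_along_path:
  assumes f: "drift_coefficient f" and x: "continuous_on {0..S} x"
  shows "(\<lambda>s. f s (x s)) \<in> borel_measurable (restrict_space borel {0..S})"
    and "bounded ((\<lambda>s. f s (x s)) ` {0..S})"
proof -
  have "(\<lambda>s. (s, x s)) \<in> measurable (restrict_space borel {0..S}) (restrict_space borel ({0..} \<times> UNIV))"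
    
    by (intro measurable_restrict_space2 borel_measurable_continuous_on_restrict continuous_intros x)
      (auto simp: space_restrict_space)
  then have "(\<lambda>s. case_prod f (s, x s)) \<in> borel_measurable (restrict_space borel {0..S})"
    using f unfolding drift_coefficient_def by (elim measurable_compose) blast
  then show "(\<lambda>s. f s (x s)) \<in> borel_measurable (restrict_space borel {0..S})" by simp
  have "compact ((\<lambda>s. (s, x s)) ` {0..S})"
    by (intro compact_continuous_image continuous_intros x) auto
  then have "bounded (case_prod f ` (\<lambda>s. (s, x s)) ` {0..S})"
    by (rule drift_coefficient_bounded[OF f]) auto
  then show "bounded ((\<lambda>s. f s (x s)) ` {0..S})" by (simp add: image_image)
qed

lemma set_integrable_Icc_bounded:
  fixes g :: "real \<Rightarrow> 'v::euclidean_space"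
  assumes g: "g \<in> borel_measurable (restrict_space borel {a..b})" and bd: "bounded (g ` {a..b})"
  shows "set_integrable lborel {a..b} g"
proof -
  obtain B where B: "\<And>s. s \<in> {a..b} \<Longrightarrow> norm (g s) \<le> B" using bd unfolding bounded_iff by (metis imageI)
  have m: "(\<lambda>s. indicator {a..b} s *\<^sub>R g s) \<in> borel_measurable lborel"
    using g by (subst (asm) borel_measurable_restrict_space_iff) auto
  have "integrable lborel (\<lambda>s. B * indicator {a..b} s)"
    by (intro integrable_mult_right integrable_real_indicator) (auto simp: emeasure_lborel_Icc_eq)
  then show ?thesis unfolding set_integrable_def
    by (rule Bochner_Integration.integrable_bound[OF _ m])
      (use B in \<open>auto simp: indicator_def intro: order_trans[OF _ abs_ge_self]\<close>)
qed

lemma set_integrable_drift_coefficient: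
  assumes "drift_coefficient f" and "continuous_on {0..S} x"
  shows "set_integrable lborel {0..S} (\<lambda>s. f s (x s))"
  using drift_coefficient_along_path[OF assms] by (rule set_integrable_Icc_bounded)

lemma set_integrable_glued_drift:
  fixes x :: "real \<Rightarrow> real ^ 'n"
  assumes bp: "drift_coefficient bp" and bm: "drift_coefficient bm" and x: "continuous_on {0..S} x"
  shows "set_integrable lborel {0..S} (\<lambda>s. glued_drift d bp bm s (x s))"
proof (rule set_integrable_Icc_bounded)
  note P = drift_coefficient_along_path[OF bp x] and Q = drift_coefficient_along_path[OF bm x]
  note [measurable] = P(1) Q(1)
  have "(\<lambda>s. x s $ d) \<in> borel_measurable (restrict_space borel {0..S})"
    by (intro borel_measurable_continuous_on_restrict continuous_intros x)
  note [measurable] = this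
  show "(\<lambda>s. glued_drift d bp bm s (x s)) \<in> borel_measurable (restrict_space borel {0..S})"
    unfolding glued_drift_def by measurable
  have "bounded ((\<lambda>s. bp s (x s)) ` {0..S} \<union> (\<lambda>s. bm s (x s)) ` {0..S})"
    using P(2) Q(2) by simp
  then show "bounded ((\<lambda>s. glued_drift d bp bm s (x s)) ` {0..S})"
    by (rule bounded_subset) (auto simp: glued_drift_def)
qed

lemma drift_coefficient_lipschitz:
  assumes "drift_coefficient f"
  obtains L where "0 < L" "\<And>t x y. 0 \<le> t \<Longrightarrow> norm (f t x - f t y) \<le> L * norm (x - y)"
proof -
  obtain L where L: "\<forall>t\<ge>0. L-lipschitz_on UNIV (f t)" using assms unfolding drift_coefficient_def by blast
  \<comment> \<open>The Gronwall estimate divides by the constant, so it is made strictly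
    positive.\<close>
  show ?thesis
  proof (rule that[of "\<bar>L\<bar> + 1"])
    fix t :: real and x y :: "real ^ 'a" assume "0 \<le> t"
    then have "norm (f t x - f t y) \<le> L * norm (x - y)"
      using L lipschitz_onD[of L UNIV "f t" x y] by (simp add: dist_norm)
    also have "\<dots> \<le> (\<bar>L\<bar> + 1) * norm (x - y)" by (intro mult_right_mono) auto
    finally show "norm (f t x - f t y) \<le> (\<bar>L\<bar> + 1) * norm (x - y)" .
  qed simp
qed

section \<open>Probability of following a branch\<close>

text \<open>Monotonicity of the drift makes the inequality self-propagating: shifting the start of the
  Euler scheme down by the modulus of continuity \<open>\<theta>\<close> compensates for the discretisation.\<close>

lemma noisy_orbit_le_path:
  fixes y :: "real \<Rightarrow> real"
  assumes pm: "0 \<le> p" "0 \<le> m" and t0: "0 < t0" and n: "0 < n" and y0: "0 \<le> y 0"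
    and a: "a integrable_on {0..t0}"
    and y: "\<And>s t. 0 \<le> s \<Longrightarrow> s \<le> t \<Longrightarrow> t \<le> t0 \<Longrightarrow> y t - y s = integral {s..t} a + (W t - W s)"
    and drift: "\<And>t. t \<in> {0..t0} \<Longrightarrow> repulsive_drift p m (y t) \<le> a t"
    and osc: "\<And>k t. k < n \<Longrightarrow> t \<in> {real k * (t0 / real n)..real (Suc k) * (t0 / real n)} \<Longrightarrow>
      y (real k * (t0 / real n)) - \<theta> \<le> y t"
  shows "k \<le> n \<Longrightarrow> noisy_orbit (\<lambda>v. v + t0 / real n * repulsive_drift p m v) (- \<theta>)
      (\<lambda>j. W (real (Suc j) * (t0 / real n)) - W (real j * (t0 / real n))) k + \<theta> \<le> y (real k * (t0 / real n))"
    (is "_ \<Longrightarrow> ?V k + \<theta> \<le> _")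
proof (induction k)
  case 0
  then show ?case using y0 by simp
next
  case (Suc k)
  define h where "h = t0 / real n"
  have h: "0 < h" using t0 n by (simp add: h_def)
  let ?s = "real k * h" and ?t = "real (Suc k) * h"
  have s: "0 \<le> ?s" "?s \<le> ?t" using h by (auto simp: algebra_simps)
  have "?t \<le> real n * h" using Suc.prems h by (intro mult_right_mono) auto
  then have t: "?t \<le> t0" using n by (simp add: h_def)
  have ih: "?V k + \<theta> \<le> y ?s" using Suc unfolding h_def by simp
  have "integral {?s..?t} (\<lambda>_. repulsive_drift p m (?V k)) \<le> integral {?s..?t} a"
  proof (rule integral_le)
    show "a integrable_on {?s..?t}" using a by (rule integrable_on_subinterval) (use s t in auto)
    fix u assume u: "u \<in> {?s..?t}"
    have "y ?s - \<theta> \<le> y u" using osc[of k u] u Suc.prems unfolding h_def by simp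
    then have "repulsive_drift p m (?V k) \<le> repulsive_drift p m (y u)"
      using ih by (intro repulsive_drift_mono pm) linarith
    also have "\<dots> \<le> a u" using u s t by (intro drift) auto
    finally show "repulsive_drift p m (?V k) \<le> a u" .
  qed (simp add: integrable_const_ivl)
  moreover have "integral {?s..?t} (\<lambda>_. repulsive_drift p m (?V k)) = h * repulsive_drift p m (?V k)"
    using s by (simp add: algebra_simps)
  moreover have "y ?t - y ?s = integral {?s..?t} a + (W ?t - W ?s)" by (rule y[OF s t])
  moreover have "?V (Suc k) = ?V k + h * repulsive_drift p m (?V k) + (W ?t - W ?s)"
    by (simp add: h_def)
  ultimately show ?case using ih unfolding h_def by linarith
qed

section \<open>Independence, suprema and oscillations of the random paths\<close>

lemma wiener_indep_increments_component:
  fixes w :: "real \<Rightarrow> 'a \<Rightarrow> real ^ 'n::finite"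
  assumes w: "wiener_process M w" and h: "0 < h"
  shows "prob_space.indep_vars M (\<lambda>_. borel)
      (\<lambda>k \<omega>. c * (w (real (Suc k) * h) \<omega> $ i) - c * (w (real k * h) \<omega> $ i)) {..<n}"
proof -
  interpret prob_space M using w unfolding wiener_process_def by blast
  have "indep_vars (\<lambda>_. borel) (\<lambda>k \<omega>. w (real (Suc k) * h) \<omega> - w (real k * h) \<omega>) {..<n}"
    using w h unfolding wiener_process_def by (auto simp: algebra_simps elim!: allE[of _ n] allE[of _ "\<lambda>k. real k * h"])
  then have "indep_vars (\<lambda>_. borel) (\<lambda>k \<omega>. c * ((w (real (Suc k) * h) \<omega> - w (real k * h) \<omega>) $ i)) {..<n}"
    by (rule indep_vars_compose2) (simp add: cart_eq_inner_axis)
  then show ?thesis by (simp add: algebra_simps)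
qed

text \<open>Each continuous path is bounded on the compact interval, so the events that the bound
  \<open>n\<close> holds increase to the whole space; continuity of the measure from below gives the
  claim.\<close>

lemma bounded_on_Icc_with_high_probability:
  fixes w :: "real \<Rightarrow> 'a \<Rightarrow> 'v::{real_normed_vector,second_countable_topology}"
  assumes M: "prob_space M" and w: "\<And>t. 0 \<le> t \<Longrightarrow> w t \<in> borel_measurable M"
    and cont: "AE \<omega> in M. continuous_on {0..} (\<lambda>t. w t \<omega>)" and \<eta>: "0 < \<eta>"
  obtains G c where "G \<in> sets M" "1 - \<eta> \<le> measure M G" "0 < c"
    "\<And>\<omega> t. \<omega> \<in> G \<Longrightarrow> t \<in> {0..S} \<Longrightarrow> norm (w t \<omega>) \<le> c"
proof -
  interpret prob_space M by (rule M)
  obtain N where N: "N \<in> null_sets M" "{\<omega> \<in> space M. \<not> continuous_on {0..} (\<lambda>t. w t \<omega>)} \<subseteq> N"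
    using cont by (auto simp: eventually_ae_filter)
  \<comment> \<open>Continuity holds only almost surely, and the set of bad outcomes need not be
    measurable. Replacing the paths by 0 on a measurable null set that contains it makes
    \<open>sets_Collect_le_interval\<close> applicable.\<close>
  define w' where "w' t \<omega> = (if \<omega> \<in> N then 0 else w t \<omega>)" for t \<omega>
  define A where "A n = {\<omega> \<in> space M. \<forall>t\<in>{0..S}. norm (w' t \<omega>) \<le> real n}" for n :: nat
  have c': "continuous_on {0..S} (\<lambda>t. w' t \<omega>)" if "\<omega> \<in> space M" for \<omega>
  proof (cases "\<omega> \<in> N")
    case False
    then have "continuous_on {0..} (\<lambda>t. w t \<omega>)" using N(2) that by blast
    then show ?thesis using False unfolding w'_def by (auto elim: continuous_on_subset)
  qed (simp add: w'_def)
  have A: "A n \<in> sets M" for n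
    unfolding A_def
  proof (rule sets_Collect_le_interval)
    fix t assume "t \<in> {0..S}"
    then have [measurable]: "w t \<in> borel_measurable M" using w by auto
    have [measurable]: "N \<in> sets M" using N(1) by auto
    show "(\<lambda>\<omega>. norm (w' t \<omega>)) \<in> borel_measurable M" unfolding w'_def by measurable
  qed (intro continuous_intros c')
  have "incseq A" unfolding A_def incseq_def by fastforce
  then have "(\<lambda>n. prob (A n)) \<longlonglongrightarrow> prob (\<Union>n. A n)"
    using A by (intro finite_Lim_measure_incseq) auto
  moreover have "(\<Union>n. A n) = space M"
  proof -
    have "\<exists>n. \<omega> \<in> A n" if \<omega>: "\<omega> \<in> space M" for \<omega>
    proof -
      have "bounded ((\<lambda>t. w' t \<omega>) ` {0..S})"
        by (intro compact_imp_bounded compact_continuous_image c' \<omega>) auto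
      then obtain B where B: "\<And>t. t \<in> {0..S} \<Longrightarrow> norm (w' t \<omega>) \<le> B" unfolding bounded_iff by (metis imageI)
      obtain n :: nat where "B \<le> real n" using real_arch_simple by blast
      then have "norm (w' t \<omega>) \<le> real n" if "t \<in> {0..S}" for t using B[OF that] by linarith
      then have "\<omega> \<in> A n" using \<omega> unfolding A_def by blast
      then show ?thesis by blast
    qed
    then show ?thesis unfolding A_def by blast
  qed
  ultimately have "(\<lambda>n. prob (A n)) \<longlonglongrightarrow> 1" by (simp add: prob_space)
  then have "\<forall>\<^sub>F n in sequentially. 1 - \<eta> < prob (A n)"
    using \<eta> by (intro order_tendstoD) auto
  then obtain n where n: "1 - \<eta> < prob (A n)" by (auto simp: eventually_sequentially)
  show ?thesis
  proof (rule that[of "A n - N" "real n + 1"])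
    show "A n - N \<in> sets M" using A N(1) by auto
    show "1 - \<eta> \<le> prob (A n - N)" using n measure_Diff_null_set[OF A N(1)] by simp
    fix \<omega> t assume "\<omega> \<in> A n - N" "t \<in> {0..S}"
    then show "norm (w t \<omega>) \<le> real n + 1" unfolding A_def w'_def by fastforce
  qed simp
qed

text \<open>Uniform continuity puts each path into all but finitely many of the events. These events
  need not be monotone in \<open>n\<close>, so dominated convergence for their indicators replaces
  continuity of the measure.\<close>

lemma prob_grid_oscillation:
  fixes y :: "real \<Rightarrow> 'a \<Rightarrow> real"
  assumes M: "prob_space M" and y: "\<And>t. t \<in> {0..S} \<Longrightarrow> y t \<in> borel_measurable M"
    and cont: "\<And>\<omega>. \<omega> \<in> space M \<Longrightarrow> continuous_on {0..S} (\<lambda>t. y t \<omega>)"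
    and pos: "0 < S" "0 < \<theta>" "0 < \<eta>"
  shows "\<forall>\<^sub>F n in sequentially. \<exists>A\<in>sets M. 1 - \<eta> \<le> measure M A \<and>
    (\<forall>\<omega>\<in>A. \<forall>k<n. \<forall>t\<in>{real k * (S / real n)..real (Suc k) * (S / real n)}. y (real k * (S / real n)) \<omega> - \<theta> \<le> y t \<omega>)"
proof -
  interpret prob_space M by (rule M)
  define A where "A n = {\<omega> \<in> space M. \<forall>k\<in>{..<n}.
      \<forall>t\<in>{real k * (S / real n)..real (Suc k) * (S / real n)}. y (real k * (S / real n)) \<omega> - y t \<omega> \<le> \<theta>}" for n
  have grid: "{real k * (S / real n)..real (Suc k) * (S / real n)} \<subseteq> {0..S}" "real k * (S / real n) \<in> {0..S}" if "k < n" for k n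
  proof -
    have "real (Suc k) * (S / real n) \<le> real n * (S / real n)" using that pos by (intro mult_right_mono) auto
    then have "real (Suc k) * (S / real n) \<le> S" using that by simp
    moreover have "0 \<le> real k * (S / real n)" "real k * (S / real n) \<le> real (Suc k) * (S / real n)"
      by (use pos in simp) (rule mult_right_mono, use pos in auto)
    ultimately show "{real k * (S / real n)..real (Suc k) * (S / real n)} \<subseteq> {0..S}" "real k * (S / real n) \<in> {0..S}"
      by (auto simp del: of_nat_Suc)
  qed
  have A: "A n \<in> sets M" for n
    unfolding A_def
  proof (rule predE, rule measurable_pred_countable(1), simp, unfold pred_def, rule sets_Collect_le_interval, goal_cases)
    case (1 k t)
    then have "y t \<in> borel_measurable M" "y (real k * (S / real n)) \<in> borel_measurable M"
      using grid[of k n] by (auto intro!: y simp del: of_nat_Suc)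
    then show ?case by measurable
  next
    case (2 k \<omega>)
    then show ?case using grid(1)[of k n] by (intro continuous_intros) (auto intro: continuous_on_subset[OF cont] simp del: of_nat_Suc)
  qed
  have "(\<lambda>n. prob (A n)) \<longlonglongrightarrow> 1"
  proof -
    have "(\<lambda>n. \<integral>\<omega>. indicator (A n) \<omega> \<partial>M) \<longlonglongrightarrow> (\<integral>\<omega>. (1::real) \<partial>M)"
    proof (rule integral_dominated_convergence[where w = "\<lambda>_. 1"])
      show "AE \<omega> in M. (\<lambda>n. indicator (A n) \<omega>) \<longlonglongrightarrow> (1::real)"
      proof (rule AE_I2)
        fix \<omega> assume \<omega>: "\<omega> \<in> space M"
        have "uniformly_continuous_on {0..S} (\<lambda>t. y t \<omega>)"
          by (rule compact_uniformly_continuous[OF cont[OF \<omega>]]) auto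
        then obtain \<delta> where \<delta>: "0 < \<delta>" "\<And>s t. s \<in> {0..S} \<Longrightarrow> t \<in> {0..S} \<Longrightarrow> dist t s < \<delta> \<Longrightarrow> dist (y t \<omega>) (y s \<omega>) < \<theta>"
          unfolding uniformly_continuous_on_def using pos(2) by metis
        have "((\<lambda>n. S / real n) \<longlongrightarrow> 0) sequentially" by (rule lim_const_over_n)
        then have "\<forall>\<^sub>F n in sequentially. S / real n < \<delta>" using \<delta>(1) by (rule order_tendstoD)
        then have "\<forall>\<^sub>F n in sequentially. indicator (A n) \<omega> = (1::real)"
        proof eventually_elim
          case (elim n)
          have "\<omega> \<in> A n" unfolding A_def
          proof (intro CollectI conjI \<omega> ballI)
            fix k t assume k: "k \<in> {..<n}" and t: "t \<in> {real k * (S / real n)..real (Suc k) * (S / real n)}"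
            have "real (Suc k) * (S / real n) = real k * (S / real n) + S / real n"
              by (simp add: distrib_right add_divide_distrib)
            then have "dist (real k * (S / real n)) t < \<delta>"
              using t elim by (simp only: atLeastAtMost_iff dist_real_def abs_less_iff) (intro conjI, linarith+)
            then have "dist (y (real k * (S / real n)) \<omega>) (y t \<omega>) < \<theta>"
              using grid[of k n] k t by (intro \<delta>(2)) auto
            then show "y (real k * (S / real n)) \<omega> - y t \<omega> \<le> \<theta>" by (auto simp: dist_real_def)
          qed
          then show ?case by simp
        qed
        then show "(\<lambda>n. indicator (A n) \<omega>) \<longlonglongrightarrow> (1::real)" by (rule tendsto_eventually)
      qed
    qed (use A in \<open>auto simp: indicator_def\<close>)
    then show ?thesis using A by (simp add: prob_space)
  qed
  then have "\<forall>\<^sub>F n in sequentially. 1 - \<eta> < prob (A n)"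
    using pos by (intro order_tendstoD) auto
  then show ?thesis
  proof eventually_elim
    case (elim n)
    then show ?case using A[of n] unfolding A_def by (intro bexI[of _ "A n"]) (auto simp: A_def algebra_simps)
  qed
qed

text \<open>\<open>null_sets M\<close> contains only measurable sets, so augmenting by it does not
  lead out of \<open>sets M\<close>.\<close>

lemma borel_measurable_augmented_filtration:
  assumes w: "\<And>t. 0 \<le> t \<Longrightarrow> w t \<in> borel_measurable M"
    and X: "X \<in> borel_measurable (augmented_filtration M w t)"
  shows "X \<in> borel_measurable M"
proof -
  let ?G = "{w s -` A \<inter> space M | s A. 0 \<le> s \<and> s \<le> t \<and> A \<in> sets borel} \<union> null_sets M"
  have G: "?G \<subseteq> sets M" using w by (auto intro: measurable_sets)
  then have "?G \<subseteq> Pow (space M)" using sets.space_closed by blast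
  then have "space (augmented_filtration M w t) = space M" "sets (augmented_filtration M w t) \<subseteq> sets M"
    unfolding augmented_filtration_def using sets.sigma_sets_subset[OF G]
    by (auto simp: space_measure_of_conv sets_measure_of)
  then show ?thesis using X by (auto simp: measurable_def)
qed

lemma strong_solution_measurable:
  assumes "wiener_process M w" "strong_solution M w b \<epsilon> x0 X" "0 \<le> t"
  shows "X t \<in> borel_measurable M"
  using assms unfolding wiener_process_def strong_solution_def
  by (intro borel_measurable_augmented_filtration[of w M "X t" t]) auto

lemma strong_solution_noisy_path:
  assumes X: "strong_solution M w b \<epsilon> x0 X"
    and b: "\<And>x. continuous_on {0..S} x \<Longrightarrow> set_integrable lborel {0..S} (\<lambda>s. b s (x s))"
  shows "AE \<omega> in M. noisy_path b x0 S (\<lambda>t. \<epsilon> *\<^sub>R w t \<omega>) (\<lambda>t. X t \<omega>)"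
proof -
  have "AE \<omega> in M. \<forall>t\<ge>0. X t \<omega> = x0 + (LINT s:{0..t}|lborel. b s (X s \<omega>)) + \<epsilon> *\<^sub>R w t \<omega>"
    using X unfolding strong_solution_def by blast
  then show ?thesis
  proof (rule AE_mp, intro AE_I2 impI)
    fix \<omega> assume \<omega>: "\<omega> \<in> space M" and eq: "\<forall>t\<ge>0. X t \<omega> = x0 + (LINT s:{0..t}|lborel. b s (X s \<omega>)) + \<epsilon> *\<^sub>R w t \<omega>"
    have "continuous_on {0..} (\<lambda>t. X t \<omega>)" using X \<omega> unfolding strong_solution_def by blast
    then have c: "continuous_on {0..S} (\<lambda>t. X t \<omega>)" by (rule continuous_on_subset) auto
    show "noisy_path b x0 S (\<lambda>t. \<epsilon> *\<^sub>R w t \<omega>) (\<lambda>t. X t \<omega>)"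
    proof (rule noisy_pathI)
      show "set_integrable lborel {0..S} (\<lambda>s. b s (X s \<omega>))" by (rule b[OF c])
    qed (use c eq in auto)
  qed
qed

text \<open>Three events together force the path into the tube: the scheme ends above
  \<open>- r\<close>, the path oscillates little on the grid, and the Wiener path is bounded. On
  them the comparison with the scheme gives the height at \<open>t0\<close> that
  \<open>noisy_path_follows_branch\<close> requires.\<close>

lemma branch_probability:
  fixes b b1 b2 :: "real \<Rightarrow> real ^ 'n::finite \<Rightarrow> real ^ 'n" and \<sigma> :: real
  assumes b1: "drift_coefficient b1" and b2: "drift_coefficient b2"
    and b: "\<And>x. continuous_on {0..S} x \<Longrightarrow> set_integrable lborel {0..S} (\<lambda>s. b s (x s))"
    and b12: "\<And>t x. b t x = b1 t x \<or> b t x = b2 t x"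
    and bb1: "\<And>t x. 0 < \<sigma> * x $ d \<Longrightarrow> b t x = b1 t x"
    and w: "wiener_process M w" and X: "\<And>\<epsilon>. 0 < \<epsilon> \<Longrightarrow> strong_solution M w b \<epsilon> x0 (X \<epsilon>)"
    and x0: "x0 $ d = 0" and \<sigma>: "\<bar>\<sigma>\<bar> = 1"
    and lim1: "((\<lambda>t. b1 t x0 $ d) \<longlongrightarrow> b1 0 x0 $ d) (at_right 0)"
    and lim2: "((\<lambda>t. b2 t x0 $ d) \<longlongrightarrow> b2 0 x0 $ d) (at_right 0)"
    and q: "q1 = \<sigma> * b1 0 x0 $ d" "q2 = - (\<sigma> * b2 0 x0 $ d)" "0 < q1" "0 < q2"
    and S: "0 < S" and X1: "noisy_path b1 x0 S (\<lambda>_. 0) X1" "\<And>t. 0 < t \<Longrightarrow> t < S \<Longrightarrow> 0 < \<sigma> * X1 t $ d"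
    and e: "0 < e" and \<eta>: "0 < \<eta>"
  shows "\<forall>\<^sub>F \<epsilon> in at_right 0. q1 / (q1 + q2) - \<eta> \<le>
    measure M {\<omega> \<in> space M. \<forall>t\<in>{0..S}. norm (X \<epsilon> t \<omega> - X1 t) \<le> e}"
proof -
  interpret prob_space M using w unfolding wiener_process_def by blast
  have wm: "\<And>t. 0 \<le> t \<Longrightarrow> w t \<in> borel_measurable M" and wc: "AE \<omega> in M. continuous_on {0..} (\<lambda>t. w t \<omega>)"
    and w0: "AE \<omega> in M. w 0 \<omega> = 0"
    using w unfolding wiener_process_def by auto
  \<comment> \<open>The losses sum to six of these eighths: one for passing from \<open>q1\<close>,
    \<open>q2\<close> to \<open>\<kappa>\<close>, three for the scheme (start at
    \<open>- \<theta>\<close>, level \<open>- r\<close>, discretisation), and two for the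
    exceptional sets of \<open>A\<close> and \<open>G\<close>.\<close>
  define \<eta>' where "\<eta>' = \<eta> / 8"
  have \<eta>': "0 < \<eta>'" using \<eta> by (simp add: \<eta>'_def)
  have "((\<lambda>\<rho>. (q1 - 2 * \<rho>) / (q1 + q2 + \<rho>)) \<longlongrightarrow> (q1 - 2 * 0) / (q1 + q2 + 0)) (at_right 0)"
    using q by (intro tendsto_intros) auto
  then have "\<forall>\<^sub>F \<rho> in at_right 0. q1 / (q1 + q2) - \<eta>' < (q1 - 2 * \<rho>) / (q1 + q2 + \<rho>)"
    using \<eta>' by (intro order_tendstoD) auto
  moreover have "\<forall>\<^sub>F \<rho> in at_right 0. \<rho> \<in> {0<..<q1 / 2}"
    using q by (intro eventually_at_right_real) auto
  ultimately have "\<forall>\<^sub>F \<rho> in at_right 0. 0 < \<rho> \<and> \<rho> < q1 / 2 \<and> q1 / (q1 + q2) - \<eta>' < (q1 - 2 * \<rho>) / (q1 + q2 + \<rho>)"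
    by eventually_elim auto
  from eventually_happens'[OF trivial_limit_at_right_real this]
  obtain \<rho> where \<rho>: "0 < \<rho>" "\<rho> < q1 / 2" "q1 / (q1 + q2) - \<eta>' < (q1 - 2 * \<rho>) / (q1 + q2 + \<rho>)"
    by (elim exE conjE)
  \<comment> \<open>One \<open>\<rho>\<close> covers the variation of the drift near (0,
    \<open>x0\<close>), the other the term \<open>\<rho> * t\<close> subtracted in \<open>y\<close>.
    The third \<open>\<rho>\<close> in \<open>\<kappa>\<close> makes \<open>m < \<kappa> * p\<close>
    strict.\<close>
  define p where "p = q1 - 2 * \<rho>"
  define m where "m = q2 + 2 * \<rho>"
  define \<kappa> where "\<kappa> = (q2 + 3 * \<rho>) / p"
  have pm: "0 < p" "0 < m" "m < \<kappa> * p" "0 < \<kappa>" using \<rho> q by (auto simp: p_def m_def \<kappa>_def)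
  have \<kappa>1: "1 / (\<kappa> + 1) = (q1 - 2 * \<rho>) / (q1 + q2 + \<rho>)"
    using pm(1) by (simp add: \<kappa>_def p_def field_simps)
  obtain L1 where L1: "0 < L1" "\<And>t x y. 0 \<le> t \<Longrightarrow> norm (b1 t x - b1 t y) \<le> L1 * norm (x - y)"
    using drift_coefficient_lipschitz[OF b1] by metis
  obtain L2 where L2: "0 < L2" "\<And>t x y. 0 \<le> t \<Longrightarrow> norm (b2 t x - b2 t y) \<le> L2 * norm (x - y)"
    using drift_coefficient_lipschitz[OF b2] by metis
  define L where "L = L1 + L2"
  have L: "0 < L" using L1 L2 by (simp add: L_def)
  have lip1: "norm (b1 t x - b1 t y) \<le> L * norm (x - y)" if "0 \<le> t" for t x y
    using L1(2)[OF that, of x y] mult_right_mono[of L1 L "norm (x - y)"] L2(1) unfolding L_def by auto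
  have lip2: "norm (b2 t x - b2 t y) \<le> L * norm (x - y)" if "0 \<le> t" for t x y
    using L2(2)[OF that, of x y] mult_right_mono[of L2 L "norm (x - y)"] L1(1) unfolding L_def by auto
  obtain B1 where B1: "\<And>t. t \<in> {0..S} \<Longrightarrow> norm (b1 t x0) \<le> B1"
    using drift_coefficient_along_path(2)[OF b1 continuous_on_const[of "{0..S}" x0]] unfolding bounded_iff by (metis imageI)
  obtain B2 where B2: "\<And>t. t \<in> {0..S} \<Longrightarrow> norm (b2 t x0) \<le> B2"
    using drift_coefficient_along_path(2)[OF b2 continuous_on_const[of "{0..S}" x0]] unfolding bounded_iff by (metis imageI)
  define B where "B = max B1 B2"
  have B0: "norm (b1 t x0) \<le> B" "norm (b2 t x0) \<le> B" if "t \<in> {0..S}" for t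
    using B1[OF that] B2[OF that] by (auto simp: B_def)
  have Bn: "0 \<le> B" using order_trans[OF norm_ge_zero B0(1)[of 0]] S by auto
  \<comment> \<open>The Lipschitz condition in space costs \<open>\<rho>\<close> / 2 within this
    radius; right continuity in time, up to \<open>t3\<close>, costs the other half.\<close>
  define \<delta> where "\<delta> = \<rho> / (2 * L)"
  have \<delta>: "0 < \<delta>" "L * \<delta> = \<rho> / 2" using \<rho> L by (auto simp: \<delta>_def)
  have "\<forall>\<^sub>F t in at_right 0. dist (b1 t x0 $ d) (b1 0 x0 $ d) < \<rho> / 2" "\<forall>\<^sub>F t in at_right 0. dist (b2 t x0 $ d) (b2 0 x0 $ d) < \<rho> / 2"
    using \<rho>(1) by (intro tendstoD[OF lim1] tendstoD[OF lim2]; simp)+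
  then have "\<forall>\<^sub>F t in at_right 0. dist (b1 t x0 $ d) (b1 0 x0 $ d) < \<rho> / 2 \<and> dist (b2 t x0 $ d) (b2 0 x0 $ d) < \<rho> / 2"
    by eventually_elim auto
  then obtain t3 where t3: "0 < t3" "\<And>t. 0 < t \<Longrightarrow> t < t3 \<Longrightarrow> \<bar>b1 t x0 $ d - b1 0 x0 $ d\<bar> < \<rho> / 2 \<and> \<bar>b2 t x0 $ d - b2 0 x0 $ d\<bar> < \<rho> / 2"
    unfolding eventually_at_right_field dist_real_def by auto
  define t2 where "t2 = t3 / 2"
  have t2: "0 < t2" using t3 by (simp add: t2_def)
  have near1: "q1 - \<rho> \<le> \<sigma> * b1 t x $ d" and near2: "- q2 - \<rho> \<le> \<sigma> * b2 t x $ d"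
    if t: "t \<in> {0..t2}" and x: "norm (x - x0) \<le> \<delta>" for t x
  proof -
    have s: "\<bar>c t x $ d - c 0 x0 $ d\<bar> \<le> \<rho>"
      if lip: "norm (c t x - c t x0) \<le> L * norm (x - x0)" and tt: "0 < t \<Longrightarrow> t < t3 \<Longrightarrow> \<bar>c t x0 $ d - c 0 x0 $ d\<bar> < \<rho> / 2" for c
    proof -
      have "\<bar>c t x $ d - c t x0 $ d\<bar> \<le> norm (c t x - c t x0)"
        using component_le_norm_cart[of "c t x - c t x0" d] by simp
      also have "\<dots> \<le> L * \<delta>" using lip mult_left_mono[OF x, of L] L by linarith
      finally have 1: "\<bar>c t x $ d - c t x0 $ d\<bar> \<le> \<rho> / 2" using \<delta> by simp
      have 2: "\<bar>c t x0 $ d - c 0 x0 $ d\<bar> \<le> \<rho> / 2"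
        using tt t t3(1) \<rho> unfolding t2_def by (cases "t = 0") auto
      show ?thesis using 1 2 by linarith
    qed
    have s': "\<bar>\<sigma> * (c t x $ d) - \<sigma> * (c 0 x0 $ d)\<bar> \<le> \<rho>" if "\<bar>c t x $ d - c 0 x0 $ d\<bar> \<le> \<rho>" for c
      using that \<sigma> by (simp add: abs_mult right_diff_distrib[symmetric])
    have "0 \<le> t" using t by simp
    from s'[OF s[OF lip1[OF this] t3(2)[THEN conjunct1]]] s'[OF s[OF lip2[OF this] t3(2)[THEN conjunct2]]]
    show "q1 - \<rho> \<le> \<sigma> * b1 t x $ d" "- q2 - \<rho> \<le> \<sigma> * b2 t x $ d"
      unfolding q by (auto simp: abs_le_iff)
  qed
  have near: "0 \<le> \<sigma> * b1 t x $ d" if "t \<in> {0..t2}" "norm (x - x0) \<le> \<delta>" for t x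
    using near1[OF that] \<rho> q(3) by linarith
  have lip1': "\<And>t x y. t \<in> {0..S} \<Longrightarrow> norm (b1 t x - b1 t y) \<le> L * norm (x - y)"
    and lip2': "\<And>t x y. t \<in> {0..S} \<Longrightarrow> norm (b2 t x - b2 t y) \<le> L * norm (x - y)"
    using lip1 lip2 by auto
  obtain t0 \<eta>0 where t0: "0 < t0" "t0 \<le> t2" "t0 \<le> S" and \<eta>0: "0 < \<eta>0"
    and region: "\<And>x v t. noisy_path b x0 S v x \<Longrightarrow> (\<forall>t\<in>{0..S}. norm (v t) \<le> \<eta>0) \<Longrightarrow> t \<in> {0..t0} \<Longrightarrow> norm (x t - x0) \<le> \<delta>"
    and follow: "\<And>x v t. noisy_path b x0 S v x \<Longrightarrow> (\<forall>t\<in>{0..S}. norm (v t) \<le> \<eta>0) \<Longrightarrow> \<rho> * t0 / 2 \<le> \<sigma> * x t0 $ d \<Longrightarrow>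
      t \<in> {0..S} \<Longrightarrow> norm (x t - X1 t) \<le> e"
    by (rule noisy_path_follows_branch[OF S L \<sigma> \<delta>(1) Bn \<rho>(1) t2 e lip1' lip2' B0(1) B0(2) b12 bb1 X1 near]) (assumption | rule that)+
  \<comment> \<open>With this level, y(t0) \<ge> \<open>- r\<close> says exactly that
    \<open>\<sigma>\<close> x_d(t0) \<ge> \<open>\<rho> * t0 / 2\<close>. As \<open>r\<close> does
    not depend on \<open>\<epsilon>\<close>, the potential at \<open>- r\<close> tends to
    -1.\<close>
  define r where "r = \<rho> * t0 / 2"
  have r: "0 < r" using \<rho> t0 by (simp add: r_def)
  obtain G c where G: "G \<in> sets M" "1 - \<eta>' \<le> prob G" "0 < c"
    "\<And>\<omega> t. \<omega> \<in> G \<Longrightarrow> t \<in> {0..S} \<Longrightarrow> norm (w t \<omega>) \<le> c"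
    using bounded_on_Icc_with_high_probability[OF prob_space_axioms wm wc \<eta>', of S] by metis
  have "((\<lambda>\<epsilon>. exp (- (2 * m / \<epsilon>\<^sup>2 * r))) \<longlongrightarrow> 0) (at_right 0)"
    using pm r by real_asymp
  then have "\<forall>\<^sub>F \<epsilon> in at_right 0. exp (- (2 * m / \<epsilon>\<^sup>2 * r)) < \<eta>'" using \<eta>' by (rule order_tendstoD)
  moreover have "\<forall>\<^sub>F \<epsilon> in at_right 0. \<epsilon> \<in> {0<..<\<eta>0 / c}"
    using \<eta>0 G(3) by (intro eventually_at_right_real) auto
  ultimately show ?thesis
  proof eventually_elim
    case (elim \<epsilon>)
    then have elim: "exp (- (2 * m / \<epsilon>\<^sup>2 * r)) < \<eta>'" "\<epsilon> < \<eta>0 / c" "0 < \<epsilon>" by auto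
    \<comment> \<open>This makes \<open>2 * m / \<epsilon>\<^sup>2 * \<theta>\<close> equal to
      \<open>\<eta>'\<close>, so starting the scheme at \<open>- \<theta>\<close> instead of 0 costs
      at most \<open>\<eta>'\<close>. That \<open>\<theta>\<close> shrinks with
      \<open>\<epsilon>\<close> is harmless, since \<open>n\<close> is chosen after
      \<open>\<epsilon>\<close>.\<close>
    define \<theta> where "\<theta> = \<eta>' * \<epsilon>\<^sup>2 / (2 * m)"
    have \<theta>: "0 < \<theta>" using \<eta>' elim pm by (simp add: \<theta>_def)
    define y where "y t \<omega> = \<sigma> * X \<epsilon> t \<omega> $ d - \<rho> * t" for t \<omega>
    define Z where "Z n k \<omega> = \<sigma> * \<epsilon> * (w (real (Suc k) * (t0 / real n)) \<omega> $ d) - \<sigma> * \<epsilon> * (w (real k * (t0 / real n)) \<omega> $ d)"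
      for n k :: nat and \<omega>
    note Xe = X[OF elim(3)]
    have Xm: "X \<epsilon> t \<in> borel_measurable M" if "0 \<le> t" for t
      by (rule strong_solution_measurable[OF w Xe that])
    have Xc: "continuous_on {0..S'} (\<lambda>t. X \<epsilon> t \<omega>)" if "\<omega> \<in> space M" for \<omega> S'
    proof (rule continuous_on_subset[of "{0..}"])
      show "continuous_on {0..} (\<lambda>t. X \<epsilon> t \<omega>)" using Xe that unfolding strong_solution_def by blast
    qed auto
    have ym: "y t \<in> borel_measurable M" if "t \<in> {0..t0}" for t
    proof -
      have [measurable]: "X \<epsilon> t \<in> borel_measurable M" using Xm that by auto
      show ?thesis unfolding y_def[abs_def] cart_eq_inner_axis by measurable
    qed
    have yc: "continuous_on {0..t0} (\<lambda>t. y t \<omega>)" if "\<omega> \<in> space M" for \<omega>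
      unfolding y_def by (intro continuous_intros Xc that)
    have ev1: "\<forall>\<^sub>F n in sequentially. \<exists>A\<in>events. 1 - \<eta>' \<le> prob A \<and> (\<forall>\<omega>\<in>A. \<forall>k<n.
        \<forall>t\<in>{real k * (t0 / real n)..real (Suc k) * (t0 / real n)}. y (real k * (t0 / real n)) \<omega> - \<theta> \<le> y t \<omega>)"
      by (rule prob_grid_oscillation[OF prob_space_axioms _ _ t0(1) \<theta> \<eta>']) (use ym yc in auto)
    have \<epsilon>2: "0 < \<epsilon>\<^sup>2" using elim by simp
    note ev2 = eventually_orbit_stays_up[OF pm(1,2) \<epsilon>2 t0(1) less_imp_le[OF r] less_imp_le[OF \<theta>] \<eta>' pm(3)]
    from eventually_happens'[OF sequentially_bot eventually_conj[OF ev1 eventually_conj[OF ev2 eventually_gt_at_top[of 0]]]]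
    obtain n where n: "0 < n"
      and osc: "\<exists>A\<in>events. 1 - \<eta>' \<le> prob A \<and> (\<forall>\<omega>\<in>A. \<forall>k<n.
          \<forall>t\<in>{real k * (t0 / real n)..real (Suc k) * (t0 / real n)}. y (real k * (t0 / real n)) \<omega> - \<theta> \<le> y t \<omega>)"
      and up: "\<And>Z. indep_vars (\<lambda>_. borel) Z {..<n} \<Longrightarrow>
        (\<forall>k<n. \<forall>l. integrable M (\<lambda>\<omega>. exp (l * Z k \<omega>)) \<and>
          expectation (\<lambda>\<omega>. exp (l * Z k \<omega>)) = exp (l\<^sup>2 * (\<epsilon>\<^sup>2 * (t0 / real n)) / 2)) \<Longrightarrow>
        exp (- (2 * m / \<epsilon>\<^sup>2 * \<theta>)) - exp (- (2 * m / \<epsilon>\<^sup>2 * r)) - \<eta>' \<le> (\<kappa> + 1) *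
          prob {\<omega> \<in> space M. - r \<le> noisy_orbit (\<lambda>v. v + t0 / real n * repulsive_drift p m v) (- \<theta>) (\<lambda>j. Z j \<omega>) n}"
      by (elim exE conjE) (rule that, assumption+, blast)
    obtain A where A: "A \<in> events" "1 - \<eta>' \<le> prob A"
        "\<And>\<omega> k t. \<omega> \<in> A \<Longrightarrow> k < n \<Longrightarrow> t \<in> {real k * (t0 / real n)..real (Suc k) * (t0 / real n)} \<Longrightarrow>
          y (real k * (t0 / real n)) \<omega> - \<theta> \<le> y t \<omega>"
      using osc by blast
    let ?V = "\<lambda>\<omega>. noisy_orbit (\<lambda>v. v + t0 / real n * repulsive_drift p m v) (- \<theta>) (\<lambda>j. Z n j \<omega>) n"
    let ?U = "{\<omega> \<in> space M. - r \<le> ?V \<omega>}"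
    let ?T = "{\<omega> \<in> space M. \<forall>t\<in>{0..S}. norm (X \<epsilon> t \<omega> - X1 t) \<le> e}"
    have h: "0 < t0 / real n" using t0 n by simp
    have ind: "indep_vars (\<lambda>_. borel) (Z n) {..<n}"
      using wiener_indep_increments_component[OF w h, of "\<sigma> * \<epsilon>" d n] unfolding Z_def[abs_def] .
    have mgf: "integrable M (\<lambda>\<omega>. exp (l * Z n k \<omega>)) \<and>
          expectation (\<lambda>\<omega>. exp (l * Z n k \<omega>)) = exp (l\<^sup>2 * (\<epsilon>\<^sup>2 * (t0 / real n)) / 2)" for k l
    proof -
      have st: "0 \<le> real k * (t0 / real n)" "real k * (t0 / real n) < real (Suc k) * (t0 / real n)"
        using h by (simp_all add: mult_strict_right_mono del: times_divide_eq_right)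
      have Zeq: "l * Z n k \<omega> = (l * \<sigma> * \<epsilon>) * (w (real (Suc k) * (t0 / real n)) \<omega> $ d - w (real k * (t0 / real n)) \<omega> $ d)" for \<omega>
        unfolding Z_def by (simp only: right_diff_distrib mult.assoc)
      have dt: "real (Suc k) * (t0 / real n) - real k * (t0 / real n) = t0 / real n"
        by (simp add: distrib_right add_divide_distrib)
      have sq: "(l * \<sigma> * \<epsilon>)\<^sup>2 * (t0 / real n) / 2 = l\<^sup>2 * (\<epsilon>\<^sup>2 * (t0 / real n)) / 2"
        using \<sigma> by (simp add: power_mult_distrib abs_square_eq_1[symmetric])
      show ?thesis
        using wiener_increment_mgf[OF w st, of "l * \<sigma> * \<epsilon>" d] unfolding Zeq dt sq by blast
    qed
    have Vm: "?U \<in> events"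
    proof -
      have Zm: "Z n j \<in> borel_measurable M" for j
      proof -
        have [measurable]: "w (real (Suc j) * (t0 / real n)) \<in> borel_measurable M" "w (real j * (t0 / real n)) \<in> borel_measurable M"
          by (intro wm mult_nonneg_nonneg of_nat_0_le_iff less_imp_le[OF h])+
        show ?thesis unfolding Z_def[abs_def] cart_eq_inner_axis by measurable
      qed
      have "(\<lambda>\<omega>. \<lambda>j\<in>{..<n}. Z n j \<omega>) \<in> measurable M (PiM {..<n} (\<lambda>_. borel))"
        using Zm by (intro measurable_restrict) auto
      then have "(\<lambda>\<omega>. noisy_orbit (\<lambda>v. v + t0 / real n * repulsive_drift p m v) (- \<theta>) (\<lambda>j\<in>{..<n}. Z n j \<omega>) n) \<in> borel_measurable M"
        by (rule measurable_compose[OF _ measurable_noisy_orbit]) auto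
      also have "(\<lambda>\<omega>. noisy_orbit (\<lambda>v. v + t0 / real n * repulsive_drift p m v) (- \<theta>) (\<lambda>j\<in>{..<n}. Z n j \<omega>) n) = ?V"
        by (intro ext noisy_orbit_cong) auto
      finally have [measurable]: "?V \<in> borel_measurable M" .
      show ?thesis by measurable
    qed
    have Tm: "?T \<in> events"
    proof (rule sets_Collect_le_interval)
      fix t assume "t \<in> {0..S}"
      then have [measurable]: "X \<epsilon> t \<in> borel_measurable M" using Xm by auto
      show "(\<lambda>\<omega>. norm (X \<epsilon> t \<omega> - X1 t)) \<in> borel_measurable M" by measurable
    next
      fix \<omega> assume "\<omega> \<in> space M"
      then show "continuous_on {0..S} (\<lambda>t. norm (X \<epsilon> t \<omega> - X1 t))"
        using X1(1) unfolding noisy_path_def by (intro continuous_intros Xc) auto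
    qed
    have AEN: "AE \<omega> in M. noisy_path b x0 S (\<lambda>t. \<epsilon> *\<^sub>R w t \<omega>) (\<lambda>t. X \<epsilon> t \<omega>)"
      by (rule strong_solution_noisy_path[OF Xe]) (rule b)
    have "AE \<omega> in M. \<omega> \<in> ?U \<inter> A \<inter> G \<longrightarrow> \<omega> \<in> ?T"
      using AEN w0 AE_space
    proof eventually_elim
      case (elim \<omega>)
      note N = elim(1)
      show ?case
      proof
        assume \<omega>: "\<omega> \<in> ?U \<inter> A \<inter> G"
        have v: "\<forall>t\<in>{0..S}. norm (\<epsilon> *\<^sub>R w t \<omega>) \<le> \<eta>0"
        proof
          fix t assume "t \<in> {0..S}"
          then have "norm (w t \<omega>) \<le> c" using G(4) \<omega> by auto
          then have "\<epsilon> * norm (w t \<omega>) \<le> \<eta>0 / c * c"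
            using \<open>\<epsilon> < \<eta>0 / c\<close> \<open>0 < \<epsilon>\<close> \<eta>0 G(3) by (intro mult_mono) auto
          then show "norm (\<epsilon> *\<^sub>R w t \<omega>) \<le> \<eta>0" using \<open>0 < \<epsilon>\<close> G(3) by simp
        qed
        let ?a = "\<lambda>t. \<sigma> * b t (X \<epsilon> t \<omega>) $ d - \<rho>"
        let ?W = "\<lambda>t. \<sigma> * \<epsilon> * (w t \<omega> $ d)"
        have bi: "(\<lambda>s. b s (X \<epsilon> s \<omega>)) integrable_on {s..t}" if "0 \<le> s" "t \<le> t0" for s t
          using noisy_path_integrable[OF N, of s t] that t0 by auto
        have ai: "?a integrable_on {s..t}" if "0 \<le> s" "t \<le> t0" for s t
          by (intro integrable_diff integrable_on_mult_right integral_vec_nth(1) bi that integrable_const_ivl)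
        have "?V \<omega> + \<theta> \<le> y (real n * (t0 / real n)) \<omega>"
          unfolding Z_def
        proof (rule noisy_orbit_le_path[OF less_imp_le[OF pm(1)] less_imp_le[OF pm(2)] t0(1) n _ ai])
          have "X \<epsilon> 0 \<omega> = x0" using N S elim(2) unfolding noisy_path_def by auto
          then show "0 \<le> y 0 \<omega>" by (simp add: y_def x0)
        next
          fix s t :: real assume st: "0 \<le> s" "s \<le> t" "t \<le> t0"
          have "t \<le> S" using st t0 by simp
          have "integral {s..t} ?a = \<sigma> * integral {s..t} (\<lambda>s. b s (X \<epsilon> s \<omega>)) $ d - \<rho> * (t - s)"
            using st by (subst Henstock_Kurzweil_Integration.integral_diff)
              (auto simp: integral_vec_nth(2)[OF bi[OF st(1,3)]] algebra_simps
                intro!: integrable_on_mult_right integral_vec_nth(1) bi)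
          moreover have "X \<epsilon> t \<omega> - X \<epsilon> s \<omega> = integral {s..t} (\<lambda>s. b s (X \<epsilon> s \<omega>)) + (\<epsilon> *\<^sub>R w t \<omega> - \<epsilon> *\<^sub>R w s \<omega>)"
            by (rule noisy_path_increment[OF N st(1,2) \<open>t \<le> S\<close>])
          then have "(X \<epsilon> t \<omega> - X \<epsilon> s \<omega>) $ d = (integral {s..t} (\<lambda>s. b s (X \<epsilon> s \<omega>)) + (\<epsilon> *\<^sub>R w t \<omega> - \<epsilon> *\<^sub>R w s \<omega>)) $ d"
            by (rule arg_cong)
          then have "\<sigma> * (X \<epsilon> t \<omega> $ d - X \<epsilon> s \<omega> $ d) = \<sigma> * (integral {s..t} (\<lambda>s. b s (X \<epsilon> s \<omega>)) $ d + (\<epsilon> * w t \<omega> $ d - \<epsilon> * w s \<omega> $ d))"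
            by simp
          ultimately show "y t \<omega> - y s \<omega> = integral {s..t} ?a + (?W t - ?W s)"
            unfolding y_def by (simp add: algebra_simps)
        next
          fix t assume t: "t \<in> {0..t0}"
          have x: "norm (X \<epsilon> t \<omega> - x0) \<le> \<delta>" by (rule region[OF N v t])
          have tt: "t \<in> {0..t2}" using t t0 by auto
          show "repulsive_drift p m (y t \<omega>) \<le> ?a t"
          proof (cases "0 < y t \<omega>")
            case True
            then have "0 < \<sigma> * X \<epsilon> t \<omega> $ d" using t \<rho>(1) unfolding y_def
              by (auto intro: le_less_trans[OF mult_nonneg_nonneg[of \<rho> t]])
            then show ?thesis using True near1[OF tt x] bb1[of "X \<epsilon> t \<omega>" t]
              by (simp add: repulsive_drift_def p_def)
          next
            \<comment> \<open>Here x may be on either side of the hyperplane. Both bounds suffice: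
              \<open>q1\<close> - 2 \<open>\<rho>\<close> is positive, and the other one is
              \<open>- m\<close>.\<close>
            case False
            then show ?thesis using near1[OF tt x] near2[OF tt x] b12[of t "X \<epsilon> t \<omega>"] q \<rho>
              by (auto simp: repulsive_drift_def m_def)
          qed
        next
          fix k t assume "k < n" "t \<in> {real k * (t0 / real n)..real (Suc k) * (t0 / real n)}"
          then show "y (real k * (t0 / real n)) \<omega> - \<theta> \<le> y t \<omega>" using A(3) \<omega> by blast
        qed auto
        then have "- r \<le> y t0 \<omega>" using \<omega> \<theta> n by auto
        then have "\<rho> * t0 / 2 \<le> \<sigma> * X \<epsilon> t0 \<omega> $ d" unfolding y_def r_def by (simp add: field_simps)
        then show "\<omega> \<in> ?T" using follow[OF N v] elim(3) by auto
      qed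
    qed
    then have "prob (?U \<inter> A \<inter> G) \<le> prob ?T"
      using Tm by (intro finite_measure_mono_AE) auto
    moreover have "prob ?U - \<eta>' - \<eta>' \<le> prob (?U \<inter> A \<inter> G)"
    proof -
      have AG: "prob (space M - A) \<le> \<eta>'" "prob (space M - G) \<le> \<eta>'"
        using A G by (auto simp: prob_compl)
      have "prob ?U \<le> prob (?U \<inter> A \<inter> G \<union> (space M - A) \<union> (space M - G))"
        using Vm A(1) G(1) by (intro finite_measure_mono) auto
      also have "\<dots> \<le> prob (?U \<inter> A \<inter> G \<union> (space M - A)) + prob (space M - G)"
        using Vm A(1) G(1) by (intro measure_Un_le) auto
      also have "prob (?U \<inter> A \<inter> G \<union> (space M - A)) \<le> prob (?U \<inter> A \<inter> G) + prob (space M - A)"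
        using Vm A(1) G(1) by (intro measure_Un_le) auto
      finally show ?thesis using AG by linarith
    qed
    moreover have "1 / (\<kappa> + 1) - 3 * \<eta>' \<le> prob ?U"
    proof -
      have "1 - \<eta>' \<le> exp (- (2 * m / \<epsilon>\<^sup>2 * \<theta>))"
        using exp_ge_add_one_self[of "- \<eta>'"] elim(3) pm by (simp add: \<theta>_def)
      then have "1 - 3 * \<eta>' \<le> (\<kappa> + 1) * prob ?U"
        using up[OF ind] mgf elim(1) by fastforce
      then have "(1 - 3 * \<eta>') / (\<kappa> + 1) \<le> prob ?U" using pm(4) by (simp add: field_simps)
      moreover have "3 * \<eta>' / (\<kappa> + 1) \<le> 3 * \<eta>'" using pm(4) \<eta>' by (simp add: field_simps)
      ultimately show ?thesis by (simp add: diff_divide_distrib)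
    qed
    ultimately show ?case using \<rho>(3) \<kappa>1 \<eta> unfolding \<eta>'_def by linarith
  qed
qed

section \<open>Weak convergence\<close>

text \<open>The minimum of a real number and a positive \<open>\<tau>\<close> is finite, so the
  default value of \<open>real_of_ereal\<close> at infinity never appears: the clock is t or the
  minimum of t and a positive constant.\<close>

lemma stopped_path_time:
  assumes "0 < \<tau>"
  shows "0 \<le> t \<Longrightarrow> 0 \<le> real_of_ereal (min (ereal t) \<tau>)"
    and "0 < t \<Longrightarrow> 0 < real_of_ereal (min (ereal t) \<tau>)"
    and "ereal (real_of_ereal (min (ereal t) \<tau>)) \<le> \<tau>"
    and "s \<le> t \<Longrightarrow> real_of_ereal (min (ereal s) \<tau>) \<le> real_of_ereal (min (ereal t) \<tau>)"
    and "continuous_on A (\<lambda>t. real_of_ereal (min (ereal t) \<tau>))"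
proof -
  consider "\<tau> = \<infinity>" | c where "0 < c" "\<tau> = ereal c" using assms by (cases \<tau>) auto
  then have "\<exists>f. (\<forall>t. real_of_ereal (min (ereal t) \<tau>) = f t) \<and> (\<forall>t\<ge>0. 0 \<le> f t) \<and> (\<forall>t>0. 0 < f t) \<and>
    (\<forall>t. ereal (f t) \<le> \<tau>) \<and> mono f \<and> continuous_on A f"
  proof cases
    case 1
    then show ?thesis by (intro exI[of _ "\<lambda>t. t"]) (auto simp: mono_def)
  next
    case 2
    then show ?thesis
      by (intro exI[of _ "\<lambda>t. min t c"]) (auto simp: mono_def simp flip: ereal_min intro!: continuous_intros)
  qed
  then show "0 \<le> t \<Longrightarrow> 0 \<le> real_of_ereal (min (ereal t) \<tau>)"
    and "0 < t \<Longrightarrow> 0 < real_of_ereal (min (ereal t) \<tau>)"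
    and "ereal (real_of_ereal (min (ereal t) \<tau>)) \<le> \<tau>"
    and "s \<le> t \<Longrightarrow> real_of_ereal (min (ereal s) \<tau>) \<le> real_of_ereal (min (ereal t) \<tau>)"
    and "continuous_on A (\<lambda>t. real_of_ereal (min (ereal t) \<tau>))"
    by (auto simp: mono_def)
qed

lemma stopped_path_in_paths:
  assumes \<tau>: "0 < \<tau>" and x: "continuous_on {t. 0 \<le> t \<and> ereal t \<le> \<tau>} x"
  shows "stopped_path \<tau> x \<in> paths"
proof -
  have "continuous_on {0..} (\<lambda>t. x (real_of_ereal (min (ereal t) \<tau>)))"
    by (rule continuous_on_compose2[OF x stopped_path_time(5)[OF \<tau>]])
      (auto intro: stopped_path_time[OF \<tau>])
  then have "continuous_on {0..} (stopped_path \<tau> x)"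
    by (rule continuous_on_eq) (simp add: stopped_path_def)
  then show ?thesis by (auto simp: paths_def stopped_path_def)
qed

lemma borel_measurable_borel_of:
  fixes \<phi> :: "'b \<Rightarrow> real"
  assumes "continuous_map T euclideanreal \<phi>"
  shows "\<phi> \<in> borel_measurable (borel_of T)"
proof (rule borel_measurableI)
  fix S :: "real set" assume "open S"
  then have "openin T {x \<in> topspace T. \<phi> x \<in> S}"
    using assms by (intro openin_continuous_map_preimage[of T euclideanreal]) auto
  moreover have "\<phi> -` S \<inter> space (borel_of T) = {x \<in> topspace T. \<phi> x \<in> S}"
    by (auto simp: borel_of_def space_measure_of_conv)
  moreover have "{U. openin T U} \<subseteq> Pow (topspace T)" using openin_subset by blast
  ultimately show "\<phi> -` S \<inter> space (borel_of T) \<in> sets (borel_of T)"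
    by (simp add: borel_of_def sets_measure_of)
qed

lemma space_borel_of [simp]: "space (borel_of T) = topspace T"
  by (simp add: borel_of_def space_measure_of_conv)

lemma path_continuous_map_near:
  fixes \<phi> :: "(real \<Rightarrow> 'v::metric_space) \<Rightarrow> real"
  assumes \<phi>: "continuous_map path_topology euclideanreal \<phi>" and f: "f \<in> paths" and e: "0 < e"
  obtains T r where "0 < T" "0 < r"
    "\<And>g. g \<in> paths \<Longrightarrow> (\<forall>t\<in>{0..T}. dist (g t) (f t) < r) \<Longrightarrow> \<bar>\<phi> g - \<phi> f\<bar> < e"
proof -
  let ?U = "{g \<in> topspace path_topology. \<phi> g \<in> ball (\<phi> f) e}"
  have "path_open ?U" unfolding openin_path_topology[symmetric]
    using \<phi> by (intro openin_continuous_map_preimage[of path_topology euclideanreal]) auto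
  moreover have "f \<in> ?U" using f e by (simp add: topspace_path_topology)
  ultimately obtain K r where K: "compact K" "K \<subseteq> {0..}" "0 < r"
    "\<And>g. g \<in> paths \<Longrightarrow> \<forall>t\<in>K. dist (g t) (f t) < r \<Longrightarrow> g \<in> ?U"
    unfolding path_open_def by meson
  obtain B where B: "\<And>t. t \<in> K \<Longrightarrow> \<bar>t\<bar> \<le> B"
    using compact_imp_bounded[OF K(1)] unfolding bounded_real by blast
  show ?thesis
  proof (rule that[of "\<bar>B\<bar> + 1" r])
    fix g assume g: "g \<in> paths" "\<forall>t\<in>{0..\<bar>B\<bar> + 1}. dist (g t) (f t) < r"
    have "\<forall>t\<in>K. dist (g t) (f t) < r"
    proof
      fix t assume t: "t \<in> K"
      then have "t \<in> {0..\<bar>B\<bar> + 1}" using B[OF t] K(2) by auto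
      then show "dist (g t) (f t) < r" using g(2) by blast
    qed
    from K(4)[OF g(1) this] show "\<bar>\<phi> g - \<phi> f\<bar> < e" by (simp add: dist_real_def abs_minus_commute)
  qed (use K in auto)
qed

text \<open>Here lower bounds become limits: \<open>A\<close> and \<open>B\<close> are disjoint and
  \<open>p + q = 1\<close>, so each probability is within \<open>\<eta>\<close> of its target and at
  most \<open>2 * \<eta>\<close> of mass lies outside both. The outside mass and the two deviations
  each cost \<open>2 * C * \<eta>\<close> in total.\<close>

lemma (in prob_space) expectation_near_two_values:
  fixes F :: "'a \<Rightarrow> real"
  assumes F: "F \<in> borel_measurable M" "\<And>\<omega>. \<omega> \<in> space M \<Longrightarrow> \<bar>F \<omega>\<bar> \<le> C"
    and AB: "A \<in> events" "B \<in> events" "A \<inter> B = {}"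
    and a: "\<And>\<omega>. \<omega> \<in> A \<Longrightarrow> \<bar>F \<omega> - a\<bar> \<le> e" "\<bar>a\<bar> \<le> C" and b: "\<And>\<omega>. \<omega> \<in> B \<Longrightarrow> \<bar>F \<omega> - b\<bar> \<le> e" "\<bar>b\<bar> \<le> C"
    and pq: "p + q = 1" "p - \<eta> \<le> prob A" "q - \<eta> \<le> prob B" and e: "0 \<le> e"
  shows "\<bar>expectation F - (p * a + q * b)\<bar> \<le> e + 4 * C * \<eta>"
proof -
  have C: "0 \<le> C" using a(2) by linarith
  have FI: "integrable M F" by (rule integrable_const_bound[of _ C]) (use F in auto)
  let ?R = "\<lambda>\<omega>. a * indicator A \<omega> + b * indicator B \<omega>"
  have AI: "integrable M (indicator A :: 'a \<Rightarrow> real)" "integrable M (indicator B :: 'a \<Rightarrow> real)"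
    using AB by (auto simp: less_top[symmetric])
  have RI: "integrable M ?R" using AI by auto
  let ?S = "\<lambda>\<omega>. e + C * (1 - indicator A \<omega> - indicator B \<omega>)"
  have "\<bar>expectation F - expectation ?R\<bar> = \<bar>expectation (\<lambda>\<omega>. F \<omega> - ?R \<omega>)\<bar>"
    using FI RI by simp
  also have "\<dots> \<le> expectation (\<lambda>\<omega>. \<bar>F \<omega> - ?R \<omega>\<bar>)" by (rule integral_abs_bound)
  also have "\<dots> \<le> expectation ?S"
  proof (rule integral_mono)
    fix \<omega> assume \<omega>: "\<omega> \<in> space M"
    show "\<bar>F \<omega> - ?R \<omega>\<bar> \<le> ?S \<omega>"
      using a b AB(3) F(2)[OF \<omega>] e by (auto simp: indicator_def)
  qed (use FI RI AI in auto)
  also have "\<dots> = e + C * (1 - prob A - prob B)" using AI AB by (simp add: prob_space)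
  also have "\<dots> \<le> e + C * (2 * \<eta>)" using pq C by (intro add_left_mono mult_left_mono) auto
  finally have 1: "\<bar>expectation F - expectation ?R\<bar> \<le> e + C * (2 * \<eta>)" .
  have R: "expectation ?R = a * prob A + b * prob B" using AI AB by simp
  have "prob A + prob B = prob (A \<union> B)" using AB by (simp add: finite_measure_Union)
  then have AB1: "prob A + prob B \<le> 1" by simp
  have "\<bar>expectation ?R - (p * a + q * b)\<bar> = \<bar>a * (prob A - p) + b * (prob B - q)\<bar>"
    unfolding R by (simp add: algebra_simps)
  also have "\<dots> \<le> \<bar>a\<bar> * \<bar>prob A - p\<bar> + \<bar>b\<bar> * \<bar>prob B - q\<bar>"
    by (metis abs_mult abs_triangle_ineq)
  also have "\<dots> \<le> C * \<eta> + C * \<eta>"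
    using pq AB1 a(2) b(2) C by (intro add_mono mult_mono) auto
  finally show ?thesis using 1 by linarith
qed

text \<open>Seen as the image of a coin toss, the limit measure is evidently a probability measure,
  and integrals against it reduce to a two-term sum.\<close>

lemma add_measure_return_eq_distr_bernoulli:
  assumes p: "0 \<le> p" "p \<le> 1" and fg: "f \<in> space N" "g \<in> space N"
  shows "add_measure (scale_measure (ennreal (1 - p)) (return N g)) (scale_measure (ennreal p) (return N f))
    = distr (measure_pmf (bernoulli_pmf p)) N (\<lambda>b. if b then f else g)"
proof (rule measure_eqI)
  fix A assume "A \<in> sets (add_measure (scale_measure (ennreal (1 - p)) (return N g)) (scale_measure (ennreal p) (return N f)))"
  then have A: "A \<in> sets N" by simp
  have h: "(\<lambda>b. if b then f else g) \<in> measurable (measure_pmf (bernoulli_pmf p)) N" using fg by auto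
  have "emeasure (distr (measure_pmf (bernoulli_pmf p)) N (\<lambda>b. if b then f else g)) A
    = (\<integral>\<^sup>+x. indicator A x \<partial>distr (measure_pmf (bernoulli_pmf p)) N (\<lambda>b. if b then f else g))"
    using A by simp
  also have "\<dots> = (\<integral>\<^sup>+b. indicator A (if b then f else g) \<partial>measure_pmf (bernoulli_pmf p))"
    using A by (intro nn_integral_distr h) auto
  also have "\<dots> = indicator A f * ennreal p + indicator A g * ennreal (1 - p)"
    using p by (subst nn_integral_bernoulli_pmf) auto
  finally show "emeasure (add_measure (scale_measure (ennreal (1 - p)) (return N g)) (scale_measure (ennreal p) (return N f))) A
    = emeasure (distr (measure_pmf (bernoulli_pmf p)) N (\<lambda>b. if b then f else g)) A"
    using A by (subst emeasure_add_measure) (auto simp: ac_simps)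
qed simp

section \<open>The deterministic branches and the drift at the starting point\<close>

lemma solves_until_return_noisy_path:
  fixes f :: "real \<Rightarrow> real ^ 'n \<Rightarrow> real ^ 'n"
  assumes f: "drift_coefficient f" and X: "solves_until_return H f x0 X \<tau>" and S: "ereal S \<le> \<tau>"
  shows "noisy_path f x0 S (\<lambda>_. 0) X"
proof -
  have le: "ereal t \<le> \<tau>" if "t \<le> S" for t
    by (rule order_trans[OF _ S]) (use that in simp)
  have "continuous_on {t. 0 \<le> t \<and> ereal t \<le> \<tau>} X" using X unfolding solves_until_return_def by blast
  then have c: "continuous_on {0..S} X" by (rule continuous_on_subset) (use le in auto)
  show ?thesis
  proof (rule noisy_pathI)
    show "set_integrable lborel {0..S} (\<lambda>s. f s (X s))" by (rule set_integrable_drift_coefficient[OF f c])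
  qed (use c X le in \<open>auto simp: solves_until_return_def\<close>)
qed

text \<open>Repulsion is assumed only off the hyperplane. Approaching \<open>x0\<close> along the
  normal direction, the Lipschitz condition carries the bound to \<open>x0\<close> itself, so that
  the denominator of the limit probabilities is positive.\<close>

lemma drift_component_at_boundary:
  fixes f :: "real \<Rightarrow> real ^ 'n \<Rightarrow> real ^ 'n"
  assumes f: "drift_coefficient f" and x0: "x0 $ d = 0" and \<sigma>: "\<bar>\<sigma>\<bar> = 1" and t: "0 \<le> t" and \<delta>: "0 < \<delta>"
    and le: "\<And>x. 0 < \<sigma> * x $ d \<Longrightarrow> norm (x - x0) \<le> \<delta> \<Longrightarrow> c \<le> \<sigma> * f t x $ d"
  shows "c \<le> \<sigma> * f t x0 $ d"
proof (rule field_le_epsilon)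
  fix e :: real assume e: "0 < e"
  obtain L where L: "0 < L" "\<And>t x y. 0 \<le> t \<Longrightarrow> norm (f t x - f t y) \<le> L * norm (x - y)"
    using drift_coefficient_lipschitz[OF f] by metis
  define s where "s = min \<delta> (e / L)"
  have s: "0 < s" "s \<le> \<delta>" "s \<le> e / L" using \<delta> e L by (auto simp: s_def)
  define x where "x = x0 + (\<sigma> * s) *\<^sub>R axis d (1::real)"
  have xd: "x $ d = \<sigma> * s" by (simp add: x_def x0)
  have n: "norm (x - x0) = s" using \<sigma> s by (simp add: x_def abs_mult)
  have "\<sigma> * \<sigma> = 1" using \<sigma> by (metis abs_mult_self_eq mult_1)
  then have "0 < \<sigma> * x $ d" using s unfolding xd mult.assoc[symmetric] by simp
  then have "c \<le> \<sigma> * f t x $ d" using le n s by auto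
  moreover have "\<bar>\<sigma> * f t x $ d - \<sigma> * f t x0 $ d\<bar> = \<bar>(f t x - f t x0) $ d\<bar>"
    using \<sigma> by (simp add: right_diff_distrib[symmetric] abs_mult)
  moreover have "\<bar>(f t x - f t x0) $ d\<bar> \<le> norm (f t x - f t x0)" by (rule component_le_norm_cart)
  moreover have "norm (f t x - f t x0) \<le> L * s" using L(2)[OF t, of x x0] n by simp
  moreover have "L * s \<le> e" using s L by (simp add: field_simps)
  ultimately show "c \<le> \<sigma> * f t x0 $ d + e" by linarith
qed

text \<open>Shortly after time 0 the normal drift stays above half of its initial value: a quarter
  is spent on the motion in space, a quarter on right continuity in time. Once the path is on the
  correct side, the intermediate value theorem keeps it there until it meets the hyperplane.\<close>

lemma solution_enters_half_space:
  fixes f :: "real \<Rightarrow> real ^ 'n \<Rightarrow> real ^ 'n"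
  assumes f: "drift_coefficient f" and X: "noisy_path f x0 S (\<lambda>_. 0) X" and x0: "x0 $ d = 0" and \<sigma>: "\<bar>\<sigma>\<bar> = 1"
    and lim: "((\<lambda>t. f t x0 $ d) \<longlongrightarrow> f 0 x0 $ d) (at_right 0)" and q: "0 < \<sigma> * f 0 x0 $ d"
    and nz: "\<And>t. 0 < t \<Longrightarrow> t < S \<Longrightarrow> X t $ d \<noteq> 0" and t: "0 < t" "t < S"
  shows "0 < \<sigma> * X t $ d"
proof -
  obtain L where L: "0 < L" "\<And>t x y. 0 \<le> t \<Longrightarrow> norm (f t x - f t y) \<le> L * norm (x - y)"
    using drift_coefficient_lipschitz[OF f] by metis
  define q where "q = \<sigma> * f 0 x0 $ d"
  have q0: "0 < q" using q by (simp add: q_def)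
  have cont: "continuous_on {0..S} X" using X unfolding noisy_path_def by blast
  have X0: "X 0 = x0" using X t unfolding noisy_path_def by auto
  have "\<forall>\<^sub>F s in at_right 0. dist (f s x0 $ d) (f 0 x0 $ d) < q / 4"
    by (rule tendstoD[OF lim]) (use q0 in simp)
  then obtain t3 where t3: "0 < t3" "\<And>s. 0 < s \<Longrightarrow> s < t3 \<Longrightarrow> \<bar>f s x0 $ d - f 0 x0 $ d\<bar> < q / 4"
    unfolding eventually_at_right_field dist_real_def by auto
  obtain t4 where t4: "0 < t4" "\<And>s. s \<in> {0..S} \<Longrightarrow> s < t4 \<Longrightarrow> norm (X s - x0) < q / (4 * L)"
  proof -
    have "0 < q / (4 * L)" using q0 L by simp
    moreover have "0 \<in> {0..S}" using t by simp
    ultimately obtain r where "0 < r" "\<forall>s\<in>{0..S}. dist s 0 < r \<longrightarrow> dist (X s) (X 0) < q / (4 * L)"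
      using cont unfolding continuous_on_iff by meson
    then show ?thesis by (intro that[of r]) (auto simp: dist_norm X0)
  qed
  define u where "u = min (min t3 t4 / 2) t"
  have u: "0 < u" "u < t3" "u < t4" "u \<le> t" using t3(1) t4(1) t by (auto simp: u_def)
  have g: "q / 2 \<le> \<sigma> * f s (X s) $ d" if s: "s \<in> {0..u}" for s
  proof -
    have "norm (X s - x0) < q / (4 * L)" using t4(2)[of s] s u t by auto
    then have "L * norm (X s - x0) < q / 4" using L(1) by (simp add: field_simps)
    then have "norm (f s (X s) - f s x0) < q / 4" using L(2)[of s "X s" x0] s by auto
    then have "\<bar>(f s (X s) - f s x0) $ d\<bar> < q / 4"
      using component_le_norm_cart[of "f s (X s) - f s x0" d] by linarith
    moreover have "\<bar>f s x0 $ d - f 0 x0 $ d\<bar> < q / 4"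
      using t3(2)[of s] s u q0 by (cases "s = 0") auto
    ultimately have "\<bar>f s (X s) $ d - f 0 x0 $ d\<bar> < q / 2" unfolding vector_minus_component by linarith
    moreover have "\<bar>\<sigma> * f s (X s) $ d - q\<bar> = \<bar>f s (X s) $ d - f 0 x0 $ d\<bar>"
      using \<sigma> by (simp add: q_def right_diff_distrib[symmetric] abs_mult)
    ultimately show ?thesis by linarith
  qed
  have fi: "(\<lambda>s. f s (X s)) integrable_on {0..u}"
    using u t by (intro noisy_path_integrable[OF X]) auto
  have "X u = x0 + integral {0..u} (\<lambda>s. f s (X s))" using X u t unfolding noisy_path_def by auto
  then have "\<sigma> * X u $ d = integral {0..u} (\<lambda>s. \<sigma> * f s (X s) $ d)"
    by (simp add: x0 integral_vec_nth(2)[OF fi])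
  also have "\<dots> \<ge> integral {0..u} (\<lambda>_. q / 2)"
    using g by (intro integral_le integrable_on_mult_right integral_vec_nth(1) fi) (auto intro: integrable_const_ivl)
  also have "integral {0..u} (\<lambda>_. q / 2) = u * (q / 2)" using u by simp
  finally have up: "0 < \<sigma> * X u $ d" using u q0 by (smt (verit) mult_pos_pos half_gt_zero)
  show ?thesis
  proof (rule ccontr)
    assume "\<not> 0 < \<sigma> * X t $ d"
    moreover have "continuous_on {u..t} (\<lambda>s. \<sigma> * X s $ d)"
      using u t by (intro continuous_intros continuous_on_subset[OF cont]) auto
    ultimately obtain s where s: "u \<le> s" "s \<le> t" "\<sigma> * X s $ d = 0"
      using IVT2'[of "\<lambda>s. \<sigma> * X s $ d" t 0 u] up u by auto
    then show False using nz[of s] u t \<sigma> by auto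
  qed
qed

theorem theorem2:
  fixes d :: "'n::finite"
    and bp bm :: "real \<Rightarrow> real ^ 'n \<Rightarrow> real ^ 'n"
    and M :: "'a measure"
    and w :: "real \<Rightarrow> 'a \<Rightarrow> real ^ 'n"
    and X :: "real \<Rightarrow> real \<Rightarrow> 'a \<Rightarrow> real ^ 'n"
    and x0 :: "real ^ 'n"
    and Xp Xm :: "real \<Rightarrow> real ^ 'n"
    and \<tau>p \<tau>m :: ereal
  assumes bp: "drift_coefficient bp"
    and bm: "drift_coefficient bm"
    and w: "wiener_process M w"
    and X: "\<And>\<epsilon>. 0 < \<epsilon> \<Longrightarrow> strong_solution M w (glued_drift d bp bm) \<epsilon> x0 (X \<epsilon>)"
    and x0: "x0 \<in> hyperplane d"
    and repulsive: "\<exists>T>0. \<exists>\<delta>>0. \<exists>c>0. \<forall>t\<in>{0..T}. \<forall>x. x \<notin> hyperplane d \<and> norm (x - x0) \<le> \<delta>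
           \<longrightarrow> sgn (x $ d) * (glued_drift d bp bm t x $ d) \<ge> c"
    and bp_right_continuous: "continuous (at_right 0) (\<lambda>t. bp t x0 $ d)"
    and bm_right_continuous: "continuous (at_right 0) (\<lambda>t. bm t x0 $ d)"
    and Xp: "solves_until_return (hyperplane d) bp x0 Xp \<tau>p"
    and Xm: "solves_until_return (hyperplane d) bm x0 Xm \<tau>m"
  shows "(\<forall>t. 0 < t \<and> ereal t < \<tau>p \<longrightarrow> Xp t $ d > 0) \<and>
         (\<forall>t. 0 < t \<and> ereal t < \<tau>m \<longrightarrow> Xm t $ d < 0) \<and>
         weakly_converges path_topology
           (\<lambda>\<epsilon>. distr M (borel_of path_topology) (\<lambda>\<omega>. stopped_path (min \<tau>p \<tau>m) (\<lambda>t. X \<epsilon> t \<omega>)))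
           (add_measure
             (scale_measure (ennreal (- (bm 0 x0 $ d) / (bp 0 x0 $ d - bm 0 x0 $ d)))
               (return (borel_of path_topology) (stopped_path (min \<tau>p \<tau>m) Xm)))
             (scale_measure (ennreal (bp 0 x0 $ d / (bp 0 x0 $ d - bm 0 x0 $ d)))
               (return (borel_of path_topology) (stopped_path (min \<tau>p \<tau>m) Xp))))
           (at_right 0)"
proof -
  have prM: "prob_space M" using w unfolding wiener_process_def by blast
  interpret prob_space M by (rule prM)
  have x0d: "x0 $ d = 0" using x0 by (simp add: hyperplane_def)
  have limp: "((\<lambda>t. bp t x0 $ d) \<longlongrightarrow> bp 0 x0 $ d) (at_right 0)"
    using bp_right_continuous by (simp add: continuous_within)
  have limm: "((\<lambda>t. bm t x0 $ d) \<longlongrightarrow> bm 0 x0 $ d) (at_right 0)"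
    using bm_right_continuous by (simp add: continuous_within)
  obtain T \<delta> c where rep: "0 < T" "0 < \<delta>" "0 < c"
    "\<And>t x. t \<in> {0..T} \<Longrightarrow> x \<notin> hyperplane d \<Longrightarrow> norm (x - x0) \<le> \<delta> \<Longrightarrow> c \<le> sgn (x $ d) * (glued_drift d bp bm t x $ d)"
    using repulsive by blast
  have "c \<le> 1 * bp 0 x0 $ d"
  proof (rule drift_component_at_boundary[OF bp x0d _ _ rep(2)])
    fix x assume x: "0 < 1 * x $ d" "norm (x - x0) \<le> \<delta>"
    then show "c \<le> 1 * bp 0 x $ d" using rep(4)[of 0 x] rep(1) by (simp add: glued_drift_def hyperplane_def)
  qed auto
  then have qp: "0 < bp 0 x0 $ d" using rep(3) by simp
  have "c \<le> (- 1) * bm 0 x0 $ d"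
  proof (rule drift_component_at_boundary[OF bm x0d _ _ rep(2)])
    fix x assume x: "0 < (- 1) * x $ d" "norm (x - x0) \<le> \<delta>"
    then show "c \<le> (- 1) * bm 0 x $ d" using rep(4)[of 0 x] rep(1) by (simp add: glued_drift_def hyperplane_def)
  qed auto
  then have qm: "bm 0 x0 $ d < 0" using rep(3) by simp
  have up: "0 < 1 * Xp t $ d" if S: "ereal S \<le> \<tau>p" and t: "0 < t" "t < S" for S t
  proof (rule solution_enters_half_space[OF bp solves_until_return_noisy_path[OF bp Xp S] x0d _ limp _ _ t])
    fix s assume s: "0 < s" "s < S"
    then have "ereal s < ereal S" by simp
    then have "Xp s \<notin> hyperplane d" using solves_until_return_pos(2)[OF Xp s(1)] S by (meson less_le_trans)
    then show "Xp s $ d \<noteq> 0" by (simp add: hyperplane_def)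
  qed (use qp in auto)
  have down: "0 < (- 1) * Xm t $ d" if S: "ereal S \<le> \<tau>m" and t: "0 < t" "t < S" for S t
  proof (rule solution_enters_half_space[OF bm solves_until_return_noisy_path[OF bm Xm S] x0d _ limm _ _ t])
    fix s assume s: "0 < s" "s < S"
    then have "ereal s < ereal S" by simp
    then have "Xm s \<notin> hyperplane d" using solves_until_return_pos(2)[OF Xm s(1)] S by (meson less_le_trans)
    then show "Xm s $ d \<noteq> 0" by (simp add: hyperplane_def)
  qed (use qm in auto)
  define \<tau> where "\<tau> = min \<tau>p \<tau>m"
  have \<tau>: "0 < \<tau>" "\<tau> \<le> \<tau>p" "\<tau> \<le> \<tau>m"
    using solves_until_return_pos(1)[OF Xp] solves_until_return_pos(1)[OF Xm] by (auto simp: \<tau>_def)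
  let ?N = "borel_of (path_topology :: (real \<Rightarrow> real ^ 'n) topology)"
  let ?Q = "\<lambda>\<epsilon> \<omega>. stopped_path \<tau> (\<lambda>t. X \<epsilon> t \<omega>)"
  let ?fp = "stopped_path \<tau> Xp" and ?fm = "stopped_path \<tau> Xm"
  define p where "p = bp 0 x0 $ d / (bp 0 x0 $ d - bm 0 x0 $ d)"
  define q where "q = - (bm 0 x0 $ d) / (bp 0 x0 $ d - bm 0 x0 $ d)"
  have "p + q = 1"
    using qp qm by (simp add: p_def q_def diff_divide_distrib[symmetric])
  moreover have "0 \<le> p" "0 \<le> q"
    unfolding p_def q_def using qp qm by (intro divide_nonneg_nonneg; simp)+
  ultimately have pq: "q = 1 - p" "p + q = 1" "0 \<le> p" "p \<le> 1" by auto
  have fp: "?fp \<in> paths"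
  proof (rule stopped_path_in_paths[OF \<tau>(1)])
    have "continuous_on {t. 0 \<le> t \<and> ereal t \<le> \<tau>p} Xp" using Xp unfolding solves_until_return_def by blast
    then show "continuous_on {t. 0 \<le> t \<and> ereal t \<le> \<tau>} Xp" by (rule continuous_on_subset) (use \<tau> in auto)
  qed
  have fm: "?fm \<in> paths"
  proof (rule stopped_path_in_paths[OF \<tau>(1)])
    have "continuous_on {t. 0 \<le> t \<and> ereal t \<le> \<tau>m} Xm" using Xm unfolding solves_until_return_def by blast
    then show "continuous_on {t. 0 \<le> t \<and> ereal t \<le> \<tau>} Xm" by (rule continuous_on_subset) (use \<tau> in auto)
  qed
  have Xc: "continuous_on {0..} (\<lambda>t. X \<epsilon> t \<omega>)" if "0 < \<epsilon>" "\<omega> \<in> space M" for \<epsilon> \<omega>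
    using X[OF that(1)] that(2) unfolding strong_solution_def by blast
  have Qp: "?Q \<epsilon> \<omega> \<in> paths" if "0 < \<epsilon>" "\<omega> \<in> space M" for \<epsilon> \<omega>
    by (rule stopped_path_in_paths[OF \<tau>(1)], rule continuous_on_subset[OF Xc[OF that]]) auto
  have Qm: "?Q \<epsilon> \<in> measurable M ?N" if \<epsilon>: "0 < \<epsilon>" for \<epsilon>
  proof (rule measurable_borel_of_path_topology[OF Qp[OF \<epsilon>]])
    fix t :: real assume t: "0 \<le> t"
    show "(\<lambda>\<omega>. ?Q \<epsilon> \<omega> t) \<in> borel_measurable M"
      using strong_solution_measurable[OF w X[OF \<epsilon>] stopped_path_time(1)[OF \<tau>(1) t]] t
      by (simp add: stopped_path_def)
  qed
  let ?\<nu> = "distr (measure_pmf (bernoulli_pmf p)) ?N (\<lambda>b. if b then ?fp else ?fm)"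
  have \<nu>: "add_measure (scale_measure (ennreal q) (return ?N ?fm)) (scale_measure (ennreal p) (return ?N ?fp)) = ?\<nu>"
    using add_measure_return_eq_distr_bernoulli[OF pq(3,4), of ?fp ?N ?fm] fp fm
    by (simp add: topspace_path_topology pq(1))
  have hm: "(\<lambda>b. if b then ?fp else ?fm) \<in> measurable (measure_pmf (bernoulli_pmf p)) ?N"
    using fp fm by (auto simp: topspace_path_topology)
  have conv: "((\<lambda>\<epsilon>. LINT f|distr M ?N (?Q \<epsilon>). \<phi> f) \<longlongrightarrow> (LINT f|?\<nu>. \<phi> f)) (at_right 0)"
    if \<phi>: "continuous_map path_topology euclideanreal \<phi>" and bd: "bounded (\<phi> ` topspace path_topology)" for \<phi>
  proof (rule tendstoI)
    fix e' :: real assume e': "0 < e'"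
    obtain C0 where C0: "\<And>f. f \<in> paths \<Longrightarrow> \<bar>\<phi> f\<bar> \<le> C0"
      using bd unfolding bounded_real topspace_path_topology by blast
    define C where "C = \<bar>C0\<bar> + 1"
    have C: "\<And>f. f \<in> paths \<Longrightarrow> \<bar>\<phi> f\<bar> \<le> C" "0 < C" using C0 unfolding C_def by fastforce+
    have \<phi>m: "\<phi> \<in> borel_measurable ?N" by (rule borel_measurable_borel_of[OF \<phi>])
    have lim: "(LINT f|?\<nu>. \<phi> f) = p * \<phi> ?fp + q * \<phi> ?fm"
      using pq(3,4) by (subst integral_distr[OF hm \<phi>m]) (simp add: pq(1) algebra_simps)
    obtain Tp rp where Tp: "0 < Tp" "0 < rp"
      "\<And>g. g \<in> paths \<Longrightarrow> (\<forall>t\<in>{0..Tp}. dist (g t) (?fp t) < rp) \<Longrightarrow> \<bar>\<phi> g - \<phi> ?fp\<bar> < e' / 4"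
      using path_continuous_map_near[OF \<phi> fp, of "e' / 4"] e' by (metis zero_less_divide_iff zero_less_numeral)
    obtain Tm rm where Tm: "0 < Tm" "0 < rm"
      "\<And>g. g \<in> paths \<Longrightarrow> (\<forall>t\<in>{0..Tm}. dist (g t) (?fm t) < rm) \<Longrightarrow> \<bar>\<phi> g - \<phi> ?fm\<bar> < e' / 4"
      using path_continuous_map_near[OF \<phi> fm, of "e' / 4"] e' by (metis zero_less_divide_iff zero_less_numeral)
    define R where "R t = real_of_ereal (min (ereal t) \<tau>)" for t
    \<comment> \<open>On the time windows that matter for \<open>\<phi>\<close>, the stopped paths
      only read the original ones on \<open>{0..S}\<close>; and \<open>S\<close> exceeds neither
      return time, so both branches solve their equations there.\<close>
    define S where "S = R (max Tp Tm)"
    have S: "0 < S" using stopped_path_time(2)[OF \<tau>(1), of "max Tp Tm"] Tp(1) by (auto simp: S_def R_def)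
    have "ereal S \<le> \<tau>" unfolding S_def R_def by (rule stopped_path_time(3)[OF \<tau>(1)])
    then have Sp: "ereal S \<le> \<tau>p" and Sm: "ereal S \<le> \<tau>m" using \<tau> by (meson order_trans)+
    have RS: "R t \<in> {0..S}" if "0 \<le> t" "t \<le> Tp \<or> t \<le> Tm" for t
      using stopped_path_time(1)[OF \<tau>(1) that(1)] stopped_path_time(4)[OF \<tau>(1), of t "max Tp Tm"] that(2)
      by (auto simp: S_def R_def)
    \<comment> \<open>At \<open>S / 2\<close> the branches are strictly on opposite sides, whereas
      at \<open>S\<close> one or both may be back on the hyperplane. The bound
      \<open>2 * e < g\<close> then makes the two tubes disjoint.\<close>
    define g where "g = Xp (S / 2) $ d - Xm (S / 2) $ d"
    have g: "0 < g" using up[OF Sp, of "S / 2"] down[OF Sm, of "S / 2"] S by (simp add: g_def)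
    define e where "e = min (min (rp / 2) (rm / 2)) (g / 3)"
    have e: "0 < e" "e < rp" "e < rm" "2 * e < g" using g Tp(2) Tm(2) by (auto simp: e_def)
    define \<eta> where "\<eta> = e' / (16 * C)"
    have \<eta>: "0 < \<eta>" "4 * C * \<eta> = e' / 4" using e' C(2) by (auto simp: \<eta>_def)
    let ?A = "\<lambda>\<epsilon>. {\<omega> \<in> space M. \<forall>t\<in>{0..S}. norm (X \<epsilon> t \<omega> - Xp t) \<le> e}"
    let ?B = "\<lambda>\<epsilon>. {\<omega> \<in> space M. \<forall>t\<in>{0..S}. norm (X \<epsilon> t \<omega> - Xm t) \<le> e}"
    have evA: "\<forall>\<^sub>F \<epsilon> in at_right 0. bp 0 x0 $ d / (bp 0 x0 $ d + - (bm 0 x0 $ d)) - \<eta> \<le> prob (?A \<epsilon>)"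
    proof (rule branch_probability[where \<sigma> = 1 and d = d, OF bp bm _ _ _ w X x0d _ limp limm _ _ qp _ S _ _ e(1) \<eta>(1)])
      show "set_integrable lborel {0..S} (\<lambda>s. glued_drift d bp bm s (x s))" if "continuous_on {0..S} x" for x
        by (rule set_integrable_glued_drift[OF bp bm that])
      show "noisy_path bp x0 S (\<lambda>_. 0) Xp" by (rule solves_until_return_noisy_path[OF bp Xp Sp])
    qed (use qm up[OF Sp] in \<open>auto simp: glued_drift_def\<close>)
    \<comment> \<open>The other branch is the same estimate with the roles exchanged. The gluing
      assigns the hyperplane to \<open>bp\<close>, but \<open>branch_probability\<close> prescribes
      \<open>b\<close> only strictly inside the half-space of its branch and so applies to both
      signs.\<close>
    have evB: "\<forall>\<^sub>F \<epsilon> in at_right 0. - (bm 0 x0 $ d) / (- (bm 0 x0 $ d) + bp 0 x0 $ d) - \<eta> \<le> prob (?B \<epsilon>)"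
    proof (rule branch_probability[where \<sigma> = "-1" and d = d, OF bm bp _ _ _ w X x0d _ limm limp _ _ _ qp S _ _ e(1) \<eta>(1)])
      show "set_integrable lborel {0..S} (\<lambda>s. glued_drift d bp bm s (x s))" if "continuous_on {0..S} x" for x
        by (rule set_integrable_glued_drift[OF bp bm that])
      show "noisy_path bm x0 S (\<lambda>_. 0) Xm" by (rule solves_until_return_noisy_path[OF bm Xm Sm])
    qed (use qm down[OF Sm] in \<open>auto simp: glued_drift_def\<close>)
    have ev0: "\<forall>\<^sub>F \<epsilon> in at_right (0::real). 0 < \<epsilon>" by (rule eventually_at_right_less)
    show "\<forall>\<^sub>F \<epsilon> in at_right 0. dist (LINT f|distr M ?N (?Q \<epsilon>). \<phi> f) (LINT f|?\<nu>. \<phi> f) < e'"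
      using evA evB ev0
    proof eventually_elim
      case (elim \<epsilon>)
      note \<epsilon> = elim(3)
      have ms: "{\<omega> \<in> space M. \<forall>t\<in>{0..S}. norm (X \<epsilon> t \<omega> - x t) \<le> e} \<in> events" if x: "continuous_on {0..S} x" for x
      proof (rule sets_Collect_le_interval)
        fix t assume "t \<in> {0..S}"
        then have [measurable]: "X \<epsilon> t \<in> borel_measurable M" by (intro strong_solution_measurable[OF w X[OF \<epsilon>]]) auto
        show "(\<lambda>\<omega>. norm (X \<epsilon> t \<omega> - x t)) \<in> borel_measurable M" by measurable
      next
        fix \<omega> assume "\<omega> \<in> space M"
        then have "continuous_on {0..S} (\<lambda>t. X \<epsilon> t \<omega>)" by (intro continuous_on_subset[OF Xc[OF \<epsilon>]]) auto
        then show "continuous_on {0..S} (\<lambda>t. norm (X \<epsilon> t \<omega> - x t))" by (intro continuous_intros x)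
      qed
      have cp: "continuous_on {0..S} Xp" "continuous_on {0..S} Xm"
        using solves_until_return_noisy_path[OF bp Xp Sp] solves_until_return_noisy_path[OF bm Xm Sm]
        unfolding noisy_path_def by auto
      have "\<bar>expectation (\<lambda>\<omega>. \<phi> (?Q \<epsilon> \<omega>)) - (p * \<phi> ?fp + q * \<phi> ?fm)\<bar> \<le> e' / 4 + 4 * C * \<eta>"
      proof (rule expectation_near_two_values[OF _ _ ms[OF cp(1)] ms[OF cp(2)]])
        show "(\<lambda>\<omega>. \<phi> (?Q \<epsilon> \<omega>)) \<in> borel_measurable M" by (rule measurable_compose[OF Qm[OF \<epsilon>] \<phi>m])
        show "\<bar>\<phi> (?Q \<epsilon> \<omega>)\<bar> \<le> C" if "\<omega> \<in> space M" for \<omega> by (rule C(1)[OF Qp[OF \<epsilon> that]])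
        show "?A \<epsilon> \<inter> ?B \<epsilon> = {}"
        proof (rule ccontr)
          assume "?A \<epsilon> \<inter> ?B \<epsilon> \<noteq> {}"
          moreover have "S / 2 \<in> {0..S}" using S by simp
          ultimately obtain \<omega> where "norm (X \<epsilon> (S/2) \<omega> - Xp (S/2)) \<le> e" "norm (X \<epsilon> (S/2) \<omega> - Xm (S/2)) \<le> e"
            by blast
          then have "\<bar>(X \<epsilon> (S/2) \<omega> - Xp (S/2)) $ d\<bar> \<le> e" "\<bar>(X \<epsilon> (S/2) \<omega> - Xm (S/2)) $ d\<bar> \<le> e"
            using component_le_norm_cart order_trans by blast+
          then show False using e(4) unfolding g_def vector_minus_component by linarith
        qed
        show "\<bar>\<phi> (?Q \<epsilon> \<omega>) - \<phi> ?fp\<bar> \<le> e' / 4" if \<omega>: "\<omega> \<in> ?A \<epsilon>" for \<omega>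
        proof -
          have "\<forall>t\<in>{0..Tp}. dist (?Q \<epsilon> \<omega> t) (?fp t) < rp"
          proof
            fix t assume t: "t \<in> {0..Tp}"
            then have "norm (X \<epsilon> (R t) \<omega> - Xp (R t)) \<le> e" using \<omega> RS[of t] by auto
            then show "dist (?Q \<epsilon> \<omega> t) (?fp t) < rp" using t e(2) by (simp add: stopped_path_def dist_norm R_def)
          qed
          from Tp(3)[OF Qp[OF \<epsilon>] this] \<omega> show ?thesis by auto
        qed
        show "\<bar>\<phi> (?Q \<epsilon> \<omega>) - \<phi> ?fm\<bar> \<le> e' / 4" if \<omega>: "\<omega> \<in> ?B \<epsilon>" for \<omega>
        proof -
          have "\<forall>t\<in>{0..Tm}. dist (?Q \<epsilon> \<omega> t) (?fm t) < rm"
          proof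
            fix t assume t: "t \<in> {0..Tm}"
            then have "norm (X \<epsilon> (R t) \<omega> - Xm (R t)) \<le> e" using \<omega> RS[of t] by auto
            then show "dist (?Q \<epsilon> \<omega> t) (?fm t) < rm" using t e(3) by (simp add: stopped_path_def dist_norm R_def)
          qed
          from Tm(3)[OF Qp[OF \<epsilon>] this] \<omega> show ?thesis by auto
        qed
        show "p - \<eta> \<le> prob (?A \<epsilon>)" using elim(1) by (simp add: p_def)
        show "q - \<eta> \<le> prob (?B \<epsilon>)" using elim(2) by (simp add: q_def add.commute)
      qed (use C fp fm pq(2) e' in auto)
      moreover have "(LINT f|distr M ?N (?Q \<epsilon>). \<phi> f) = expectation (\<lambda>\<omega>. \<phi> (?Q \<epsilon> \<omega>))"
        by (rule integral_distr[OF Qm[OF \<epsilon>] \<phi>m])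
      ultimately show ?case using \<eta>(2) e' unfolding lim dist_real_def by linarith
    qed
  qed
  have "weakly_converges path_topology (\<lambda>\<epsilon>. distr M ?N (?Q \<epsilon>)) ?\<nu> (at_right 0)"
    unfolding weakly_converges_def
  proof (intro conjI allI impI)
    show "\<forall>\<^sub>F \<epsilon> in at_right 0. prob_space (distr M ?N (?Q \<epsilon>)) \<and> sets (distr M ?N (?Q \<epsilon>)) = sets ?N"
      using eventually_at_right_less[of "0::real"] by eventually_elim (auto intro: prob_space_distr Qm)
    show "prob_space ?\<nu>" by (rule prob_space.prob_space_distr[OF measure_pmf.prob_space_axioms hm])
  qed (auto intro: conv)
  moreover have "0 < Xp t $ d" if t: "0 < t" "ereal t < \<tau>p" for t
  proof -
    obtain S where "ereal t < ereal S" "ereal S < \<tau>p" using ereal_dense2[OF t(2)] by auto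
    then show ?thesis using up[of S t] t by (auto simp: less_imp_le)
  qed
  moreover have "Xm t $ d < 0" if t: "0 < t" "ereal t < \<tau>m" for t
  proof -
    obtain S where "ereal t < ereal S" "ereal S < \<tau>m" using ereal_dense2[OF t(2)] by auto
    then show ?thesis using down[of S t] t by (auto simp: less_imp_le)
  qed
  ultimately show ?thesis unfolding \<tau>_def[symmetric] \<nu>[unfolded p_def q_def, symmetric] p_def q_def by blast
qed

end
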